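(* Let $I,J\in\Lambda$ and let $p=\sum_if_ip_i\in\mathcal Q_q$ be a linear combination of paths $p_i$ from $I$ to $J$, where each $f_i\in\mathbb Z[q]$. If $\upsilon_{\emptyset,J}\,p\,\delta_{I,\emptyset}=0$ in $\mathcal Q_q/\langle\mathcal J\rangle$, then $p$ is $P$-torsion. Further, the ideal $\mathcal K$ is generated by $\mathcal J$ together with all such $P$-torsion elements $p$ (for all $I,J\in\Lambda$).
   Context: $(W,S)$ is a Coxeter system with $S$ finite and length function $\ell$. For $I\subseteq S$, $W_I=\langle I\rangle$; $I$ is finitary if $W_I$ is finite, with longest element $w_I$. $\Lambda$ is the set of finitary subsets (including $\emptyset$), $\Lambda^*=\Lambda\setminus\{\emptyset\}$; $I\sqsubset J$ means $I\subset J$, $|I|=|J|-1$. $H_q$ is the Hecke algebra over $\mathbb Z[q]$ with basis $T_w$, generated by $T_s$ ($s\in S$) with $T_s^2=(q-1)T_s+q$ and the braid relations. For $I\in\Lambda$, $x_I=\sum_{w\in W_I}T_w$, $\pi(I)=\sum_{w\in W_I}q^{\ell(w)}$, $x_s=x_{\{s\}}$. $E_q(W)=\mathrm{End}_{H_q}(\bigoplus_{I\in\Lambda}x_IH_q)$ (right modules). The Hasse quiver $\mathcal Q$ has vertex set $\Lambda$ (trivial paths $e_K$) and, for $I\sqsubset J$ in $\Lambda$, arrows $\upsilon_{I,J}$ from $J$ to $I$ and $\delta_{J,I}$ from $I$ to $J$. $\mathcal Q_q=\mathbb Z[q]\mathcal Q$ is the path algebra, where $\alpha\beta$ is concatenation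 if the starting vertex of $\alpha$ is the ending vertex of $\beta$ and $0$ otherwise. $\chi_s=\upsilon_{\emptyset,\{s\}}\delta_{\{s\},\emptyset}$. For an ordering $I_\bullet:\emptyset=I_0\sqsubset I_1\sqsubset\cdots\sqsubset I_m=I$ of $I\in\Lambda$ fix a reduced expression $w_I=s_l\cdots s_1$ such that each $w_{I_i}$ equals $s_{j_i}\cdots s_1$ for some $j_i$, and put $\underline w_{I_\bullet}=(s_l,\ldots,s_1)$. For a sequence $\underline y=(t_k,\ldots,t_1)$ put $x_{\underline y}=x_{t_k}\cdots x_{t_1}$, $\chi_{\underline y}=\chi_{t_k}\cdots\chi_{t_1}$; $\underline y<\underline w$ means $\underline y$ arises from $\underline w$ by removing some terms. Fix $a_{\underline y,\underline w_{I_\bullet}}\in\mathbb Z[q]$ (they exist) with $x_I=x_{\underline w_{I_\bullet}}+q\sum_{\underline y<\underline w_{I_\bullet}}a_{\underline y,\underline w_{I_\bullet}}x_{\underline y}$ in $H_q$ and set $\chi_{I_\bullet}=\chi_{\underline w_{I_\bullet}}+q\sum_{\underline y<\underline w_{I_\bullet}}a_{\underline y,\underline w_{I_\bullet}}\chi_{\underline y}$. $\mathcal J\subset\mathcal Q_q$ is the set of relations: quasi-idempotent relations $\delta_{J,I}\upsilon_{I,J}=\frac{\pi(J)}{\pi(I)}e_J$ for $I\sqsubset J$; sandwich relations $\upsilon_{I,J}\upsilon_{J,K}=\upsilon_{I,J'}\upsilon_{J',K}$ and $\delta_{K,J}\delta_{J,I}=\delta_{K,J'}\delta_{J',I}$ whenever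 $I\sqsubset J\sqsubset K$, $I\sqsubset J'\sqsubset K$; extended braid relations $\upsilon_{\emptyset,I_1}\cdots\upsilon_{I_{m-1},I}\delta_{I,I_{m-1}}\cdots\delta_{I_1,\emptyset}=\chi_{I_\bullet}$ for all $I\in\Lambda^*$ and orderings $I_\bullet$. There is a surjective algebra homomorphism $\psi:\mathcal Q_q/\langle\mathcal J\rangle\to E_q(W)$ sending $e_K$ to the identity of $x_KH_q$, $\upsilon_{I,J}$ to the inclusion $x_JH_q\to x_IH_q$, and $\delta_{J,I}$ to the map $x_IH_q\to x_JH_q$ given by left multiplication by $\sum_wT_w$ over $w\in W_J$ of minimal length in $wW_I$. $\mathcal K$ is the ideal of $\mathcal Q_q$ containing $\mathcal J$ such that $\ker\psi=\mathcal K/\langle\mathcal J\rangle$. $P$ is the set of polynomials in $\mathbb Z[q]$ with constant term $1$. A $P$-torsion element is an element of $\mathcal K/\langle\mathcal J\rangle$ annihilated by some polynomial in $P$ (an element of $\mathcal Q_q$ is called $P$-torsion if its class is). For $I\in\Lambda$ and any chain $\emptyset=I_0\sqsubset\cdots\sqsubset I_m=I$, $\upsilon_{\emptyset,I}=\upsilon_{\emptyset,I_1}\cdots\upsilon_{I_{m-1},I}$ and $\delta_{I,\emptyset}=\delta_{I,I_{m-1}}\cdots\delta_{I_1,\emptyset}$; modulo the sandwich relations these do not depend on the chain.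
   Formalization: In the second sentence, "all such P-torsion elements p" is taken as all P-torsion linear combinations of paths from I to J, without requiring υ_{∅,J} p δ_{I,∅} = 0; with that requirement the generation claim fails, e.g. for W = (Z/2)^3. *)

theory Defs
  imports
    "HOL-Algebra.Ideal"
    "HOL-Algebra.Generated_Groups"
    "HOL-Algebra.Multiplicative_Group"
    "HOL-Computational_Algebra.Polynomial"
    "HOL-Library.Sublist"
begin

section \<open>Coxeter systems\<close>

definition word_prod :: "('w, 'm) monoid_scheme \<Rightarrow> 'w list \<Rightarrow> 'w" where
  "word_prod W ws = foldr (\<lambda>s w. s \<otimes>\<^bsub>W\<^esub> w) ws \<one>\<^bsub>W\<^esub>"

text \<open>
  The congruence on words generated by the relations \<open>(s t)^m = 1\<close>, where \<open>m\<close> is the order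
  of \<open>s t\<close> in \<open>W\<close>. The case \<open>s = t\<close> gives the relation \<open>s s = 1\<close>. If \<open>s t\<close> has infinite order,
  then \<open>ord\<close> is \<open>0\<close> and the relation is void.
\<close>
inductive cox_equiv :: "('w, 'm) monoid_scheme \<Rightarrow> 'w set \<Rightarrow> 'w list \<Rightarrow> 'w list \<Rightarrow> bool"
  for W :: "('w, 'm) monoid_scheme" and S :: "'w set" where
  rel: "\<lbrakk>s \<in> S; t \<in> S; set us \<subseteq> S; set vs \<subseteq> S\<rbrakk> \<Longrightarrow>
    cox_equiv W S (us @ concat (replicate (group.ord W (s \<otimes>\<^bsub>W\<^esub> t)) [s, t]) @ vs) (us @ vs)"
| refl: "cox_equiv W S us us"
| sym: "cox_equiv W S us vs \<Longrightarrow> cox_equiv W S vs us"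
| trans: "cox_equiv W S us vs \<Longrightarrow> cox_equiv W S vs ws \<Longrightarrow> cox_equiv W S us ws"

text \<open>
  \<open>W\<close> is presented by the generators \<open>S\<close>, which are involutions, and the relations \<open>(s t)^m = 1\<close>.
  Since each \<open>s \<in> S\<close> is its own inverse, words in \<open>S\<close> without formal inverses suffice.
\<close>
definition coxeter_system :: "('w, 'm) monoid_scheme \<Rightarrow> 'w set \<Rightarrow> bool" where
  "coxeter_system W S \<longleftrightarrow>
     group W \<and> S \<subseteq> carrier W \<and> generate W S = carrier W \<and>
     (\<forall>s\<in>S. group.ord W s = 2) \<and>
     (\<forall>us vs. set us \<subseteq> S \<longrightarrow> set vs \<subseteq> S \<longrightarrow> word_prod W us = word_prod W vs
        \<longrightarrow> cox_equiv W S us vs)"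

definition len :: "('w, 'm) monoid_scheme \<Rightarrow> 'w set \<Rightarrow> 'w \<Rightarrow> nat" where
  "len W S w = (LEAST n. \<exists>ws. set ws \<subseteq> S \<and> word_prod W ws = w \<and> length ws = n)"

definition reduced_expr :: "('w, 'm) monoid_scheme \<Rightarrow> 'w set \<Rightarrow> 'w \<Rightarrow> 'w list \<Rightarrow> bool" where
  "reduced_expr W S w ws \<longleftrightarrow> set ws \<subseteq> S \<and> word_prod W ws = w \<and> length ws = len W S w"

definition finitary :: "('w, 'm) monoid_scheme \<Rightarrow> 'w set \<Rightarrow> 'w set set" where
  "finitary W S = {I. I \<subseteq> S \<and> finite (generate W I)}"

definition longest :: "('w, 'm) monoid_scheme \<Rightarrow> 'w set \<Rightarrow> 'w set \<Rightarrow> 'w" where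
  "longest W S I =
     (THE w. w \<in> generate W I \<and> (\<forall>v \<in> generate W I. len W S v \<le> len W S w))"

definition min_coset_reps :: "('w, 'm) monoid_scheme \<Rightarrow> 'w set \<Rightarrow> 'w set \<Rightarrow> 'w set \<Rightarrow> 'w set" where
  "min_coset_reps W S J I =
     {w \<in> generate W J. \<forall>v \<in> l_coset W w (generate W I). len W S w \<le> len W S v}"

definition covers :: "'w set \<Rightarrow> 'w set \<Rightarrow> bool" where
  "covers I J \<longleftrightarrow> I \<subset> J \<and> card J = card I + 1"

text \<open>An ordering of \<open>I\<close>: the list \<open>[I\<^sub>0, \<dots>, I\<^sub>m]\<close> with \<open>I\<^sub>0 = {}\<close>, \<open>I\<^sub>m = I\<close> and consecutive covers.\<close>
definition is_ordering ::
    "('w, 'm) monoid_scheme \<Rightarrow> 'w set \<Rightarrow> 'w set \<Rightarrow> 'w set list \<Rightarrow> bool" where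
  "is_ordering W S I cs \<longleftrightarrow>
     cs \<noteq> [] \<and> hd cs = {} \<and> last cs = I \<and> set cs \<subseteq> finitary W S \<and> successively covers cs"

text \<open>
  A list \<open>[s\<^sub>l, \<dots>, s\<^sub>1]\<close> is read as the word \<open>s\<^sub>l \<cdots> s\<^sub>1\<close>, so the words \<open>s\<^sub>j \<cdots> s\<^sub>1\<close> are its suffixes.
\<close>
definition adapted_expr ::
    "('w, 'm) monoid_scheme \<Rightarrow> 'w set \<Rightarrow> 'w set list \<Rightarrow> 'w list \<Rightarrow> bool" where
  "adapted_expr W S cs ws \<longleftrightarrow>
     reduced_expr W S (longest W S (last cs)) ws \<and>
     (\<forall>I \<in> set cs. \<exists>k \<le> length ws. word_prod W (drop k ws) = longest W S I)"

section \<open>The Hecke algebra\<close>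

text \<open>
  Elements of free \<open>\<int>[q]\<close>-modules are finitely supported functions from the basis to \<open>\<int>[q]\<close>.
\<close>
definition qvar :: "int poly" where
  "qvar = [:0, 1:]"

definition basis_elt :: "'x \<Rightarrow> 'x \<Rightarrow> int poly" where
  "basis_elt x = (\<lambda>y. if y = x then 1 else 0)"

definition scal :: "int poly \<Rightarrow> ('x \<Rightarrow> int poly) \<Rightarrow> 'x \<Rightarrow> int poly" where
  "scal f a = (\<lambda>x. f * a x)"

definition free_module :: "'x set \<Rightarrow> ('x \<Rightarrow> int poly) set" where
  "free_module B = {a. finite {x. a x \<noteq> 0} \<and> {x. a x \<noteq> 0} \<subseteq> B}"

text \<open>
  \<open>T\<^sub>s T\<^sub>w = T\<^bsub>sw\<^esub>\<close> if \<open>\<ell>(sw) > \<ell>(w)\<close>. Otherwise \<open>T\<^sub>w = T\<^sub>s T\<^bsub>sw\<^esub>\<close>, and the quadratic relation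
  \<open>T\<^sub>s\<^sup>2 = (q-1) T\<^sub>s + q\<close> gives \<open>T\<^sub>s T\<^sub>w = (q-1) T\<^sub>w + q T\<^bsub>sw\<^esub>\<close>.
\<close>
definition gen_times_basis ::
    "('w, 'm) monoid_scheme \<Rightarrow> 'w set \<Rightarrow> 'w \<Rightarrow> 'w \<Rightarrow> 'w \<Rightarrow> int poly" where
  "gen_times_basis W S s w =
     (if len W S (s \<otimes>\<^bsub>W\<^esub> w) > len W S w then basis_elt (s \<otimes>\<^bsub>W\<^esub> w)
      else (\<lambda>v. (qvar - 1) * basis_elt w v + qvar * basis_elt (s \<otimes>\<^bsub>W\<^esub> w) v))"

definition gen_times ::
    "('w, 'm) monoid_scheme \<Rightarrow> 'w set \<Rightarrow> 'w \<Rightarrow> ('w \<Rightarrow> int poly) \<Rightarrow> 'w \<Rightarrow> int poly" where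
  "gen_times W S s h = (\<lambda>v. \<Sum>w | h w \<noteq> 0. h w * gen_times_basis W S s w v)"

text \<open>
  \<open>T\<^sub>w = T\<^bsub>s\<^sub>1\<^esub> \<cdots> T\<^bsub>s\<^sub>l\<^esub>\<close> for any reduced expression of \<open>w\<close>; by Matsumoto's theorem the choice of
  expression does not matter.
\<close>
definition basis_times ::
    "('w, 'm) monoid_scheme \<Rightarrow> 'w set \<Rightarrow> 'w \<Rightarrow> ('w \<Rightarrow> int poly) \<Rightarrow> 'w \<Rightarrow> int poly" where
  "basis_times W S w h = foldr (gen_times W S) (SOME ws. reduced_expr W S w ws) h"

definition hecke :: "('w, 'm) monoid_scheme \<Rightarrow> 'w set \<Rightarrow> ('w \<Rightarrow> int poly) ring" where
  "hecke W S =
     \<lparr> carrier = free_module (carrier W),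
       monoid.mult = (\<lambda>a b v. \<Sum>w | a w \<noteq> 0. a w * basis_times W S w b v),
       one = basis_elt \<one>\<^bsub>W\<^esub>,
       zero = (\<lambda>_. 0),
       add = (\<lambda>a b v. a v + b v) \<rparr>"

definition x_elt :: "('w, 'm) monoid_scheme \<Rightarrow> 'w set \<Rightarrow> 'w \<Rightarrow> int poly" where
  "x_elt W I = (\<lambda>v. \<Sum>w \<in> generate W I. basis_elt w v)"

definition x_word :: "('w, 'm) monoid_scheme \<Rightarrow> 'w set \<Rightarrow> 'w list \<Rightarrow> 'w \<Rightarrow> int poly" where
  "x_word W S ys =
     foldr (\<lambda>s h. x_elt W {s} \<otimes>\<^bsub>hecke W S\<^esub> h) ys \<one>\<^bsub>hecke W S\<^esub>"

definition poincare :: "('w, 'm) monoid_scheme \<Rightarrow> 'w set \<Rightarrow> 'w set \<Rightarrow> int poly" where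
  "poincare W S I = (\<Sum>w \<in> generate W I. qvar ^ len W S w)"

section \<open>The endomorphism algebra\<close>

definition x_ideal :: "('w, 'm) monoid_scheme \<Rightarrow> 'w set \<Rightarrow> 'w set \<Rightarrow> ('w \<Rightarrow> int poly) set" where
  "x_ideal W S I = {x_elt W I \<otimes>\<^bsub>hecke W S\<^esub> h | h. h \<in> carrier (hecke W S)}"

text \<open>The direct sum of the right modules \<open>x\<^sub>I H\<close>, \<open>I\<close> finitary, as families with finite index set.\<close>
definition x_sum :: "('w, 'm) monoid_scheme \<Rightarrow> 'w set \<Rightarrow> ('w set \<Rightarrow> 'w \<Rightarrow> int poly) set" where
  "x_sum W S = {m. (\<forall>I \<in> finitary W S. m I \<in> x_ideal W S I) \<and>
                   (\<forall>I. I \<notin> finitary W S \<longrightarrow> m I = \<zero>\<^bsub>hecke W S\<^esub>)}"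

definition madd :: "('i \<Rightarrow> 'w \<Rightarrow> int poly) \<Rightarrow> ('i \<Rightarrow> 'w \<Rightarrow> int poly) \<Rightarrow> 'i \<Rightarrow> 'w \<Rightarrow> int poly" where
  "madd m n = (\<lambda>I v. m I v + n I v)"

definition mact :: "('w, 'm) monoid_scheme \<Rightarrow> 'w set \<Rightarrow>
    ('w set \<Rightarrow> 'w \<Rightarrow> int poly) \<Rightarrow> ('w \<Rightarrow> int poly) \<Rightarrow> 'w set \<Rightarrow> 'w \<Rightarrow> int poly" where
  "mact W S m h = (\<lambda>I. m I \<otimes>\<^bsub>hecke W S\<^esub> h)"

definition E_alg :: "('w, 'm) monoid_scheme \<Rightarrow> 'w set \<Rightarrow>
    (('w set \<Rightarrow> 'w \<Rightarrow> int poly) \<Rightarrow> 'w set \<Rightarrow> 'w \<Rightarrow> int poly) ring" where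
  "E_alg W S =
     \<lparr> carrier = {f \<in> x_sum W S \<rightarrow>\<^sub>E x_sum W S.
          (\<forall>m \<in> x_sum W S. \<forall>n \<in> x_sum W S. f (madd m n) = madd (f m) (f n)) \<and>
          (\<forall>m \<in> x_sum W S. \<forall>h \<in> carrier (hecke W S). f (mact W S m h) = mact W S (f m) h)},
       monoid.mult = (\<lambda>f g. compose (x_sum W S) f g),
       one = (\<lambda>m \<in> x_sum W S. m),
       zero = (\<lambda>m \<in> x_sum W S. \<lambda>_ _. 0),
       add = (\<lambda>f g. \<lambda>m \<in> x_sum W S. madd (f m) (g m)) \<rparr>"

section \<open>The path algebra of the Hasse quiver\<close>

text \<open>\<open>Ups I J\<close> is the arrow \<open>\<upsilon>\<^bsub>I,J\<^esub>\<close> from \<open>J\<close> to \<open>I\<close>; \<open>Del J I\<close> is \<open>\<delta>\<^bsub>J,I\<^esub>\<close> from \<open>I\<close> to \<open>J\<close>.\<close>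
datatype 'w arrow = Ups "'w set" "'w set" | Del "'w set" "'w set"

fun asrc :: "'w arrow \<Rightarrow> 'w set" where
  "asrc (Ups I J) = J"
| "asrc (Del J I) = I"

fun atgt :: "'w arrow \<Rightarrow> 'w set" where
  "atgt (Ups I J) = I"
| "atgt (Del J I) = J"

definition arrows :: "('w, 'm) monoid_scheme \<Rightarrow> 'w set \<Rightarrow> 'w arrow set" where
  "arrows W S =
     {Ups I J | I J. I \<in> finitary W S \<and> J \<in> finitary W S \<and> covers I J} \<union>
     {Del J I | I J. I \<in> finitary W S \<and> J \<in> finitary W S \<and> covers I J}"

text \<open>
  A path is the list of its arrows, last traversed first, together with its starting vertex.
\<close>
type_synonym 'w path = "'w arrow list \<times> 'w set"

fun psrc :: "'w path \<Rightarrow> 'w set" where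
  "psrc (as, K) = K"

fun ptgt :: "'w path \<Rightarrow> 'w set" where
  "ptgt ([], K) = K"
| "ptgt (a # as, K) = atgt a"

fun is_path :: "('w, 'm) monoid_scheme \<Rightarrow> 'w set \<Rightarrow> 'w path \<Rightarrow> bool" where
  "is_path W S ([], K) \<longleftrightarrow> K \<in> finitary W S"
| "is_path W S (a # as, K) \<longleftrightarrow> a \<in> arrows W S \<and> asrc a = ptgt (as, K) \<and> is_path W S (as, K)"

fun pconc :: "'w path \<Rightarrow> 'w path \<Rightarrow> 'w path" where
  "pconc (as, K) (bs, L) = (as @ bs, L)"

definition path_alg :: "('w, 'm) monoid_scheme \<Rightarrow> 'w set \<Rightarrow> ('w path \<Rightarrow> int poly) ring" where
  "path_alg W S =
     \<lparr> carrier = free_module {p. is_path W S p},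
       monoid.mult = (\<lambda>x y r. \<Sum>a | x a \<noteq> 0. \<Sum>b | y b \<noteq> 0.
                 if psrc a = ptgt b \<and> pconc a b = r then x a * y b else 0),
       one = (\<lambda>r. \<Sum>K \<in> finitary W S. basis_elt ([], K) r),
       zero = (\<lambda>_. 0),
       add = (\<lambda>x y r. x r + y r) \<rparr>"

definition e_path :: "'w set \<Rightarrow> 'w path \<Rightarrow> int poly" where
  "e_path K = basis_elt ([], K)"

definition ups :: "'w set \<Rightarrow> 'w set \<Rightarrow> 'w path \<Rightarrow> int poly" where
  "ups I J = basis_elt ([Ups I J], J)"

definition del :: "'w set \<Rightarrow> 'w set \<Rightarrow> 'w path \<Rightarrow> int poly" where
  "del J I = basis_elt ([Del J I], I)"

text \<open>For \<open>cs = [I\<^sub>0, \<dots>, I\<^sub>m]\<close>: the path \<open>\<upsilon>\<^bsub>I\<^sub>0,I\<^sub>1\<^esub> \<cdots> \<upsilon>\<^bsub>I\<^sub>m\<^sub>-\<^sub>1,I\<^sub>m\<^esub>\<close>, trivial if \<open>m = 0\<close>.\<close>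
definition ups_chain :: "'w set list \<Rightarrow> 'w path \<Rightarrow> int poly" where
  "ups_chain cs = basis_elt (map2 Ups cs (tl cs), last cs)"

text \<open>For \<open>cs = [I\<^sub>0, \<dots>, I\<^sub>m]\<close>: the path \<open>\<delta>\<^bsub>I\<^sub>m,I\<^sub>m\<^sub>-\<^sub>1\<^esub> \<cdots> \<delta>\<^bsub>I\<^sub>1,I\<^sub>0\<^esub>\<close>, trivial if \<open>m = 0\<close>.\<close>
definition del_chain :: "'w set list \<Rightarrow> 'w path \<Rightarrow> int poly" where
  "del_chain cs = basis_elt (rev (map2 Del (tl cs) cs), hd cs)"

text \<open>
  The empty product is the trivial path at \<open>{}\<close>. This convention is harmless: the one-dimensional
  representation \<open>T\<^sub>s \<mapsto> -1\<close> kills all \<open>x\<^sub>s\<close> and all \<open>x\<^sub>I\<close> with \<open>I \<noteq> {}\<close>, so the coefficient of the empty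
  word in any expression of such an \<open>x\<^sub>I\<close> as below is \<open>0\<close>.
\<close>
definition chi_word :: "('w, 'm) monoid_scheme \<Rightarrow> 'w set \<Rightarrow> 'w list \<Rightarrow> 'w path \<Rightarrow> int poly" where
  "chi_word W S ys =
     foldr (\<lambda>s x. (ups {} {s} \<otimes>\<^bsub>path_alg W S\<^esub> del {s} {}) \<otimes>\<^bsub>path_alg W S\<^esub> x) ys (e_path {})"

text \<open>
  \<open>f\<^bsub>ws\<^esub> + q \<Sum> a\<^bsub>y,ws\<^esub> f\<^sub>y\<close>, the sum being over the sequences \<open>y\<close> obtained from \<open>ws\<close> by removing some
  terms.
\<close>
definition subword_comb ::
    "('w list \<Rightarrow> 'w list \<Rightarrow> int poly) \<Rightarrow> ('w list \<Rightarrow> 'x \<Rightarrow> int poly) \<Rightarrow> 'w list \<Rightarrow> 'x \<Rightarrow> int poly" where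
  "subword_comb a f ws =
     (\<lambda>r. f ws r + qvar * (\<Sum>ys | strict_subseq ys ws. a ys ws * f ys r))"

text \<open>
  \<open>\<pi>(I)\<close> divides \<open>\<pi>(J)\<close> in \<open>\<int>[q]\<close>, so \<open>div\<close> is the exact quotient. Here and below, a relation \<open>x = y\<close> is
  recorded as the element \<open>x - y\<close>.
\<close>
definition quasi_idempotent_rels ::
    "('w, 'm) monoid_scheme \<Rightarrow> 'w set \<Rightarrow> ('w path \<Rightarrow> int poly) set" where
  "quasi_idempotent_rels W S =
     {(del J I \<otimes>\<^bsub>path_alg W S\<^esub> ups I J)
        \<ominus>\<^bsub>path_alg W S\<^esub> scal (poincare W S J div poincare W S I) (e_path J) | I J.
      I \<in> finitary W S \<and> J \<in> finitary W S \<and> covers I J}"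

definition sandwich_rels ::
    "('w, 'm) monoid_scheme \<Rightarrow> 'w set \<Rightarrow> ('w path \<Rightarrow> int poly) set" where
  "sandwich_rels W S =
     (\<Union>(I, J, J', K) \<in> {(I, J, J', K). {I, J, J', K} \<subseteq> finitary W S \<and>
           covers I J \<and> covers J K \<and> covers I J' \<and> covers J' K}.
        {(ups I J \<otimes>\<^bsub>path_alg W S\<^esub> ups J K)
           \<ominus>\<^bsub>path_alg W S\<^esub> (ups I J' \<otimes>\<^bsub>path_alg W S\<^esub> ups J' K),
         (del K J \<otimes>\<^bsub>path_alg W S\<^esub> del J I)
           \<ominus>\<^bsub>path_alg W S\<^esub> (del K J' \<otimes>\<^bsub>path_alg W S\<^esub> del J' I)})"

text \<open>
  \<open>rex cs\<close> is the fixed reduced expression for the ordering \<open>cs\<close>, and \<open>a\<close> the fixed coefficients.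
\<close>
definition braid_rels :: "('w, 'm) monoid_scheme \<Rightarrow> 'w set \<Rightarrow> ('w set list \<Rightarrow> 'w list) \<Rightarrow>
    ('w list \<Rightarrow> 'w list \<Rightarrow> int poly) \<Rightarrow> ('w path \<Rightarrow> int poly) set" where
  "braid_rels W S rex a =
     {(ups_chain cs \<otimes>\<^bsub>path_alg W S\<^esub> del_chain cs)
        \<ominus>\<^bsub>path_alg W S\<^esub> subword_comb a (chi_word W S) (rex cs) | I cs.
      I \<in> finitary W S - {{}} \<and> is_ordering W S I cs}"

definition J_rels :: "('w, 'm) monoid_scheme \<Rightarrow> 'w set \<Rightarrow> ('w set list \<Rightarrow> 'w list) \<Rightarrow>
    ('w list \<Rightarrow> 'w list \<Rightarrow> int poly) \<Rightarrow> ('w path \<Rightarrow> int poly) set" where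
  "J_rels W S rex a = quasi_idempotent_rels W S \<union> sandwich_rels W S \<union> braid_rels W S rex a"

section \<open>The homomorphism to the endomorphism algebra\<close>

fun psi_arrow :: "('w, 'm) monoid_scheme \<Rightarrow> 'w set \<Rightarrow> 'w arrow \<Rightarrow>
    ('w set \<Rightarrow> 'w \<Rightarrow> int poly) \<Rightarrow> 'w set \<Rightarrow> 'w \<Rightarrow> int poly" where
  "psi_arrow W S (Ups I J) m = (\<lambda>L. if L = I then m J else \<zero>\<^bsub>hecke W S\<^esub>)"
| "psi_arrow W S (Del J I) m =
     (\<lambda>L. if L = J then (\<lambda>v. \<Sum>w \<in> min_coset_reps W S J I. basis_elt w v) \<otimes>\<^bsub>hecke W S\<^esub> m I
          else \<zero>\<^bsub>hecke W S\<^esub>)"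

fun psi_path :: "('w, 'm) monoid_scheme \<Rightarrow> 'w set \<Rightarrow> 'w path \<Rightarrow>
    ('w set \<Rightarrow> 'w \<Rightarrow> int poly) \<Rightarrow> 'w set \<Rightarrow> 'w \<Rightarrow> int poly" where
  "psi_path W S ([], K) m = (\<lambda>L. if L = K then m K else \<zero>\<^bsub>hecke W S\<^esub>)"
| "psi_path W S (a # as, K) m = psi_arrow W S a (psi_path W S (as, K) m)"

text \<open>The composite of \<open>\<psi>\<close> with the quotient map from the path algebra.\<close>
definition psi :: "('w, 'm) monoid_scheme \<Rightarrow> 'w set \<Rightarrow> ('w path \<Rightarrow> int poly) \<Rightarrow>
    ('w set \<Rightarrow> 'w \<Rightarrow> int poly) \<Rightarrow> 'w set \<Rightarrow> 'w \<Rightarrow> int poly" where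
  "psi W S x = (\<lambda>m \<in> x_sum W S. \<lambda>L v. \<Sum>p | x p \<noteq> 0. x p * psi_path W S p m L v)"

definition K_ideal :: "('w, 'm) monoid_scheme \<Rightarrow> 'w set \<Rightarrow> ('w path \<Rightarrow> int poly) set" where
  "K_ideal W S = a_kernel (path_alg W S) (E_alg W S) (psi W S)"

section \<open>\<open>P\<close>-torsion\<close>

definition P_polys :: "int poly set" where
  "P_polys = {f. Polynomial.coeff f 0 = 1}"

definition P_torsion :: "('w, 'm) monoid_scheme \<Rightarrow> 'w set \<Rightarrow> ('w set list \<Rightarrow> 'w list) \<Rightarrow>
    ('w list \<Rightarrow> 'w list \<Rightarrow> int poly) \<Rightarrow> ('w path \<Rightarrow> int poly) \<Rightarrow> bool" where
  "P_torsion W S rex a x \<longleftrightarrow>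
     x \<in> K_ideal W S \<and>
     (\<exists>f \<in> P_polys. scal f x \<in> Idl\<^bsub>path_alg W S\<^esub> (J_rels W S rex a))"

text \<open>
  Linear combinations of paths from \<open>I\<close> to \<open>J\<close>. The kernel ideal is generated by the relations and
  all \<open>P\<close>-torsion elements of this form; those with \<open>\<upsilon>\<^bsub>{},J\<^esub> p \<delta>\<^bsub>I,{}\<^esub> = 0\<close> alone do not suffice, for
  instance when \<open>W\<close> is elementary abelian of order 8.
\<close>
definition path_combs ::
    "('w, 'm) monoid_scheme \<Rightarrow> 'w set \<Rightarrow> 'w set \<Rightarrow> 'w set \<Rightarrow> ('w path \<Rightarrow> int poly) set" where
  "path_combs W S I J = free_module {r. is_path W S r \<and> psrc r = I \<and> ptgt r = J}"

end

theory Submission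
  imports Defs "HOL-Library.Function_Algebras"
begin

text \<open>
  Modulo the quasi-idempotent relations, \<open>\<delta>\<^bsub>J,{}\<^esub> \<upsilon>\<^bsub>{},J\<^esub> = \<pi>(J) e\<^sub>J\<close> by telescoping, and \<open>\<pi>(J)\<close> has constant
  term \<open>1\<close>. So \<open>\<pi>(J) \<pi>(I) p\<close> is a multiple of \<open>\<upsilon>\<^bsub>{},J\<^esub> p \<delta>\<^bsub>I,{}\<^esub>\<close>, and \<open>p\<close> is torsion as soon as the latter is
  annihilated by a polynomial with constant term \<open>1\<close>.

  Conversely let \<open>p\<close> be in the kernel. Inserting \<open>\<delta>\<^bsub>K,{}\<^esub> \<upsilon>\<^bsub>{},K\<^esub>\<close> at every vertex \<open>K\<close> of a path, the sandwich and
  braid relations turn a multiple \<open>f \<upsilon>\<^bsub>{},J\<^esub> p \<delta>\<^bsub>I,{}\<^esub>\<close> into a polynomial in the loops \<open>\<chi>\<^sub>s\<close>. The elements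
  \<open>\<tau>\<^sub>s = \<chi>\<^sub>s - e\<^bsub>{}\<^esub>\<close> satisfy the quadratic relation of the Hecke algebra, and also the braid relations: for
  finitary \<open>{s, t}\<close> the two orderings give two expressions for the same loop, with leading terms the two
  reduced words of the longest element. Hence the products \<open>\<tau>\<^sub>w\<close> span, their images \<open>T\<^sub>w\<close> are linearly
  independent, and the polynomial in the loops, being in the kernel, vanishes modulo the relations.
\<close>

section \<open>Exchange in Coxeter groups\<close>

text \<open>The obstacle is that \<open>tau\<close> is not handed its braid relations. The extended
  braid relations for the two orderings of \<open>{s, t}\<close> equate the two reduced words only
  up to shorter words whose coefficients \<open>a\<close> are arbitrary. Shorter words can be
  compared only after they are rewritten as combinations of the \<open>tau_red w\<close>, and this
  rewriting already uses that the choice of reduced word does not matter. So independence of the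
  word and rewriting advance together, by induction on length, and the unknown coefficients are
  never computed: a combination of the \<open>tau_red w\<close> that kills \<open>T \<one>\<close>
  is zero.

  Everything is moved to the vertex \<open>{}\<close> because \<open>x_elt W {}\<close> is
  \<open>T \<one>\<close>. The module there is all of \<open>H\<close>, so the kernel can be tested
  on \<open>T \<one>\<close>. The price of the move is one factor \<open>\<pi> K\<close> for each
  inserted vertex, and such factors stay in \<open>P_polys\<close> because that set is closed under
  products.

  The product of the Hecke algebra is built on a chosen reduced expression. Its associativity comes
  from left and right multiplication operators that commute, and the exchange condition behind this
  comes from the presentation by counting reflections modulo 2.\<close>

locale coxeter_group =
  fixes W :: "('w, 'm) monoid_scheme" (structure) and S :: "'w set"
  assumes coxeter: "coxeter_system W S" and finite_S: "finite S"

sublocale coxeter_group \<subseteq> group W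
  using coxeter by (simp add: coxeter_system_def)

context coxeter_group
begin

abbreviation wp :: "'w list \<Rightarrow> 'w" where "wp \<equiv> word_prod W"
abbreviation lenW :: "'w \<Rightarrow> nat" ("\<ell>") where "\<ell> \<equiv> len W S"

lemma S_carrier: "s \<in> S \<Longrightarrow> s \<in> carrier W"
  using coxeter by (auto simp: coxeter_system_def)

lemma gen_sq: "s \<in> S \<Longrightarrow> s \<otimes> s = \<one>"
  using coxeter pow_ord_eq_1[of s] S_carrier[of s]
  by (auto simp: coxeter_system_def numeral_2_eq_2)

lemma gen_ne_one: "s \<in> S \<Longrightarrow> s \<noteq> \<one>"
  using coxeter ord_eq_1[of s] by (auto simp: coxeter_system_def)

lemma gen_inv: "s \<in> S \<Longrightarrow> inv s = s"
  using gen_sq S_carrier inv_equality by blast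

lemma gen_cancel: "s \<in> S \<Longrightarrow> w \<in> carrier W \<Longrightarrow> s \<otimes> (s \<otimes> w) = w"
  by (simp add: m_assoc[symmetric] gen_sq S_carrier)

lemma gen_cancel_right: "s \<in> S \<Longrightarrow> w \<in> carrier W \<Longrightarrow> w \<otimes> s \<otimes> s = w"
  by (simp add: m_assoc gen_sq S_carrier)

lemma gen_move: "s \<in> S \<Longrightarrow> v \<in> carrier W \<Longrightarrow> w \<in> carrier W \<Longrightarrow> s \<otimes> v = w \<longleftrightarrow> v = s \<otimes> w"
  using gen_cancel by auto

section \<open>Words in the generators and their lengths\<close>

lemma wp_Nil [simp]: "wp [] = \<one>"
  and wp_Cons [simp]: "wp (s # ws) = s \<otimes> wp ws"
  by (simp_all add: word_prod_def)

lemma wp_closed [simp]: "set ws \<subseteq> S \<Longrightarrow> wp ws \<in> carrier W"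
  by (induction ws) (auto simp: S_carrier)

lemma wp_append: "set us \<subseteq> S \<Longrightarrow> set vs \<subseteq> S \<Longrightarrow> wp (us @ vs) = wp us \<otimes> wp vs"
  by (induction us) (auto simp: S_carrier m_assoc)

lemma wp_rev: "set ws \<subseteq> S \<Longrightarrow> wp (rev ws) = inv (wp ws)"
  by (induction ws) (auto simp: wp_append S_carrier inv_mult_group gen_inv)

lemma generate_iff_word:
  assumes "I \<subseteq> S"
  shows "w \<in> generate W I \<longleftrightarrow> (\<exists>ws. set ws \<subseteq> I \<and> wp ws = w)"
proof
  assume "w \<in> generate W I"
  then show "\<exists>ws. set ws \<subseteq> I \<and> wp ws = w"
  proof (induction rule: generate.induct)
    case one
    show ?case by (intro exI[of _ "[]"]) simp
  next
    case (incl h)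
    then show ?case using assms by (intro exI[of _ "[h]"]) (auto simp: S_carrier)
  next
    case (inv h)
    then show ?case using assms by (intro exI[of _ "[h]"]) (auto simp: S_carrier gen_inv)
  next
    case (eng h1 h2)
    then obtain us vs where "set us \<subseteq> I" "wp us = h1" "set vs \<subseteq> I" "wp vs = h2" by blast
    then show ?case using assms
      by (intro exI[of _ "us @ vs"]) (auto simp: wp_append)
  qed
next
  have "wp ws \<in> generate W I" if "set ws \<subseteq> I" for ws
    using that by (induction ws) (auto intro: generate.intros)
  then show "\<exists>ws. set ws \<subseteq> I \<and> wp ws = w \<Longrightarrow> w \<in> generate W I" by blast
qed

lemma generate_closed: "I \<subseteq> S \<Longrightarrow> w \<in> generate W I \<Longrightarrow> w \<in> carrier W"
  using generate_iff_word by (metis wp_closed subset_trans)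

lemma ex_word: "w \<in> carrier W \<Longrightarrow> \<exists>ws. set ws \<subseteq> S \<and> wp ws = w"
  using coxeter generate_iff_word[of S w] by (auto simp: coxeter_system_def)

lemma ex_reduced:
  assumes "w \<in> carrier W"
  shows "\<exists>ws. reduced_expr W S w ws"
proof -
  obtain ws0 where "set ws0 \<subseteq> S" "wp ws0 = w" using ex_word[OF assms] by blast
  then have "\<exists>n ws. set ws \<subseteq> S \<and> wp ws = w \<and> length ws = n" by blast
  then have "\<exists>ws. set ws \<subseteq> S \<and> wp ws = w \<and> length ws = \<ell> w"
    unfolding len_def by (rule LeastI_ex)
  then show ?thesis by (auto simp: reduced_expr_def)
qed

lemma len_le: "set ws \<subseteq> S \<Longrightarrow> \<ell> (wp ws) \<le> length ws"
  unfolding len_def by (rule Least_le) blast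

lemma len_one [simp]: "\<ell> \<one> = 0"
  using len_le[of "[]"] by simp

lemma len_eq_0: "w \<in> carrier W \<Longrightarrow> \<ell> w = 0 \<longleftrightarrow> w = \<one>"
  using ex_reduced[of w] by (auto simp: reduced_expr_def)

lemma len_inv:
  assumes "w \<in> carrier W"
  shows "\<ell> (inv w) = \<ell> w"
proof -
  have le: "\<ell> (inv v) \<le> \<ell> v" if v: "v \<in> carrier W" for v
  proof -
    obtain ws where "set ws \<subseteq> S" "wp ws = v" "length ws = \<ell> v"
      using ex_reduced[OF v] by (auto simp: reduced_expr_def)
    then show ?thesis using len_le[of "rev ws"] by (simp add: wp_rev)
  qed
  from le[OF assms] le[of "inv w"] assms show ?thesis by simp
qed

lemma len_mult_le:
  assumes "v \<in> carrier W" "w \<in> carrier W"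
  shows "\<ell> (v \<otimes> w) \<le> \<ell> v + \<ell> w"
proof -
  obtain us vs where "set us \<subseteq> S" "wp us = v" "length us = \<ell> v"
      "set vs \<subseteq> S" "wp vs = w" "length vs = \<ell> w"
    using ex_reduced[OF assms(1)] ex_reduced[OF assms(2)] by (auto simp: reduced_expr_def)
  then show ?thesis using len_le[of "us @ vs"] by (simp add: wp_append)
qed

text \<open>
  The reflections \<open>s\<^sub>1 \<cdots> s\<^bsub>i-1\<^esub> s\<^sub>i s\<^bsub>i-1\<^esub> \<cdots> s\<^sub>1\<close> of a word. The parity of the number of occurrences of a
  reflection depends only on the product of the word; this is what the presentation is used for.
\<close>
fun invs :: "'w list \<Rightarrow> 'w list" where
  "invs [] = []"
| "invs (s # ws) = s # map (\<lambda>r. s \<otimes> r \<otimes> inv s) (invs ws)"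

lemma invs_closed: "set ws \<subseteq> S \<Longrightarrow> set (invs ws) \<subseteq> carrier W"
  by (induction ws) (auto simp: S_carrier)

lemma invs_append:
  "set us \<subseteq> S \<Longrightarrow> set vs \<subseteq> S \<Longrightarrow>
    invs (us @ vs) = invs us @ map (\<lambda>r. wp us \<otimes> r \<otimes> inv (wp us)) (invs vs)"
proof (induction us)
  case Nil
  have "map (\<lambda>r. \<one> \<otimes> r \<otimes> inv \<one>) (invs vs) = invs vs"
    using invs_closed[OF Nil(2)] by (intro map_idI) auto
  then show ?case by simp
next
  case (Cons s us)
  have "s \<otimes> (wp us \<otimes> r \<otimes> inv (wp us)) \<otimes> inv s = s \<otimes> wp us \<otimes> r \<otimes> inv (s \<otimes> wp us)"
    if "r \<in> set (invs vs)" for r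
    using that Cons.prems invs_closed[OF Cons.prems(2)]
    by (auto simp: S_carrier inv_mult_group m_assoc subset_eq)
  then show ?case using Cons by simp
qed

lemma wp_concat_replicate:
  assumes "s \<in> S" "t \<in> S"
  shows "wp (concat (replicate n [s, t])) = (s \<otimes> t) [^] n"
proof (induction n)
  case (Suc n)
  then show ?case using assms nat_pow_Suc2[of "s \<otimes> t" n] by (simp add: S_carrier m_assoc)
qed simp

lemma invs_concat_replicate:
  assumes "s \<in> S" "t \<in> S"
  shows "invs (concat (replicate n [s, t])) = map (\<lambda>i. (s \<otimes> t) [^] i \<otimes> s) [0..<2 * n]"
proof (induction n)
  case (Suc n)
  let ?p = "s \<otimes> t"
  note car = S_carrier[OF assms(1)] S_carrier[OF assms(2)]
  have conj: "s \<otimes> (t \<otimes> ((s \<otimes> t) [^] i \<otimes> s) \<otimes> inv t) \<otimes> inv s = (s \<otimes> t) [^] Suc (Suc i) \<otimes> s" for i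
  proof -
    have "(s \<otimes> t) [^] Suc (Suc i) \<otimes> s = (s \<otimes> t) [^] Suc i \<otimes> (s \<otimes> t) \<otimes> s"
      by simp
    also have "(s \<otimes> t) [^] Suc i = s \<otimes> t \<otimes> (s \<otimes> t) [^] i"
      using car by (simp only: nat_pow_Suc2 m_closed)
    finally show ?thesis using car by (simp add: m_assoc gen_inv assms)
  qed
  have "invs (concat (replicate (Suc n) [s, t]))
      = s # (s \<otimes> t \<otimes> inv s) # map (\<lambda>i. (s \<otimes> t) [^] Suc (Suc i) \<otimes> s) [0..<2 * n]"
  proof -
    have "invs (concat (replicate (Suc n) [s, t])) = s # (s \<otimes> t \<otimes> inv s) #
        map (\<lambda>r. s \<otimes> (t \<otimes> r \<otimes> inv t) \<otimes> inv s) (invs (concat (replicate n [s, t])))"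
      by (simp add: comp_def)
    then show ?thesis by (simp only: Suc map_map comp_def conj)
  qed
  also have "\<dots> = map (\<lambda>i. (s \<otimes> t) [^] i \<otimes> s) [0..<2 * Suc n]"
  proof -
    have "[0..<2 * Suc n] = 0 # 1 # map (\<lambda>i. Suc (Suc i)) [0..<2 * n]"
      by (simp add: upt_conv_Cons map_Suc_upt[symmetric] comp_def del: upt_Suc)
    then show ?thesis using car by (simp add: gen_inv assms comp_def del: upt_Suc)
  qed
  finally show ?case .
qed simp

lemma odd_count_invs_cong:
  assumes "cox_equiv W S us vs"
  shows "odd (count_list (invs us) r) = odd (count_list (invs vs) r)"
  using assms
proof induction
  case (rel s t us vs)
  let ?m = "ord (s \<otimes> t)" and ?f = "\<lambda>i. (s \<otimes> t) [^] i \<otimes> s"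
  let ?c = "concat (replicate ?m [s, t])"
  have st: "s \<otimes> t \<in> carrier W" using rel by (simp add: S_carrier)
  have c1: "wp ?c = \<one>" using rel st by (simp add: wp_concat_replicate pow_ord_eq_1)
  have cS: "set ?c \<subseteq> S" using rel by auto
  have "[0..<2 * ?m] = [0..<?m] @ map (\<lambda>i. i + ?m) [0..<?m]"
    using upt_add_eq_append[of 0 ?m ?m] by (simp add: map_add_upt mult_2)
  moreover have "?f (i + ?m) = ?f i" for i
    using st pow_ord_eq_1[OF st] nat_pow_mult[OF st, of i ?m, symmetric] by simp
  \<comment> \<open>As \<open>(s t)^m = 1\<close>, the list of \<open>2 m\<close> reflections has
    period \<open>m\<close>. Each reflection occurs in it an even number of times, so inserting the
    relator changes no parity.\<close>
  ultimately have "invs ?c = map ?f [0..<?m] @ map ?f [0..<?m]"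
    using rel by (simp add: invs_concat_replicate comp_def)
  moreover have "invs (us @ ?c @ vs) =
     invs us @ map (\<lambda>r. wp us \<otimes> r \<otimes> inv (wp us)) (invs ?c) @
       map (\<lambda>r. wp us \<otimes> r \<otimes> inv (wp us)) (invs vs)"
  proof -
    have "wp (us @ ?c) = wp us" using rel cS wp_append[of us ?c] c1 by simp
    then show ?thesis
      using rel cS invs_append[of "us @ ?c" vs] invs_append[of us ?c] by (simp only: append_assoc) auto
  qed
  ultimately have "count_list (invs (us @ ?c @ vs)) r = count_list (invs (us @ vs)) r +
      2 * count_list (map (\<lambda>r. wp us \<otimes> r \<otimes> inv (wp us)) (map ?f [0..<?m])) r"
    using invs_append[OF rel(3,4)] by (simp only: count_list_append map_append mult_2 ac_simps)
  then show ?case by simp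
qed auto

lemma odd_count_invs_wp:
  assumes "set us \<subseteq> S" "set vs \<subseteq> S" "wp us = wp vs"
  shows "odd (count_list (invs us) r) = odd (count_list (invs vs) r)"
  using assms coxeter by (intro odd_count_invs_cong) (auto simp: coxeter_system_def)

section \<open>Deletion and the exchange condition\<close>

definition drop_nth :: "nat \<Rightarrow> 'a list \<Rightarrow> 'a list" where
  "drop_nth i ws = take i ws @ drop (Suc i) ws"

lemma length_drop_nth: "i < length ws \<Longrightarrow> length (drop_nth i ws) = length ws - 1"
  by (auto simp: drop_nth_def)

lemma set_drop_nth: "set (drop_nth i ws) \<subseteq> set ws"
  by (auto simp: drop_nth_def dest: in_set_takeD in_set_dropD)

lemma drop_nth_append:
  "drop_nth i (us @ vs) = (if i < length us then drop_nth i us @ vs else us @ drop_nth (i - length us) vs)"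
  by (auto simp: drop_nth_def Suc_diff_le)

text \<open>A reflection in the list is \<open>u s inv u\<close>, where \<open>s\<close> is a letter
  and \<open>u\<close> the product of the letters before it. Multiplying by it from the left cancels
  exactly that letter.\<close>

lemma invs_deletion:
  assumes "set ws \<subseteq> S" "r \<in> set (invs ws)"
  shows "\<exists>i < length ws. r \<otimes> wp ws = wp (drop_nth i ws)"
  using assms
proof (induction ws arbitrary: r)
  case (Cons s ws)
  note car = S_carrier[of s] wp_closed[of ws]
  consider "r = s" | r' where "r' \<in> set (invs ws)" "r = s \<otimes> r' \<otimes> inv s" using Cons.prems by auto
  then show ?case
  proof cases
    case 1
    then show ?thesis using Cons.prems car
      by (intro exI[of _ 0]) (simp add: drop_nth_def gen_cancel)
  next
    case (2 r')
    then obtain i where i: "i < length ws" "r' \<otimes> wp ws = wp (drop_nth i ws)"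
      using Cons by auto
    have r': "r' \<in> carrier W" using 2(1) invs_closed[of ws] Cons.prems by auto
    have "r \<otimes> wp (s # ws) = s \<otimes> (r' \<otimes> wp ws)"
      using 2 r' Cons.prems car by (simp add: m_assoc gen_inv gen_cancel)
    also have "\<dots> = wp (drop_nth (Suc i) (s # ws))" using i by (simp add: drop_nth_def)
    finally show ?thesis using i(1) by (intro exI[of _ "Suc i"]) simp
  qed
qed simp

text \<open>Conjugation by \<open>s\<close> fixes \<open>s\<close>, so the old occurrences of
  \<open>s\<close> are kept, and the new first letter adds one.\<close>

lemma odd_count_invs_mult:
  assumes "s \<in> S" "set ws \<subseteq> S"
  shows "odd (count_list (invs (s # ws)) s) \<longleftrightarrow> even (count_list (invs ws) s)"
proof -
  have *: "s \<otimes> r \<otimes> s = s \<longleftrightarrow> r = s" if "r \<in> carrier W" for r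
    using that assms S_carrier[of s] gen_sq[of s]
    by (metis m_assoc m_closed r_one gen_cancel gen_cancel_right l_one)
  have "count_list (map (\<lambda>r. s \<otimes> r \<otimes> inv s) rs) s = count_list rs s" if "set rs \<subseteq> carrier W" for rs
    using that by (induction rs) (auto simp: gen_inv assms *)
  then show ?thesis using invs_closed[OF assms(2)] by simp
qed

text \<open>The parity of \<open>s\<close> among the reflections decides everything. If it is odd,
  \<open>s\<close> occurs in every word of \<open>w\<close>, and a letter can be deleted. If it is
  even, it is odd for \<open>s w\<close>, and the same argument goes from \<open>s w\<close> down to
  \<open>w\<close>.\<close>

lemma len_gen_mult_cases:
  assumes "s \<in> S" "w \<in> carrier W"
  shows "\<ell> (s \<otimes> w) = Suc (\<ell> w) \<or> \<ell> w = Suc (\<ell> (s \<otimes> w))"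
    and "\<ell> (s \<otimes> w) < \<ell> w \<Longrightarrow> set ws \<subseteq> S \<Longrightarrow> wp ws = w \<Longrightarrow>
      \<exists>i < length ws. s \<otimes> w = wp (drop_nth i ws)"
proof -
  have dec: "\<ell> (s \<otimes> v) < \<ell> v \<and> (\<exists>i < length ws. s \<otimes> v = wp (drop_nth i ws))"
    if ws: "set ws \<subseteq> S" "wp ws = v" "odd (count_list (invs ws) s)" for v ws
  proof -
    have "v \<in> carrier W" using that by auto
    then obtain us where us: "set us \<subseteq> S" "wp us = v" "length us = \<ell> v"
      using ex_reduced by (auto simp: reduced_expr_def)
    have "odd (count_list (invs us) s)" using odd_count_invs_wp[of us ws] us that by simp
    then have "s \<in> set (invs us)" "s \<in> set (invs ws)"
      using that(3) count_list_0_iff[of _ s] by (metis even_zero)+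
    then obtain i j where i: "i < length us" "s \<otimes> v = wp (drop_nth i us)"
      and j: "j < length ws" "s \<otimes> v = wp (drop_nth j ws)"
      using invs_deletion[of us s] invs_deletion[of ws s] us(1,2) ws(1,2) by auto
    have "\<ell> (s \<otimes> v) \<le> length (drop_nth i us)"
      unfolding i(2) using us set_drop_nth[of i us] by (intro len_le) auto
    then show ?thesis using i j us by (auto simp: length_drop_nth)
  qed
  obtain us where us: "set us \<subseteq> S" "wp us = w" using ex_word assms by blast
  have sw: "s \<otimes> w \<in> carrier W" using assms S_carrier by simp
  have inc: "\<ell> w < \<ell> (s \<otimes> w)" if "even (count_list (invs us) s)"
    using dec[of "s # us" "s \<otimes> w"] us that odd_count_invs_mult[of s us] assms
    by (auto simp: gen_cancel)
  have s1: "\<ell> s \<le> 1" using len_le[of "[s]"] assms S_carrier[of s] by simp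
  have "\<ell> (s \<otimes> w) \<le> Suc (\<ell> w)"
    using len_mult_le[of s w] s1 assms S_carrier[of s] by simp
  moreover have "\<ell> w \<le> Suc (\<ell> (s \<otimes> w))"
    using len_mult_le[of s "s \<otimes> w"] s1 assms S_carrier[of s] sw by (simp add: gen_cancel)
  moreover have "\<ell> w \<noteq> \<ell> (s \<otimes> w)" using dec[of us w] inc us by (cases "odd (count_list (invs us) s)") auto
  ultimately show "\<ell> (s \<otimes> w) = Suc (\<ell> w) \<or> \<ell> w = Suc (\<ell> (s \<otimes> w))" by linarith
  assume lt: "\<ell> (s \<otimes> w) < \<ell> w" and ws: "set ws \<subseteq> S" "wp ws = w"
  have "odd (count_list (invs us) s)" using inc lt by auto
  then have "odd (count_list (invs ws) s)" using odd_count_invs_wp[of us ws] us ws by simp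
  then show "\<exists>i < length ws. s \<otimes> w = wp (drop_nth i ws)" using dec ws by blast
qed

lemmas exchange_left = len_gen_mult_cases(2)

lemma len_mult_gen_cases:
  assumes "s \<in> S" "w \<in> carrier W"
  shows "\<ell> (w \<otimes> s) = Suc (\<ell> w) \<or> \<ell> w = Suc (\<ell> (w \<otimes> s))"
proof -
  have "\<ell> (s \<otimes> inv w) = \<ell> (w \<otimes> s)"
    using len_inv[of "w \<otimes> s"] assms S_carrier[of s] by (simp add: inv_mult_group gen_inv)
  then show ?thesis using len_gen_mult_cases(1)[of s "inv w"] assms len_inv by simp
qed

lemma exchange_right:
  assumes "s \<in> S" "set ws \<subseteq> S" "\<ell> (wp ws \<otimes> s) < \<ell> (wp ws)"
  shows "\<exists>i < length ws. wp ws \<otimes> s = wp (drop_nth i ws)"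
proof -
  have w: "wp ws \<in> carrier W" "s \<in> carrier W" using assms S_carrier by auto
  have "s \<otimes> inv (wp ws) = inv (wp ws \<otimes> s)" using w assms by (simp add: inv_mult_group gen_inv)
  then obtain i where i: "i < length ws" "inv (wp ws \<otimes> s) = wp (drop_nth i (rev ws))"
    using exchange_left[of s "inv (wp ws)" "rev ws"] assms w len_inv[of "wp ws"] len_inv[of "wp ws \<otimes> s"]
    by (auto simp: wp_rev)
  have rv: "rev (drop_nth i (rev ws)) = drop_nth (length ws - Suc i) ws"
    using i(1) by (simp add: drop_nth_def rev_take rev_drop Suc_diff_Suc)
  have "wp ws \<otimes> s = inv (wp (drop_nth i (rev ws)))" using i(2) w by (metis inv_inv m_closed)
  also have "\<dots> = wp (drop_nth (length ws - Suc i) ws)"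
    using assms(2) set_drop_nth[of i "rev ws"] by (subst rv[symmetric], subst wp_rev) auto
  finally show ?thesis using i(1) by (intro exI[of _ "length ws - Suc i"]) auto
qed

section \<open>Reduced expressions in parabolic subgroups\<close>

lemma reduced_exprD:
  assumes "reduced_expr W S w ws"
  shows "set ws \<subseteq> S" "wp ws = w" "length ws = \<ell> w" "w \<in> carrier W"
  using assms by (auto simp: reduced_expr_def)

lemma reduced_append:
  assumes "reduced_expr W S w (us @ vs)"
  shows "reduced_expr W S (wp us) us" "reduced_expr W S (wp vs) vs"
proof -
  have S: "set us \<subseteq> S" "set vs \<subseteq> S" using assms by (auto simp: reduced_expr_def)
  have "length us + length vs = \<ell> (wp us \<otimes> wp vs)"
    using assms S by (auto simp: reduced_expr_def wp_append)
  moreover have "\<ell> (wp us \<otimes> wp vs) \<le> \<ell> (wp us) + \<ell> (wp vs)" using S by (intro len_mult_le) auto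
  moreover have "\<ell> (wp us) \<le> length us" "\<ell> (wp vs) \<le> length vs" using S len_le by auto
  ultimately show "reduced_expr W S (wp us) us" "reduced_expr W S (wp vs) vs"
    using S by (auto simp: reduced_expr_def)
qed

lemma reduced_additive:
  assumes "reduced_expr W S v us" "reduced_expr W S w vs" "\<ell> (v \<otimes> w) = \<ell> v + \<ell> w"
  shows "reduced_expr W S (v \<otimes> w) (us @ vs)"
  using assms by (auto simp: reduced_expr_def wp_append)

text \<open>Build a word in \<open>I\<close> letter by letter from the right. When a new letter
  shortens the element, exchange deletes a letter, so letters outside \<open>I\<close> never
  enter.\<close>

lemma reduced_in_parabolic:
  assumes "I \<subseteq> S" "w \<in> generate W I"
  shows "\<exists>ws. reduced_expr W S w ws \<and> set ws \<subseteq> I"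
proof -
  have "\<exists>vs. reduced_expr W S (wp ws) vs \<and> set vs \<subseteq> I" if "set ws \<subseteq> I" for ws
    using that
  proof (induction ws)
    case Nil
    show ?case by (intro exI[of _ "[]"]) (simp add: reduced_expr_def)
  next
    case (Cons s ws)
    then obtain vs where vs: "reduced_expr W S (wp ws) vs" "set vs \<subseteq> I" by auto
    note v = reduced_exprD[OF vs(1)]
    have s: "s \<in> S" "s \<in> I" using Cons.prems assms by auto
    show ?case
    proof (cases "\<ell> (s \<otimes> wp ws) = Suc (\<ell> (wp ws))")
      case True
      then show ?thesis using vs v s by (intro exI[of _ "s # vs"]) (auto simp: reduced_expr_def)
    next
      case False
      then have lt: "\<ell> (wp ws) = Suc (\<ell> (s \<otimes> wp ws))"
        using len_gen_mult_cases(1)[OF s(1) v(4)] by auto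
      then obtain i where "i < length vs" "s \<otimes> wp ws = wp (drop_nth i vs)"
        using exchange_left[OF s(1) v(4) _ v(1,2)] by auto
      then show ?thesis using set_drop_nth[of i vs] v vs(2) lt
        by (intro exI[of _ "drop_nth i vs"]) (auto simp: reduced_expr_def length_drop_nth)
    qed
  qed
  moreover obtain ws where "set ws \<subseteq> I" "wp ws = w"
    using assms(2) generate_iff_word[OF assms(1), of w] by blast
  ultimately show ?thesis by auto
qed

lemma mult_inv_eq:
  "v \<otimes> w = u \<Longrightarrow> v \<in> carrier W \<Longrightarrow> w \<in> carrier W \<Longrightarrow> v = u \<otimes> inv w"
  by (auto simp: m_assoc)

lemma subgroup_generate: "I \<subseteq> S \<Longrightarrow> subgroup (generate W I) W"
  using generate_is_subgroup S_carrier by blast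

lemma generate_mult: "I \<subseteq> S \<Longrightarrow> v \<in> generate W I \<Longrightarrow> w \<in> generate W I \<Longrightarrow> v \<otimes> w \<in> generate W I"
  and generate_inv: "I \<subseteq> S \<Longrightarrow> v \<in> generate W I \<Longrightarrow> inv v \<in> generate W I"
  and generate_one: "I \<subseteq> S \<Longrightarrow> \<one> \<in> generate W I"
  by (simp_all add: subgroup_generate subgroup.m_closed subgroup.m_inv_closed subgroup.one_closed)

lemma generate_wp: "I \<subseteq> S \<Longrightarrow> set ws \<subseteq> I \<Longrightarrow> wp ws \<in> generate W I"
  by (subst generate_iff_word) auto

lemma generate_gen: "s \<in> I \<Longrightarrow> s \<in> generate W I"
  by (rule generate.incl)

text \<open>Compare with one reduced expression in \<open>I\<close>. Exchange puts the tail
  \<open>wp ws\<close> into the parabolic subgroup, hence also the first letter \<open>s\<close>.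
  Being of length 1, \<open>s\<close> has a reduced expression in \<open>I\<close> with one letter,
  which must be \<open>s\<close> itself.\<close>

lemma reduced_letters:
  assumes "I \<subseteq> S" "reduced_expr W S w ws" "w \<in> generate W I"
  shows "set ws \<subseteq> I"
  using assms(2,3)
proof (induction ws arbitrary: w)
  case (Cons s ws)
  note red = reduced_exprD[OF Cons.prems(1)]
  have s: "s \<in> S" "set ws \<subseteq> S" using red(1) by auto
  have w: "w = s \<otimes> wp ws" using red(2) by simp
  have "reduced_expr W S (wp ws) ws" using Cons.prems(1) reduced_append(2)[of w "[s]" ws] by simp
  then have len: "\<ell> (wp ws) < \<ell> w" using red(3) by (auto simp: reduced_expr_def)
  obtain vs where vs: "reduced_expr W S w vs" "set vs \<subseteq> I"
    using reduced_in_parabolic[OF assms(1) Cons.prems(2)] by blast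
  have sw: "s \<otimes> w = wp ws" using s w by (simp add: gen_cancel)
  then obtain i where "wp ws = wp (drop_nth i vs)"
    using exchange_left[OF s(1) red(4), of vs] len reduced_exprD[OF vs(1)] by auto
  then have ws_in: "wp ws \<in> generate W I"
    using generate_wp[OF assms(1), of "drop_nth i vs"] set_drop_nth[of i vs] vs(2) by auto
  have "s = w \<otimes> inv (wp ws)" using s w by (simp add: m_assoc S_carrier)
  then have "s \<in> generate W I"
    using generate_mult[OF assms(1) Cons.prems(2) generate_inv[OF assms(1) ws_in]] by simp
  then obtain us where us: "reduced_expr W S s us" "set us \<subseteq> I"
    using reduced_in_parabolic[OF assms(1)] by blast
  have "\<ell> s \<le> 1" using len_le[of "[s]"] s S_carrier[of s] by simp
  moreover have "\<ell> s \<noteq> 0" using gen_ne_one[OF s(1)] len_eq_0[of s] S_carrier[OF s(1)] by blast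
  ultimately have "length us = 1" using us(1) by (auto simp: reduced_expr_def)
  then obtain t where "us = [t]" by (metis One_nat_def length_0_conv length_Suc_conv)
  then have "s \<in> I" using us assms(1) by (auto simp: reduced_expr_def S_carrier subset_eq)
  then show ?case using Cons.IH[OF \<open>reduced_expr W S (wp ws) ws\<close> ws_in] by simp
qed simp

section \<open>Cosets of parabolic subgroups\<close>

definition coset_min :: "'w set \<Rightarrow> 'w \<Rightarrow> bool" where
  "coset_min I z \<longleftrightarrow> z \<in> carrier W \<and> (\<forall>v \<in> generate W I. \<ell> z \<le> \<ell> (z \<otimes> v))"

text \<open>Append the letters of a reduced word of \<open>v\<close> one at a time. If the length
  dropped, exchange would delete a letter of \<open>z\<close>, giving a shorter element of the same
  coset, or a letter of the part of \<open>v\<close> already read, contradicting that its word is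
  reduced.\<close>

lemma coset_min_additive:
  assumes I: "I \<subseteq> S" and z: "coset_min I z" and v: "v \<in> generate W I"
  shows "\<ell> (z \<otimes> v) = \<ell> z + \<ell> v"
proof -
  have zc: "z \<in> carrier W" using z by (simp add: coset_min_def)
  obtain zs where zs: "reduced_expr W S z zs" using ex_reduced[OF zc] by blast
  have "\<ell> (z \<otimes> wp vs) = \<ell> z + length vs"
    if "reduced_expr W S (wp vs) vs" "set vs \<subseteq> I" for vs
    using that
  proof (induction vs rule: rev_induct)
    case (snoc s vs)
    have s: "s \<in> S" "set vs \<subseteq> S" using snoc.prems I by auto
    have red: "reduced_expr W S (wp vs) vs" using reduced_append(1)[OF snoc.prems(1)] .
    have IH: "\<ell> (z \<otimes> wp vs) = \<ell> z + length vs" using snoc.IH[OF red] snoc.prems(2) by simp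
    have vc: "wp vs \<in> carrier W" "s \<in> carrier W" using s S_carrier by auto
    have zv: "z \<otimes> wp vs = wp (zs @ vs)" using reduced_exprD[OF zs] s by (simp add: wp_append)
    note vgen = generate_wp[OF I]
    have "\<not> \<ell> (z \<otimes> wp vs \<otimes> s) < \<ell> (z \<otimes> wp vs)"
    proof
      assume "\<ell> (z \<otimes> wp vs \<otimes> s) < \<ell> (z \<otimes> wp vs)"
      then obtain i where i: "i < length (zs @ vs)" "z \<otimes> wp vs \<otimes> s = wp (drop_nth i (zs @ vs))"
        using exchange_right[of s "zs @ vs"] s zv reduced_exprD(1)[OF zs] by auto
      show False
      proof (cases "i < length zs")
        case True
        let ?z = "wp (drop_nth i zs)"
        have S': "set (drop_nth i zs) \<subseteq> S" using reduced_exprD(1)[OF zs] set_drop_nth[of i zs] by auto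
        then have "z \<otimes> wp vs \<otimes> s = ?z \<otimes> wp vs"
          using i True s by (simp add: drop_nth_append wp_append)
        from mult_inv_eq[OF this[symmetric]] have "?z = z \<otimes> (wp vs \<otimes> s \<otimes> inv (wp vs))"
          using zc vc S' by (simp add: m_assoc)
        moreover have "wp vs \<otimes> s \<otimes> inv (wp vs) \<in> generate W I"
          using I snoc.prems(2) vgen generate_gen[of s I] by (auto intro!: generate_mult generate_inv)
        ultimately have "\<ell> z \<le> \<ell> ?z" using z by (auto simp: coset_min_def)
        moreover have "\<ell> ?z < \<ell> z" using len_le[OF S'] length_drop_nth[OF True] True reduced_exprD(3)[OF zs] by simp
        ultimately show False by simp
      next
        case False
        let ?v = "drop_nth (i - length zs) vs"
        have S': "set ?v \<subseteq> S" using s set_drop_nth[of "i - length zs" vs] by auto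
        have "z \<otimes> (wp vs \<otimes> s) = z \<otimes> wp ?v"
          using i(2) False S' reduced_exprD[OF zs] zc vc by (simp add: drop_nth_append wp_append m_assoc)
        then have "wp vs \<otimes> s = wp ?v" using zc vc S' by simp
        then have "\<ell> (wp (vs @ [s])) \<le> length ?v" using len_le[OF S'] s vc by (simp add: wp_append)
        moreover have "length ?v < length vs" using i(1) False by (subst length_drop_nth) auto
        ultimately show False using snoc.prems(1) by (auto simp: reduced_expr_def)
      qed
    qed
    then have "\<ell> (z \<otimes> wp vs \<otimes> s) = Suc (\<ell> (z \<otimes> wp vs))"
      using len_mult_gen_cases[of s "z \<otimes> wp vs"] s zc vc by auto
    then show ?case using IH s zc vc by (simp add: wp_append m_assoc)
  qed (use zc in simp)
  moreover obtain vs where vs: "reduced_expr W S v vs" "set vs \<subseteq> I"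
    using reduced_in_parabolic[OF I v] by blast
  moreover note reduced_exprD[OF vs(1)]
  ultimately show ?thesis by metis
qed

lemma coset_decomp:
  assumes I: "I \<subseteq> S" and w: "w \<in> carrier W"
  shows "\<exists>z d. coset_min I z \<and> d \<in> generate W I \<and> w = z \<otimes> d"
proof -
  obtain v where v: "v \<in> generate W I" "\<And>u. u \<in> generate W I \<Longrightarrow> \<ell> (w \<otimes> v) \<le> \<ell> (w \<otimes> u)"
    using ex_has_least_nat[of "\<lambda>v. v \<in> generate W I" \<one> "\<lambda>v. \<ell> (w \<otimes> v)"] generate_one[OF I] by blast
  have vc: "v \<in> carrier W" using v generate_closed[OF I] by blast
  have "coset_min I (w \<otimes> v)"
    using v w vc I generate_mult[OF I v(1)] generate_closed[OF I]
    by (auto simp: coset_min_def m_assoc)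
  moreover have "w = (w \<otimes> v) \<otimes> inv v" using w vc by (simp add: m_assoc)
  ultimately show ?thesis using generate_inv[OF I v(1)] by blast
qed

text \<open>For \<open>u = v inv v'\<close> additivity gives
  \<open>\<ell> z' = \<ell> z + \<ell> u\<close>, while minimality of \<open>z'\<close> gives
  \<open>\<ell> z' \<le> \<ell> z\<close>. So \<open>u\<close> has length 0.\<close>

lemma coset_min_unique:
  assumes I: "I \<subseteq> S" and z: "coset_min I z" "coset_min I z'"
    and v: "v \<in> generate W I" "v' \<in> generate W I" and eq: "z \<otimes> v = z' \<otimes> v'"
  shows "z = z'" "v = v'"
proof -
  have c: "z \<in> carrier W" "z' \<in> carrier W" "v \<in> carrier W" "v' \<in> carrier W"
    using z v generate_closed[OF I] by (auto simp: coset_min_def)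
  let ?u = "v \<otimes> inv v'"
  have u: "?u \<in> generate W I" using v generate_mult generate_inv I by blast
  have z': "z' = z \<otimes> ?u" using mult_inv_eq[OF eq[symmetric]] c by (simp add: m_assoc)
  have "z = z' \<otimes> inv ?u" using z' c by (simp add: m_assoc)
  then have "\<ell> z' \<le> \<ell> z" using z(2) generate_inv[OF I u] by (auto simp: coset_min_def)
  then have "\<ell> ?u = 0" using coset_min_additive[OF I z(1) u] z' by simp
  then have "?u = \<one>" using len_eq_0 c by simp
  then show "z = z'" using z' c by simp
  then show "v = v'" using eq c by simp
qed

lemma min_coset_reps_eq:
  assumes "I \<subseteq> J" "J \<subseteq> S"
  shows "min_coset_reps W S J I = {z \<in> generate W J. coset_min I z}"
  using assms generate_closed[of J]
  by (auto simp: min_coset_reps_def coset_min_def l_coset_def)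

lemma generate_mono: "I \<subseteq> J \<Longrightarrow> J \<subseteq> S \<Longrightarrow> generate W I \<subseteq> generate W J"
  by (simp add: mono_generate)

lemma coset_bij:
  assumes "I \<subseteq> J" "J \<subseteq> S"
  shows "bij_betw (\<lambda>(z, v). z \<otimes> v) (min_coset_reps W S J I \<times> generate W I) (generate W J)"
proof (rule bij_betw_imageI)
  have I: "I \<subseteq> S" using assms by simp
  note mono = generate_mono[OF assms]
  show "inj_on (\<lambda>(z, v). z \<otimes> v) (min_coset_reps W S J I \<times> generate W I)"
    using coset_min_unique[OF I] by (auto simp: inj_on_def min_coset_reps_eq[OF assms])
  show "(\<lambda>(z, v). z \<otimes> v) ` (min_coset_reps W S J I \<times> generate W I) = generate W J"
  proof (intro equalityI subsetI)
    fix w assume "w \<in> (\<lambda>(z, v). z \<otimes> v) ` (min_coset_reps W S J I \<times> generate W I)"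
    then show "w \<in> generate W J"
      using mono generate_mult[OF assms(2)] by (auto simp: min_coset_reps_eq[OF assms])
  next
    fix w assume w: "w \<in> generate W J"
    have wc: "w \<in> carrier W" using w generate_closed[OF assms(2)] by blast
    obtain z d where zd: "coset_min I z" "d \<in> generate W I" "w = z \<otimes> d"
      using coset_decomp[OF I wc] by blast
    have c: "z \<in> carrier W" "d \<in> carrier W" using zd generate_closed[OF I] by (auto simp: coset_min_def)
    have "z = w \<otimes> inv d" using zd(3) c by (simp add: m_assoc)
    then have "z \<in> generate W J" using w zd(2) mono generate_mult[OF assms(2)] generate_inv[OF assms(2)] by blast
    then show "w \<in> (\<lambda>(z, v). z \<otimes> v) ` (min_coset_reps W S J I \<times> generate W I)"
      using zd by (intro image_eqI[of _ _ "(z, d)"]) (auto simp: min_coset_reps_eq[OF assms])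
  qed
qed

section \<open>Longest elements\<close>

text \<open>Each new letter \<open>s\<close> is a right descent of \<open>d\<close>, so exchange
  removes a letter from the current word of \<open>d\<close> and puts \<open>s\<close> at the end.
  The removed letter cannot lie in the suffix already built, because that suffix followed by
  \<open>s\<close> is reduced.\<close>

lemma descents_suffix:
  assumes I: "I \<subseteq> S" and d: "d \<in> carrier W" and desc: "\<And>s. s \<in> I \<Longrightarrow> \<ell> (d \<otimes> s) < \<ell> d"
    and "reduced_expr W S (wp vs) vs" "set vs \<subseteq> I"
  shows "\<exists>us. reduced_expr W S d (us @ vs)"
  using assms(4,5)
proof (induction vs rule: rev_induct)
  case Nil
  then show ?case using ex_reduced[OF d] by simp
next
  case (snoc s vs)
  have red: "reduced_expr W S (wp vs) vs" using reduced_append(1)[OF snoc.prems(1)] .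
  have s: "s \<in> S" "s \<in> I" using snoc.prems I by auto
  obtain us where us: "reduced_expr W S d (us @ vs)" using snoc.IH[OF red] snoc.prems(2) by auto
  note r = reduced_exprD[OF us]
  have S: "set us \<subseteq> S" "set vs \<subseteq> S" using r by auto
  obtain i where i: "i < length (us @ vs)" "d \<otimes> s = wp (drop_nth i (us @ vs))"
    using exchange_right[of s "us @ vs"] desc[OF s(2)] s r by auto
  have dS: "set (drop_nth i (us @ vs)) \<subseteq> S" using r(1) set_drop_nth[of i "us @ vs"] by auto
  have deq: "d = wp (drop_nth i (us @ vs) @ [s])"
    using i(2) dS s d by (simp add: wp_append S_carrier i(2)[symmetric] gen_cancel_right)
  show ?case
  proof (cases "i < length us")
    case True
    have "reduced_expr W S d (drop_nth i us @ vs @ [s])"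
      using deq True dS s r(3) i(1) by (auto simp: drop_nth_append reduced_expr_def length_drop_nth)
    then show ?thesis by blast
  next
    case False
    let ?v = "drop_nth (i - length us) vs"
    have vS: "set ?v \<subseteq> S" using S set_drop_nth[of "i - length us" vs] by auto
    have "wp us \<otimes> wp vs \<otimes> s = wp us \<otimes> wp ?v"
      using i(2) False r(2) vS S by (simp add: drop_nth_append wp_append)
    then have "wp vs \<otimes> s = wp ?v" using S vS s by (simp add: m_assoc S_carrier)
    then have "\<ell> (wp (vs @ [s])) \<le> length ?v" using len_le[OF vS] s S by (simp add: wp_append S_carrier)
    moreover have "length ?v < length vs" using i(1) False by (subst length_drop_nth) auto
    ultimately show ?thesis using snoc.prems(1) by (auto simp: reduced_expr_def)
  qed
qed

text \<open>By the previous lemma every element of the subgroup is a right factor of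
  \<open>d\<close> with additive lengths. This bounds all lengths, hence gives finiteness, and
  forces a second element of maximal length to equal \<open>d\<close>. It is what makes
  \<open>{s, t}\<close> finitary when one element has both \<open>s\<close> and \<open>t\<close> as
  right descents.\<close>

lemma descents_longest:
  assumes I: "I \<subseteq> S" and d: "d \<in> generate W I" and desc: "\<And>s. s \<in> I \<Longrightarrow> \<ell> (d \<otimes> s) < \<ell> d"
  shows "I \<in> finitary W S" "longest W S I = d"
proof -
  have dc: "d \<in> carrier W" using d generate_closed[OF I] by blast
  have suf: "\<exists>u. u \<in> carrier W \<and> d = u \<otimes> v \<and> \<ell> d = \<ell> u + \<ell> v" if v: "v \<in> generate W I" for v
  proof -
    obtain vs where vs: "reduced_expr W S v vs" "set vs \<subseteq> I"
      using reduced_in_parabolic[OF I v] by blast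
    then obtain us where us: "reduced_expr W S d (us @ vs)"
      using descents_suffix[OF I dc desc] reduced_exprD(2)[OF vs(1)] by auto
    have "reduced_expr W S (wp us) us" using reduced_append(1)[OF us] .
    then show ?thesis using us vs(1)
      by (intro exI[of _ "wp us"]) (auto simp: reduced_expr_def wp_append)
  qed
  have le: "\<ell> v \<le> \<ell> d" if "v \<in> generate W I" for v using suf[OF that] by auto
  have "generate W I \<subseteq> wp ` {ws. set ws \<subseteq> I \<and> length ws \<le> \<ell> d}"
  proof
    fix v assume v: "v \<in> generate W I"
    obtain vs where vs: "reduced_expr W S v vs" "set vs \<subseteq> I"
      using reduced_in_parabolic[OF I v] by blast
    then show "v \<in> wp ` {ws. set ws \<subseteq> I \<and> length ws \<le> \<ell> d}"
      using le[OF v] reduced_exprD[OF vs(1)] by (intro image_eqI[of _ _ vs]) auto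
  qed
  moreover have "finite {ws. set ws \<subseteq> I \<and> length ws \<le> \<ell> d}"
    using finite_subset[OF I finite_S] by (rule finite_lists_length_le)
  ultimately show "I \<in> finitary W S" using I by (auto simp: finitary_def intro: finite_surj)
  show "longest W S I = d"
    unfolding longest_def
  proof (rule the_equality)
    show "d \<in> generate W I \<and> (\<forall>v\<in>generate W I. \<ell> v \<le> \<ell> d)" using d le by blast
    fix v assume v: "v \<in> generate W I \<and> (\<forall>u\<in>generate W I. \<ell> u \<le> \<ell> v)"
    then obtain u where u: "u \<in> carrier W" "d = u \<otimes> v" "\<ell> d = \<ell> u + \<ell> v" using suf by blast
    then have "\<ell> u = 0" using v d by fastforce
    then show "v = d" using u len_eq_0[of u] v generate_closed[OF I] by auto
  qed
qed

section \<open>Finitary subsets and single generators\<close>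

lemma finitary_subset: "I \<in> finitary W S \<Longrightarrow> J \<subseteq> I \<Longrightarrow> J \<in> finitary W S"
  using generate_mono[of J I] finite_subset by (fastforce simp: finitary_def)

lemma finitaryD: "I \<in> finitary W S \<Longrightarrow> I \<subseteq> S" "I \<in> finitary W S \<Longrightarrow> finite (generate W I)"
    "I \<in> finitary W S \<Longrightarrow> finite I"
  using finite_subset[OF _ finite_S] by (auto simp: finitary_def)

lemma finite_finitary: "finite (finitary W S)"
  by (rule finite_subset[of _ "Pow S"]) (auto simp: finitary_def finite_S)

lemma generate_empty [simp]: "generate W {} = {\<one>}"
  using generate_iff_word[of "{}"] by auto

lemma empty_finitary [simp]: "{} \<in> finitary W S"
  by (simp add: finitary_def)

lemma len_gen: "s \<in> S \<Longrightarrow> \<ell> s = 1"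
  using len_gen_mult_cases(1)[of s \<one>] by (auto simp: S_carrier)

lemma singleton_longest:
  assumes "s \<in> S"
  shows "{s} \<in> finitary W S" "longest W S {s} = s"
  using descents_longest[of "{s}" s] assms
  by (auto simp: gen_sq len_gen generate_gen)

lemma generate_singleton: "s \<in> S \<Longrightarrow> generate W {s} = {\<one>, s}"
proof (intro equalityI subsetI)
  fix w assume "s \<in> S" "w \<in> generate W {s}"
  then obtain ws where "set ws \<subseteq> {s}" "wp ws = w" using generate_iff_word[of "{s}"] by auto
  then show "w \<in> {\<one>, s}"
    using \<open>s \<in> S\<close> by (induction ws arbitrary: w) (auto simp: gen_sq S_carrier)
qed (auto intro: generate.intros)

text \<open>This is the only use of adaptedness: the reduced expression fixed for an ordering
  through \<open>{s}\<close> ends in \<open>s\<close>, so the two orderings of \<open>{s, t}\<close>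
  supply words with different last letters.\<close>

lemma adapted_suffix:
  assumes "adapted_expr W S cs ws" "{s} \<in> set cs" "s \<in> S"
  shows "\<exists>us. ws = us @ [s]"
proof -
  obtain k where k: "k \<le> length ws" "wp (drop k ws) = s"
    using assms singleton_longest(2) by (auto simp: adapted_expr_def)
  have "reduced_expr W S (wp (drop k ws)) (drop k ws)"
    using assms(1) reduced_append(2)[of _ "take k ws" "drop k ws"] by (auto simp: adapted_expr_def)
  then have red: "reduced_expr W S s (drop k ws)" using k by simp
  then have "length (drop k ws) = 1" using assms(3) by (auto simp: reduced_expr_def len_gen)
  then obtain t where t: "drop k ws = [t]" by (metis One_nat_def length_0_conv length_Suc_conv)
  then have "t = s" using k(2) red by (auto simp: reduced_expr_def S_carrier)
  then show ?thesis using t append_take_drop_id[of k ws] by metis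
qed

end

section \<open>Free modules of finitely supported functions\<close>

lemma scal_apply: "scal f a x = f * a x"
  by (simp add: scal_def)

lemma scal_zero [simp]: "scal f 0 = 0" "scal 0 a = 0"
  and scal_one [simp]: "scal 1 a = a"
  and scal_scal [simp]: "scal f (scal g a) = scal (f * g) a"
  and scal_add: "scal f (a + b) = scal f a + scal f b"
  and scal_add_left: "scal (f + g) a = scal f a + scal g a"
  and scal_diff: "scal f (a - b) = scal f a - scal f b"
  by (auto simp: fun_eq_iff scal_apply algebra_simps)

lemma sum_apply: "(\<Sum>i\<in>A. F i) x = (\<Sum>i\<in>A. F i x)"
  by (induction A rule: infinite_finite_induct) auto

lemma scal_sum: "scal f (\<Sum>i\<in>A. F i) = (\<Sum>i\<in>A. scal f (F i))"
  by (auto simp: fun_eq_iff sum_apply scal_apply sum_distrib_left)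

lemma fm_zero [simp]: "0 \<in> free_module B"
  by (simp add: free_module_def)

lemma fm_basis [simp]: "basis_elt x \<in> free_module B \<longleftrightarrow> x \<in> B"
  by (auto simp: free_module_def basis_elt_def)

lemma fm_add [simp]: "a \<in> free_module B \<Longrightarrow> b \<in> free_module B \<Longrightarrow> a + b \<in> free_module B"
proof -
  assume a: "a \<in> free_module B" "b \<in> free_module B"
  have "{x. (a + b) x \<noteq> 0} \<subseteq> {x. a x \<noteq> 0} \<union> {x. b x \<noteq> 0}" by auto
  then show ?thesis using a by (auto simp: free_module_def intro: finite_subset)
qed

lemma fm_scal [simp]: "a \<in> free_module B \<Longrightarrow> scal f a \<in> free_module B"
  by (auto simp: free_module_def scal_apply elim: finite_subset[rotated])

lemma fm_diff [simp]: "a \<in> free_module B \<Longrightarrow> b \<in> free_module B \<Longrightarrow> a - b \<in> free_module B"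
proof -
  assume "a \<in> free_module B" "b \<in> free_module B"
  moreover have "a - b = a + scal (- 1) b" by (auto simp: fun_eq_iff scal_apply)
  ultimately show ?thesis by (metis fm_add fm_scal)
qed

lemma fm_sum [simp]: "(\<And>i. i \<in> A \<Longrightarrow> F i \<in> free_module B) \<Longrightarrow> (\<Sum>i\<in>A. F i) \<in> free_module B"
  by (induction A rule: infinite_finite_induct) auto

lemma fm_mono: "a \<in> free_module B \<Longrightarrow> B \<subseteq> C \<Longrightarrow> a \<in> free_module C"
  by (auto simp: free_module_def)

lemma fm_expand:
  assumes "a \<in> free_module B"
  shows "a = (\<Sum>x | a x \<noteq> 0. scal (a x) (basis_elt x))"
proof
  fix y
  show "a y = (\<Sum>x | a x \<noteq> 0. scal (a x) (basis_elt x)) y"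
    using assms sum.delta[of "{x. a x \<noteq> 0}" y a]
    by (auto simp: sum_apply scal_apply basis_elt_def free_module_def if_distrib cong: if_cong)
qed

definition lin_ext :: "('x \<Rightarrow> 'y \<Rightarrow> int poly) \<Rightarrow> ('x \<Rightarrow> int poly) \<Rightarrow> 'y \<Rightarrow> int poly" where
  "lin_ext \<phi> a = (\<Sum>x | a x \<noteq> 0. scal (a x) (\<phi> x))"

lemma lin_ext_fun: "lin_ext \<phi> a = (\<lambda>v. \<Sum>x | a x \<noteq> 0. a x * \<phi> x v)"
  by (auto simp: lin_ext_def sum_apply scal_apply)

text \<open>Linearity is confined to finitely supported functions on \<open>B\<close>, because
  \<open>lin_ext\<close> gives \<open>0\<close> on a function of infinite support whose sum is
  undefined.\<close>

definition linear_on :: "'x set \<Rightarrow> (('x \<Rightarrow> int poly) \<Rightarrow> 'y \<Rightarrow> int poly) \<Rightarrow> bool" where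
  "linear_on B F \<longleftrightarrow>
     (\<forall>a \<in> free_module B. \<forall>b \<in> free_module B. F (a + b) = F a + F b) \<and>
     (\<forall>f. \<forall>a \<in> free_module B. F (scal f a) = scal f (F a))"

lemma linear_on_add: "linear_on B F \<Longrightarrow> a \<in> free_module B \<Longrightarrow> b \<in> free_module B \<Longrightarrow> F (a + b) = F a + F b"
  and linear_on_scal: "linear_on B F \<Longrightarrow> a \<in> free_module B \<Longrightarrow> F (scal f a) = scal f (F a)"
  by (simp_all add: linear_on_def)

lemma linear_on_zero: "linear_on B F \<Longrightarrow> F 0 = 0"
  using linear_on_scal[of B F 0 0] by simp

lemma linear_on_diff:
  assumes "linear_on B F" "a \<in> free_module B" "b \<in> free_module B"
  shows "F (a - b) = F a - F b"
  using linear_on_add[OF assms(1), of "a - b" b] assms by (simp add: algebra_simps)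

lemma linear_on_sum:
  assumes "linear_on B F" "\<And>i. i \<in> A \<Longrightarrow> G i \<in> free_module B"
  shows "F (\<Sum>i\<in>A. G i) = (\<Sum>i\<in>A. F (G i))"
  using assms(2)
  by (induction A rule: infinite_finite_induct) (auto simp: linear_on_add[OF assms(1)] linear_on_zero[OF assms(1)])

lemma linear_on_expand:
  assumes "linear_on B F" "a \<in> free_module B"
  shows "F a = lin_ext (\<lambda>x. F (basis_elt x)) a"
proof -
  have "\<And>x. a x \<noteq> 0 \<Longrightarrow> x \<in> B" using assms(2) by (auto simp: free_module_def)
  then have "F (\<Sum>x | a x \<noteq> 0. scal (a x) (basis_elt x)) = lin_ext (\<lambda>x. F (basis_elt x)) a"
    unfolding lin_ext_def
    by (subst linear_on_sum[OF assms(1)]) (auto intro!: sum.cong linear_on_scal[OF assms(1)])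
  then show ?thesis using fm_expand[OF assms(2)] by simp
qed

lemma linear_on_eqI:
  assumes "linear_on B F" "linear_on B G" "\<And>x. x \<in> B \<Longrightarrow> F (basis_elt x) = G (basis_elt x)"
    and "a \<in> free_module B"
  shows "F a = G a"
proof -
  have "lin_ext (\<lambda>x. F (basis_elt x)) a = lin_ext (\<lambda>x. G (basis_elt x)) a"
    unfolding lin_ext_def using assms(3,4) by (auto simp: free_module_def intro!: sum.cong)
  then show ?thesis using assms linear_on_expand by metis
qed

lemma lin_ext_superset:
  assumes "finite A" "{x. a x \<noteq> 0} \<subseteq> A"
  shows "lin_ext \<phi> a = (\<Sum>x\<in>A. scal (a x) (\<phi> x))"
  unfolding lin_ext_def using assms by (intro sum.mono_neutral_left) auto

lemma linear_lin_ext: "linear_on B (lin_ext \<phi>)"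
proof -
  have "lin_ext \<phi> (a + b) = lin_ext \<phi> a + lin_ext \<phi> b" if "a \<in> free_module B" "b \<in> free_module B" for a b
  proof -
    let ?A = "{x. a x \<noteq> 0} \<union> {x. b x \<noteq> 0}"
    have "finite ?A" using that by (auto simp: free_module_def)
    moreover have "{x. (a + b) x \<noteq> 0} \<subseteq> ?A" "{x. a x \<noteq> 0} \<subseteq> ?A" "{x. b x \<noteq> 0} \<subseteq> ?A" by auto
    ultimately show ?thesis by (simp only: lin_ext_superset plus_fun_apply scal_add_left sum.distrib)
  qed
  moreover have "lin_ext \<phi> (scal f a) = scal f (lin_ext \<phi> a)" if "a \<in> free_module B" for f a
  proof -
    have "finite {x. a x \<noteq> 0}" "{x. scal f a x \<noteq> 0} \<subseteq> {x. a x \<noteq> 0}"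
      using that by (auto simp: free_module_def scal_apply)
    then have "lin_ext \<phi> (scal f a) = (\<Sum>x | a x \<noteq> 0. scal (scal f a x) (\<phi> x))"
      by (rule lin_ext_superset)
    then show ?thesis by (simp add: lin_ext_def scal_sum scal_apply)
  qed
  ultimately show ?thesis by (simp add: linear_on_def)
qed

lemma lin_ext_basis [simp]: "lin_ext \<phi> (basis_elt x) = \<phi> x"
  using lin_ext_superset[of "{x}" "basis_elt x" \<phi>] by (auto simp: basis_elt_def)

lemma lin_ext_closed:
  assumes "a \<in> free_module B" "\<And>x. x \<in> B \<Longrightarrow> \<phi> x \<in> free_module C"
  shows "lin_ext \<phi> a \<in> free_module C"
  unfolding lin_ext_def using assms by (intro fm_sum fm_scal) (auto simp: free_module_def)

lemma linear_on_comp: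
  assumes "linear_on B F" "linear_on C G" "\<And>a. a \<in> free_module B \<Longrightarrow> F a \<in> free_module C"
  shows "linear_on B (\<lambda>a. G (F a))"
  using assms by (simp add: linear_on_def)

lemma linear_on_lin_ext_param:
  assumes "\<And>x. a x \<noteq> 0 \<Longrightarrow> linear_on B (\<lambda>b. \<phi> x b)"
  shows "linear_on B (\<lambda>b. lin_ext (\<lambda>x. \<phi> x b) a)"
  using assms
  by (auto simp: linear_on_def lin_ext_def scal_add sum.distrib scal_sum mult.commute intro!: sum.cong)

lemma linear_on_id: "linear_on B (\<lambda>a. a)"
  by (simp add: linear_on_def)

section \<open>The Hecke algebra acting on itself\<close>

context coxeter_group
begin

abbreviation H :: "('w \<Rightarrow> int poly) set" where "H \<equiv> free_module (carrier W)"
abbreviation T :: "'w \<Rightarrow> 'w \<Rightarrow> int poly" where "T \<equiv> basis_elt"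
abbreviation lmul :: "'w \<Rightarrow> ('w \<Rightarrow> int poly) \<Rightarrow> 'w \<Rightarrow> int poly" where "lmul \<equiv> gen_times W S"

text \<open>Right multiplication by \<open>T t\<close> gets a formula of its own, since the product
  of the Hecke algebra is not yet known to be associative. Associativity will follow from the fact
  that these operators commute with \<open>lmul\<close>.\<close>

definition rmul :: "'w \<Rightarrow> ('w \<Rightarrow> int poly) \<Rightarrow> 'w \<Rightarrow> int poly" where
  "rmul t = lin_ext (\<lambda>w. if \<ell> (w \<otimes> t) > \<ell> w then T (w \<otimes> t)
                         else scal (qvar - 1) (T w) + scal qvar (T (w \<otimes> t)))"

lemma gen_times_basis_eq:
  "gen_times_basis W S s w = (if \<ell> (s \<otimes> w) > \<ell> w then T (s \<otimes> w)
     else scal (qvar - 1) (T w) + scal qvar (T (s \<otimes> w)))"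
  by (auto simp: gen_times_basis_def fun_eq_iff scal_apply)

lemma lmul_eq: "lmul s = lin_ext (gen_times_basis W S s)"
  by (auto simp: gen_times_def lin_ext_fun)

lemma linear_lmul: "linear_on (carrier W) (lmul s)"
  and linear_rmul: "linear_on (carrier W) (rmul s)"
  unfolding lmul_eq rmul_def by (rule linear_lin_ext)+

lemma lmul_closed [simp]: "s \<in> S \<Longrightarrow> h \<in> H \<Longrightarrow> lmul s h \<in> H"
  unfolding lmul_eq by (rule lin_ext_closed) (auto simp: gen_times_basis_eq S_carrier)

lemma rmul_closed [simp]: "s \<in> S \<Longrightarrow> h \<in> H \<Longrightarrow> rmul s h \<in> H"
  unfolding rmul_def by (rule lin_ext_closed) (auto simp: S_carrier)

lemma lmul_up: "\<ell> w < \<ell> (s \<otimes> w) \<Longrightarrow> lmul s (T w) = T (s \<otimes> w)"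
  and lmul_down: "\<ell> (s \<otimes> w) < \<ell> w \<Longrightarrow> lmul s (T w) = scal (qvar - 1) (T w) + scal qvar (T (s \<otimes> w))"
  and rmul_up: "\<ell> w < \<ell> (w \<otimes> s) \<Longrightarrow> rmul s (T w) = T (w \<otimes> s)"
  and rmul_down: "\<ell> (w \<otimes> s) < \<ell> w \<Longrightarrow> rmul s (T w) = scal (qvar - 1) (T w) + scal qvar (T (w \<otimes> s))"
  by (auto simp: lmul_eq rmul_def gen_times_basis_eq)

text \<open>Suppose both products are longer than \<open>w\<close>. Then \<open>s\<close> shortens
  \<open>w t\<close>, and exchange deletes a letter of \<open>w t\<close>. A letter of
  \<open>w\<close> is impossible, since \<open>s w\<close> would become shorter than
  \<open>w\<close>, so it is \<open>t\<close> and \<open>s w t = w\<close>.\<close>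

lemma mult_gen_both_eq:
  assumes s: "s \<in> S" "t \<in> S" and w: "w \<in> carrier W"
    and eq: "\<ell> (s \<otimes> w) = \<ell> (w \<otimes> t)" "\<ell> (s \<otimes> w \<otimes> t) = \<ell> w"
  shows "s \<otimes> w = w \<otimes> t"
proof -
  have up: "s \<otimes> v = v \<otimes> t"
    if v: "v \<in> carrier W" "\<ell> v < \<ell> (s \<otimes> v)" "\<ell> v < \<ell> (v \<otimes> t)" "\<ell> (s \<otimes> v \<otimes> t) < \<ell> (v \<otimes> t)" for v
  proof -
    obtain vs where vs: "reduced_expr W S v vs" using ex_reduced[OF v(1)] by blast
    note r = reduced_exprD[OF vs]
    have tc: "t \<in> carrier W" "s \<in> carrier W" using s S_carrier by auto
    have "\<ell> (s \<otimes> (v \<otimes> t)) < \<ell> (v \<otimes> t)" using v tc by (simp add: m_assoc)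
    then obtain i where i: "i < length (vs @ [t])" "s \<otimes> (v \<otimes> t) = wp (drop_nth i (vs @ [t]))"
      using exchange_left[of s "v \<otimes> t" "vs @ [t]"] s v r tc by (auto simp: wp_append)
    show ?thesis
    proof (cases "i < length vs")
      case True
      have S': "set (drop_nth i vs) \<subseteq> S" using r set_drop_nth[of i vs] by auto
      have "s \<otimes> v \<otimes> t = wp (drop_nth i vs) \<otimes> t"
        using i(2) True S' s tc v by (simp add: drop_nth_append wp_append m_assoc)
      then have "s \<otimes> v = wp (drop_nth i vs)" using tc v S' by simp
      then have "\<ell> (s \<otimes> v) < \<ell> v"
        using len_le[OF S'] length_drop_nth[OF True] True r by simp
      then show ?thesis using v by simp
    next
      case False
      then have "s \<otimes> (v \<otimes> t) = v" using i r by (simp add: drop_nth_append) (simp add: drop_nth_def)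
      then show ?thesis using gen_move[OF s(1), of "v \<otimes> t" v] v tc by simp
    qed
  qed
  have c: "s \<in> carrier W" "t \<in> carrier W" using s S_carrier by auto
  show ?thesis
  proof (cases "\<ell> w < \<ell> (s \<otimes> w)")
    case True
    then show ?thesis using up[OF w] eq by simp
  next
    \<comment> \<open>Both products are now shorter than \<open>w\<close>, and \<open>s w\<close> in
      place of \<open>w\<close> satisfies the hypotheses of the ascending case.\<close>
    case False
    then have lt: "\<ell> (s \<otimes> w) < \<ell> w" using len_gen_mult_cases(1)[OF s(1) w] by auto
    have "s \<otimes> (s \<otimes> w) = s \<otimes> w \<otimes> t"
      using up[of "s \<otimes> w"] s w c eq lt by (simp add: gen_cancel)
    then show ?thesis using s w c by (simp add: m_assoc)
  qed
qed

text \<open>The four lengths of \<open>w\<close>, \<open>s w\<close>, \<open>w t\<close> and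
  \<open>s w t\<close> select the branches of the formulas. The two sides then agree term by term,
  except in the configuration of the previous lemma, where the equality \<open>s w = w t\<close>
  closes the gap.\<close>

lemma lmul_rmul_basis:
  assumes s: "s \<in> S" "t \<in> S" and w: "w \<in> carrier W"
  shows "lmul s (rmul t (T w)) = rmul t (lmul s (T w))"
proof -
  have c: "s \<in> carrier W" "t \<in> carrier W" "s \<otimes> w \<in> carrier W" "w \<otimes> t \<in> carrier W" "s \<otimes> w \<otimes> t \<in> carrier W"
    using s S_carrier w by auto
  have assoc: "s \<otimes> (w \<otimes> t) = s \<otimes> w \<otimes> t" using c w by (simp add: m_assoc)
  note lin = linear_on_add[OF linear_lmul] linear_on_scal[OF linear_lmul]
    linear_on_add[OF linear_rmul] linear_on_scal[OF linear_rmul]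
  have key: "\<ell> (s \<otimes> w) = \<ell> (w \<otimes> t) \<Longrightarrow> \<ell> (s \<otimes> w \<otimes> t) = \<ell> w \<Longrightarrow> s \<otimes> w = w \<otimes> t"
    using mult_gen_both_eq[OF s w] .
  have d1: "\<ell> (s \<otimes> w) = Suc (\<ell> w) \<or> \<ell> w = Suc (\<ell> (s \<otimes> w))" using len_gen_mult_cases(1)[OF s(1) w] .
  have d2: "\<ell> (w \<otimes> t) = Suc (\<ell> w) \<or> \<ell> w = Suc (\<ell> (w \<otimes> t))" using len_mult_gen_cases[OF s(2) w] .
  have d3: "\<ell> (s \<otimes> w \<otimes> t) = Suc (\<ell> (s \<otimes> w)) \<or> \<ell> (s \<otimes> w) = Suc (\<ell> (s \<otimes> w \<otimes> t))"
    using len_mult_gen_cases[OF s(2) c(3)] .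
  have d4: "\<ell> (s \<otimes> w \<otimes> t) = Suc (\<ell> (w \<otimes> t)) \<or> \<ell> (w \<otimes> t) = Suc (\<ell> (s \<otimes> w \<otimes> t))"
    using len_gen_mult_cases(1)[OF s(1) c(4)] assoc by simp
  have ls: "lmul s (T w) = (if \<ell> w < \<ell> (s \<otimes> w) then T (s \<otimes> w) else scal (qvar - 1) (T w) + scal qvar (T (s \<otimes> w)))"
    using d1 lmul_up lmul_down by auto
  have rt: "rmul t (T w) = (if \<ell> w < \<ell> (w \<otimes> t) then T (w \<otimes> t) else scal (qvar - 1) (T w) + scal qvar (T (w \<otimes> t)))"
    using d2 rmul_up rmul_down by auto
  have ls': "lmul s (T (w \<otimes> t)) = (if \<ell> (w \<otimes> t) < \<ell> (s \<otimes> w \<otimes> t) then T (s \<otimes> w \<otimes> t) else scal (qvar - 1) (T (w \<otimes> t)) + scal qvar (T (s \<otimes> w \<otimes> t)))"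
    using d4 lmul_up[of "w \<otimes> t" s] lmul_down[of s "w \<otimes> t"] assoc by auto
  have rt': "rmul t (T (s \<otimes> w)) = (if \<ell> (s \<otimes> w) < \<ell> (s \<otimes> w \<otimes> t) then T (s \<otimes> w \<otimes> t) else scal (qvar - 1) (T (s \<otimes> w)) + scal qvar (T (s \<otimes> w \<otimes> t)))"
    using d3 rmul_up[of "s \<otimes> w" t] rmul_down[of "s \<otimes> w" t] by auto
  show ?thesis
  proof (cases "\<ell> (s \<otimes> w) = \<ell> (w \<otimes> t) \<and> \<ell> (s \<otimes> w \<otimes> t) = \<ell> w")
    case True
    then have "s \<otimes> w = w \<otimes> t" using key by blast
    then show ?thesis using True ls rt ls' rt' d1 c w
      by (auto simp: lin scal_add)
  next
    case False
    then show ?thesis using ls rt ls' rt' d1 d2 d3 d4 c w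
      by (auto simp: lin scal_add algebra_simps split: if_splits)
  qed
qed

lemma lmul_rmul:
  assumes "s \<in> S" "t \<in> S" "h \<in> H"
  shows "lmul s (rmul t h) = rmul t (lmul s h)"
proof (rule linear_on_eqI[where F = "\<lambda>h. lmul s (rmul t h)" and G = "\<lambda>h. rmul t (lmul s h)"])
  show "linear_on (carrier W) (\<lambda>h. lmul s (rmul t h))"
    using assms by (intro linear_on_comp[OF linear_rmul linear_lmul]) simp
  show "linear_on (carrier W) (\<lambda>h. rmul t (lmul s h))"
    using assms by (intro linear_on_comp[OF linear_lmul linear_rmul]) simp
qed (use assms lmul_rmul_basis in auto)

section \<open>Endomorphisms of the right regular module\<close>

definition right_linear :: "(('w \<Rightarrow> int poly) \<Rightarrow> 'w \<Rightarrow> int poly) \<Rightarrow> bool" where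
  "right_linear F \<longleftrightarrow> linear_on (carrier W) F \<and> (\<forall>h \<in> H. F h \<in> H) \<and>
     (\<forall>t \<in> S. \<forall>h \<in> H. F (rmul t h) = rmul t (F h))"

text \<open>
  \<open>T\<^sub>1\<close> generates the right regular module, so a right linear map is determined by its value there.
  This replaces Matsumoto's theorem in the proof that the multiplication is associative.
\<close>
lemma right_linear_eqI:
  assumes F: "right_linear F" and G: "right_linear G" and one: "F (T \<one>) = G (T \<one>)" and h: "h \<in> H"
  shows "F h = G h"
proof -
  have "F (T (wp ws)) = G (T (wp ws))" if "reduced_expr W S (wp ws) ws" for ws
    using that
  proof (induction ws rule: rev_induct)
    case (snoc t ws)
    have red: "reduced_expr W S (wp ws) ws" using reduced_append(1)[OF snoc.prems] .
    have S: "t \<in> S" "set ws \<subseteq> S" using snoc.prems by (auto simp: reduced_expr_def)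
    then have "wp (ws @ [t]) = wp ws \<otimes> t" by (simp add: wp_append S_carrier)
    moreover from this have "\<ell> (wp ws) < \<ell> (wp ws \<otimes> t)"
      using snoc.prems red by (auto simp: reduced_expr_def)
    ultimately have "T (wp (ws @ [t])) = rmul t (T (wp ws))" by (simp add: rmul_up)
    then show ?case using snoc.IH[OF red] F G S by (simp add: right_linear_def)
  qed (use one in simp)
  then have "F (T w) = G (T w)" if "w \<in> carrier W" for w
    using ex_reduced[OF that] by (metis reduced_exprD(2))
  then show ?thesis using F G h linear_on_eqI[of "carrier W" F G] by (simp add: right_linear_def)
qed

lemma right_linear_id: "right_linear (\<lambda>h. h)"
  by (simp add: right_linear_def linear_on_id)

lemma right_linear_comp: "right_linear F \<Longrightarrow> right_linear G \<Longrightarrow> right_linear (\<lambda>h. F (G h))"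
  using linear_on_comp[of "carrier W" G "carrier W" F] by (simp add: right_linear_def)

lemma right_linear_lmul: "s \<in> S \<Longrightarrow> right_linear (lmul s)"
  by (simp add: right_linear_def linear_lmul lmul_rmul)

lemma right_linear_word: "set ws \<subseteq> S \<Longrightarrow> right_linear (foldr lmul ws)"
proof (induction ws)
  case Nil
  then show ?case using right_linear_id by (simp add: id_def)
next
  case (Cons s ws)
  then show ?case using right_linear_comp[OF right_linear_lmul[of s]] by (simp add: comp_def)
qed

section \<open>The product of the Hecke algebra\<close>

definition red :: "'w \<Rightarrow> 'w list" where
  "red w = (SOME ws. reduced_expr W S w ws)"

lemma reduced_red: "w \<in> carrier W \<Longrightarrow> reduced_expr W S w (red w)"
  unfolding red_def using ex_reduced by (rule someI_ex)

lemma basis_times_eq: "basis_times W S w = foldr lmul (red w)"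
  by (simp add: basis_times_def red_def fun_eq_iff)

lemma foldr_lmul_reduced: "reduced_expr W S w ws \<Longrightarrow> foldr lmul ws (T \<one>) = T w"
proof (induction ws arbitrary: w)
  case Nil
  then show ?case by (auto simp: reduced_expr_def)
next
  case (Cons s ws)
  have red: "reduced_expr W S (wp ws) ws" using reduced_append(2)[of w "[s]" ws] Cons.prems by simp
  then have "\<ell> (wp ws) < \<ell> (s \<otimes> wp ws)" "w = s \<otimes> wp ws" using Cons.prems by (auto simp: reduced_expr_def)
  then show ?case using Cons.IH[OF red] by (simp add: lmul_up)
qed

abbreviation hm :: "('w \<Rightarrow> int poly) \<Rightarrow> ('w \<Rightarrow> int poly) \<Rightarrow> 'w \<Rightarrow> int poly"  (infixl "\<star>" 70) where
  "a \<star> b \<equiv> monoid.mult (hecke W S) a b"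

lemma hm_eq: "a \<star> b = lin_ext (\<lambda>w. foldr lmul (red w) b) a"
  by (auto simp: hecke_def lin_ext_fun basis_times_eq)

lemma right_linear_basis_times: "w \<in> carrier W \<Longrightarrow> right_linear (foldr lmul (red w))"
  using reduced_red[of w] by (intro right_linear_word) (auto simp: reduced_expr_def)

lemma right_linear_hm:
  assumes a: "a \<in> H"
  shows "right_linear (\<lambda>h. a \<star> h)"
proof -
  have supp: "\<And>x. a x \<noteq> 0 \<Longrightarrow> x \<in> carrier W" using a by (auto simp: free_module_def)
  have rl: "right_linear (foldr lmul (red w))" if "w \<in> carrier W" for w
    using right_linear_basis_times[OF that] .
  have "linear_on (carrier W) (\<lambda>h. a \<star> h)"
    unfolding hm_eq using rl supp by (intro linear_on_lin_ext_param) (auto simp: right_linear_def)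
  moreover have "a \<star> h \<in> H" if "h \<in> H" for h
    unfolding hm_eq using a rl that by (intro lin_ext_closed) (auto simp: right_linear_def)
  moreover have "a \<star> rmul t h = rmul t (a \<star> h)" if "t \<in> S" "h \<in> H" for t h
  proof -
    have "rmul t (a \<star> h) = (\<Sum>w | a w \<noteq> 0. scal (a w) (rmul t (foldr lmul (red w) h)))"
      unfolding hm_eq lin_ext_def using rl supp that
      by (subst linear_on_sum[OF linear_rmul])
         (auto intro!: sum.cong linear_on_scal[OF linear_rmul] simp: right_linear_def)
    also have "\<dots> = a \<star> rmul t h"
      unfolding hm_eq lin_ext_def using rl supp that by (auto intro!: sum.cong simp: right_linear_def)
    finally show ?thesis by simp
  qed
  ultimately show ?thesis by (simp add: right_linear_def)
qed

lemma linear_hm_right: "a \<in> H \<Longrightarrow> linear_on (carrier W) (\<lambda>h. a \<star> h)"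
  and hm_closed [simp]: "a \<in> H \<Longrightarrow> b \<in> H \<Longrightarrow> a \<star> b \<in> H"
  using right_linear_hm by (auto simp: right_linear_def)

lemma linear_hm_left: "linear_on B (\<lambda>a. a \<star> b)"
  unfolding hm_eq by (rule linear_lin_ext)

lemma hm_one: "a \<in> H \<Longrightarrow> a \<star> T \<one> = a"
proof -
  assume a: "a \<in> H"
  have "a \<star> T \<one> = lin_ext T a"
    unfolding hm_eq lin_ext_def using a foldr_lmul_reduced[OF reduced_red]
    by (auto intro!: sum.cong simp: free_module_def)
  then show ?thesis using fm_expand[OF a] by (simp add: lin_ext_def)
qed

text \<open>Both sides are right linear and agree at \<open>T \<one>\<close>. So every right linear
  map is a left multiplication, and associativity results from composing two of them.\<close>

lemma right_linear_hm_eq: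
  assumes "right_linear F" "h \<in> H"
  shows "F h = F (T \<one>) \<star> h"
proof -
  have "F (T \<one>) \<in> H" using assms(1) by (simp add: right_linear_def)
  then show ?thesis
    using right_linear_eqI[OF assms(1) right_linear_hm _ assms(2)] hm_one by simp
qed

lemma hm_assoc:
  assumes "a \<in> H" "b \<in> H" "c \<in> H"
  shows "a \<star> b \<star> c = a \<star> (b \<star> c)"
  using right_linear_hm_eq[OF right_linear_comp[OF right_linear_hm right_linear_hm], of a b c] assms
  by (simp add: hm_one)

lemma one_hm: "a \<in> H \<Longrightarrow> T \<one> \<star> a = a"
  using right_linear_hm_eq[OF right_linear_id] by simp

lemma lmul_hm: "s \<in> S \<Longrightarrow> h \<in> H \<Longrightarrow> lmul s h = T s \<star> h"
  using right_linear_hm_eq[OF right_linear_lmul, of s h] lmul_up[of \<one> s]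
  by (simp add: len_gen S_carrier)

lemma basis_hm_basis:
  assumes "v \<in> carrier W" "w \<in> carrier W" "\<ell> (v \<otimes> w) = \<ell> v + \<ell> w"
  shows "T v \<star> T w = T (v \<otimes> w)"
proof -
  have "T v \<star> T w = foldr lmul (red v) (foldr lmul (red w) (T \<one>))"
    unfolding hm_eq using foldr_lmul_reduced[OF reduced_red[OF assms(2)]] by simp
  also have "\<dots> = foldr lmul (red v @ red w) (T \<one>)" by simp
  also have "\<dots> = T (v \<otimes> w)"
    using assms by (intro foldr_lmul_reduced reduced_additive reduced_red)
  finally show ?thesis .
qed

end

section \<open>Parabolic elements of the Hecke algebra\<close>

lemma P_polysI: "Polynomial.coeff f 0 = 1 \<Longrightarrow> f \<in> P_polys"
  by (simp add: P_polys_def)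

lemma P_polys_mult: "f \<in> P_polys \<Longrightarrow> g \<in> P_polys \<Longrightarrow> f * g \<in> P_polys"
  and P_polys_one: "1 \<in> P_polys"
  and P_polys_nonzero: "f \<in> P_polys \<Longrightarrow> f \<noteq> 0"
  by (auto simp: P_polys_def coeff_mult)

lemma scal_eq_0: "f \<noteq> 0 \<Longrightarrow> scal f a = 0 \<longleftrightarrow> a = 0"
  by (auto simp: fun_eq_iff scal_apply)

context coxeter_group
begin

abbreviation pr :: "'w set \<Rightarrow> int poly" ("\<pi>") where "\<pi> \<equiv> poincare W S"

definition coset_sum :: "'w set \<Rightarrow> 'w set \<Rightarrow> 'w \<Rightarrow> int poly" where
  "coset_sum J I = (\<Sum>w \<in> min_coset_reps W S J I. T w)"

lemma x_elt_sum: "x_elt W I = (\<Sum>w \<in> generate W I. T w)"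
  by (auto simp: x_elt_def sum_apply)

lemma x_elt_closed [simp]: "I \<subseteq> S \<Longrightarrow> x_elt W I \<in> H"
  unfolding x_elt_sum by (rule fm_sum) (auto intro: generate_closed)

lemma min_coset_reps_carrier: "J \<subseteq> S \<Longrightarrow> w \<in> min_coset_reps W S J I \<Longrightarrow> w \<in> carrier W"
  using generate_closed by (auto simp: min_coset_reps_def)

lemma coset_sum_closed [simp]: "J \<subseteq> S \<Longrightarrow> coset_sum J I \<in> H"
  unfolding coset_sum_def by (rule fm_sum) (auto intro: min_coset_reps_carrier)

lemma hm_sum_right: "a \<in> H \<Longrightarrow> (\<And>i. i \<in> A \<Longrightarrow> F i \<in> H) \<Longrightarrow> a \<star> (\<Sum>i\<in>A. F i) = (\<Sum>i\<in>A. a \<star> F i)"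
  using linear_on_sum[OF linear_hm_right] by blast

lemma hm_sum_left: "(\<And>i. i \<in> A \<Longrightarrow> F i \<in> H) \<Longrightarrow> (\<Sum>i\<in>A. F i) \<star> b = (\<Sum>i\<in>A. F i \<star> b)"
  using linear_on_sum[OF linear_hm_left] by blast

lemma hm_scal_left: "a \<in> H \<Longrightarrow> scal f a \<star> b = scal f (a \<star> b)"
  using linear_on_scal[OF linear_hm_left] by blast

lemma hm_zero [simp]: "a \<in> H \<Longrightarrow> a \<star> 0 = 0"
  using linear_on_zero[OF linear_hm_right] by blast

lemma coset_min_basis_mult:
  assumes "I \<subseteq> J" "J \<subseteq> S" "z \<in> min_coset_reps W S J I" "v \<in> generate W I"
  shows "T z \<star> T v = T (z \<otimes> v)" "T (inv v) \<star> T (inv z) = T (inv (z \<otimes> v))"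
proof -
  have I: "I \<subseteq> S" using assms by simp
  have z: "coset_min I z" using assms by (auto simp: min_coset_reps_eq)
  have c: "z \<in> carrier W" "v \<in> carrier W" using z assms generate_closed[OF I] by (auto simp: coset_min_def)
  have len: "\<ell> (z \<otimes> v) = \<ell> z + \<ell> v" using coset_min_additive[OF I z assms(4)] .
  show "T z \<star> T v = T (z \<otimes> v)" using basis_hm_basis[OF c len] .
  have "\<ell> (inv v \<otimes> inv z) = \<ell> (inv v) + \<ell> (inv z)"
    using len len_inv[of "z \<otimes> v"] c by (simp add: len_inv inv_mult_group)
  then show "T (inv v) \<star> T (inv z) = T (inv (z \<otimes> v))"
    using basis_hm_basis[of "inv v" "inv z"] c by (simp add: inv_mult_group)
qed

lemma sum_coset_bij:
  assumes "I \<subseteq> J" "J \<subseteq> S"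
  shows "(\<Sum>w \<in> generate W J. F w) = (\<Sum>z \<in> min_coset_reps W S J I. \<Sum>v \<in> generate W I. F (z \<otimes> v))"
proof -
  have "(\<Sum>w \<in> generate W J. F w) =
      (\<Sum>p \<in> min_coset_reps W S J I \<times> generate W I. F (case p of (z, v) \<Rightarrow> z \<otimes> v))"
    using sum.reindex_bij_betw[OF coset_bij[OF assms], of F] by simp
  then show ?thesis by (simp add: sum.cartesian_product case_prod_beta)
qed

text \<open>Each element of the larger subgroup is uniquely \<open>z v\<close> with additive
  lengths, so the product of the two sums runs through every \<open>T w\<close> once.\<close>

lemma coset_sum_mult_x:
  assumes "I \<subseteq> J" "J \<subseteq> S"
  shows "coset_sum J I \<star> x_elt W I = x_elt W J"
proof -
  have c: "\<And>z. z \<in> min_coset_reps W S J I \<Longrightarrow> T z \<in> H" "\<And>v. v \<in> generate W I \<Longrightarrow> T v \<in> H"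
    using assms min_coset_reps_carrier generate_closed[of I] by auto
  have "coset_sum J I \<star> x_elt W I =
      (\<Sum>z \<in> min_coset_reps W S J I. \<Sum>v \<in> generate W I. T z \<star> T v)"
    unfolding coset_sum_def x_elt_sum using c by (simp add: hm_sum_left hm_sum_right) (rule sum.swap)
  also have "\<dots> = x_elt W J"
    unfolding x_elt_sum sum_coset_bij[OF assms]
    using coset_min_basis_mult(1)[OF assms] by (intro sum.cong refl) auto
  finally show ?thesis .
qed

lemma x_elt_inv:
  assumes "I \<subseteq> S"
  shows "x_elt W I = (\<Sum>w \<in> generate W I. T (inv w))"
proof -
  have "bij_betw (\<lambda>w. inv w) (generate W I) (generate W I)"
    using generate_inv[OF assms] generate_closed[OF assms]
    by (intro bij_betw_byWitness[where f' = "\<lambda>w. inv w"]) auto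
  then show ?thesis unfolding x_elt_sum by (rule sum.reindex_bij_betw[symmetric])
qed

text \<open>The inclusion of \<open>x_ideal W S J\<close> in \<open>x_ideal W S I\<close> asks for
  \<open>x_elt W I\<close> as a left factor. So the factorisation \<open>w = z v\<close> is
  inverted, which preserves lengths and permutes the subgroup.\<close>

lemma x_elt_factor:
  assumes "I \<subseteq> J" "J \<subseteq> S"
  shows "\<exists>h \<in> H. x_elt W J = x_elt W I \<star> h"
proof -
  let ?h = "\<Sum>z \<in> min_coset_reps W S J I. T (inv z)"
  have I: "I \<subseteq> S" using assms by simp
  have c: "\<And>z. z \<in> min_coset_reps W S J I \<Longrightarrow> T (inv z) \<in> H"
      "\<And>v. v \<in> generate W I \<Longrightarrow> T (inv v) \<in> H"
    using assms min_coset_reps_carrier generate_closed[of I] by auto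
  then have h: "?h \<in> H" by (intro fm_sum)
  have "x_elt W I \<star> ?h = (\<Sum>v \<in> generate W I. \<Sum>z \<in> min_coset_reps W S J I. T (inv v) \<star> T (inv z))"
    unfolding x_elt_inv[OF I] using c h by (simp add: hm_sum_left hm_sum_right) (rule sum.swap)
  also have "\<dots> = (\<Sum>z \<in> min_coset_reps W S J I. \<Sum>v \<in> generate W I. T (inv (z \<otimes> v)))"
    using coset_min_basis_mult(2)[OF assms] by (subst sum.swap) (intro sum.cong refl, auto)
  also have "\<dots> = x_elt W J" unfolding x_elt_inv[OF assms(2)] sum_coset_bij[OF assms] ..
  finally show ?thesis using h by metis
qed

text \<open>Only \<open>w = v\<close> and \<open>w = s v\<close> contribute to the coefficient at
  \<open>v\<close>. They give \<open>0 + q\<close> if \<open>s v\<close> is longer than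
  \<open>v\<close>, and \<open>(q - 1) + 1\<close> otherwise.\<close>

lemma lmul_x:
  assumes "I \<subseteq> S" "finite (generate W I)" "s \<in> I"
  shows "lmul s (x_elt W I) = scal qvar (x_elt W I)"
proof
  fix v
  let ?G = "generate W I"
  have s: "s \<in> S" using assms by auto
  have "lmul s (x_elt W I) = (\<Sum>w \<in> ?G. gen_times_basis W S s w)"
    unfolding x_elt_sum
    using assms generate_closed by (subst linear_on_sum[OF linear_lmul]) (auto simp: lmul_eq)
  then have e: "lmul s (x_elt W I) v = (\<Sum>w \<in> ?G. gen_times_basis W S s w v)" by (simp add: sum_apply)
  have xv: "x_elt W I v = (if v \<in> ?G then 1 else 0)"
    using assms(2) by (simp add: x_elt_def basis_elt_def sum.delta)
  have sG: "s \<otimes> w \<in> ?G" if "w \<in> ?G" for w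
    using that assms generate_mult generate_gen by blast
  show "lmul s (x_elt W I) v = scal qvar (x_elt W I) v"
  proof (cases "v \<in> ?G")
    case False
    have "gen_times_basis W S s w v = 0" if "w \<in> ?G" for w
      using that False sG[OF that] by (auto simp: gen_times_basis_def basis_elt_def)
    then show ?thesis using e xv False by (simp add: sum.neutral scal_apply)
  next
    case True
    have vc: "v \<in> carrier W" using True generate_closed[OF assms(1)] by blast
    have ne: "s \<otimes> v \<noteq> v" using gen_ne_one[OF s] S_carrier[OF s] vc mult_inv_eq[of s v v] by auto
    have z: "gen_times_basis W S s w v = 0" if "w \<in> ?G - {v, s \<otimes> v}" for w
    proof -
      have wc: "w \<in> carrier W" using that generate_closed[OF assms(1)] by blast
      have "s \<otimes> w \<noteq> v" using that gen_move[OF s wc vc] by auto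
      then show ?thesis using that by (auto simp: gen_times_basis_def basis_elt_def)
    qed
    have "(\<Sum>w \<in> ?G. gen_times_basis W S s w v) = (\<Sum>w \<in> {v, s \<otimes> v}. gen_times_basis W S s w v)"
      using True sG z assms(2) by (intro sum.mono_neutral_right) auto
    also have "\<dots> = gen_times_basis W S s v v + gen_times_basis W S s (s \<otimes> v) v"
      using ne by auto
    also have "\<dots> = qvar"
      using len_gen_mult_cases(1)[OF s vc] ne gen_cancel[OF s vc]
      by (elim disjE) (simp_all add: gen_times_basis_def basis_elt_def)
    finally show ?thesis using e xv True by (simp add: scal_apply)
  qed
qed

lemma basis_mult_x:
  assumes "I \<in> finitary W S" "w \<in> generate W I"
  shows "T w \<star> x_elt W I = scal (qvar ^ \<ell> w) (x_elt W I)"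
proof -
  note I = finitaryD[OF assms(1)]
  have "foldr lmul ws (x_elt W I) = scal (qvar ^ length ws) (x_elt W I)" if "set ws \<subseteq> I" for ws
    using that
  proof (induction ws)
    case (Cons s ws)
    then have IH: "foldr lmul ws (x_elt W I) = scal (qvar ^ length ws) (x_elt W I)" by simp
    have "foldr lmul (s # ws) (x_elt W I) = lmul s (scal (qvar ^ length ws) (x_elt W I))"
      by (simp only: foldr.simps comp_apply IH)
    also have "\<dots> = scal (qvar ^ length ws) (lmul s (x_elt W I))"
      using I by (intro linear_on_scal[OF linear_lmul]) simp
    also have "\<dots> = scal (qvar ^ length (s # ws)) (x_elt W I)"
      using Cons.prems I lmul_x[of I s] by (simp add: power_Suc2 del: power_Suc)
    finally show ?case .
  qed simp
  moreover have r: "reduced_expr W S w (red w)"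
    using reduced_red generate_closed[OF I(1) assms(2)] by blast
  \<comment> \<open>\<open>red w\<close> is an arbitrary choice, so the fact required is that every
    reduced expression of \<open>w\<close>, and not merely some one, has its letters in
    \<open>I\<close>.\<close>
  moreover have "set (red w) \<subseteq> I" using reduced_letters[OF I(1) r assms(2)] .
  ultimately show ?thesis by (simp add: hm_eq reduced_exprD(3)[OF r])
qed

section \<open>Poincare polynomials\<close>

lemma coset_poincare:
  assumes "I \<subseteq> J" "J \<subseteq> S"
  shows "\<pi> J = (\<Sum>z \<in> min_coset_reps W S J I. qvar ^ \<ell> z) * \<pi> I"
proof -
  have I: "I \<subseteq> S" using assms by simp
  have "\<pi> J = (\<Sum>z \<in> min_coset_reps W S J I. \<Sum>v \<in> generate W I. qvar ^ \<ell> (z \<otimes> v))"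
    unfolding poincare_def by (rule sum_coset_bij[OF assms])
  also have "\<dots> = (\<Sum>z \<in> min_coset_reps W S J I. \<Sum>v \<in> generate W I. qvar ^ \<ell> z * qvar ^ \<ell> v)"
    using coset_min_additive[OF I] by (intro sum.cong refl) (auto simp: min_coset_reps_eq[OF assms] power_add)
  finally show ?thesis unfolding poincare_def by (simp add: sum_product)
qed

lemma poincare_P: "I \<in> finitary W S \<Longrightarrow> \<pi> I \<in> P_polys"
proof -
  assume "I \<in> finitary W S"
  note I = finitaryD[OF this]
  have "Polynomial.coeff (qvar ^ n) 0 = (if n = 0 then 1 else 0)" for n
    by (cases n) (auto simp: qvar_def)
  then have "Polynomial.coeff (\<pi> I) 0 = (\<Sum>w \<in> generate W I. if w = \<one> then 1 else 0)"
    unfolding poincare_def coeff_sum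
    using I len_eq_0 generate_closed by (intro sum.cong) auto
  also have "\<dots> = 1" using I generate_one by simp
  finally show ?thesis by (rule P_polysI)
qed

lemma poincare_div:
  assumes "I \<subseteq> J" "J \<in> finitary W S"
  shows "\<pi> J div \<pi> I = (\<Sum>z \<in> min_coset_reps W S J I. qvar ^ \<ell> z)" "(\<pi> J div \<pi> I) * \<pi> I = \<pi> J"
proof -
  have "\<pi> I \<noteq> 0" using poincare_P P_polys_nonzero finitary_subset[OF assms(2,1)] by blast
  then show "\<pi> J div \<pi> I = (\<Sum>z \<in> min_coset_reps W S J I. qvar ^ \<ell> z)"
    using coset_poincare[OF assms(1) finitaryD(1)[OF assms(2)]] by simp
  then show "(\<pi> J div \<pi> I) * \<pi> I = \<pi> J"
    using coset_poincare[OF assms(1) finitaryD(1)[OF assms(2)]] by simp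
qed

text \<open>This is the quasi-idempotent relation seen in the Hecke algebra: every
  \<open>T z\<close> with \<open>z\<close> in the subgroup of \<open>J\<close> multiplies
  \<open>x_elt W J\<close> by \<open>q\<close> to the length of \<open>z\<close>.\<close>

lemma coset_sum_mult_x_top:
  assumes "I \<subseteq> J" "J \<in> finitary W S"
  shows "coset_sum J I \<star> x_elt W J = scal (\<pi> J div \<pi> I) (x_elt W J)"
proof -
  note J = finitaryD[OF assms(2)]
  have z: "z \<in> min_coset_reps W S J I \<Longrightarrow> z \<in> generate W J" for z by (simp add: min_coset_reps_def)
  have "coset_sum J I \<star> x_elt W J = (\<Sum>z \<in> min_coset_reps W S J I. T z \<star> x_elt W J)"
    unfolding coset_sum_def using min_coset_reps_carrier[OF J(1)] by (intro hm_sum_left) auto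
  also have "\<dots> = (\<Sum>z \<in> min_coset_reps W S J I. scal (qvar ^ \<ell> z) (x_elt W J))"
    using basis_mult_x[OF assms(2) z] by (intro sum.cong refl) auto
  also have "\<dots> = scal (\<pi> J div \<pi> I) (x_elt W J)"
    unfolding poincare_div(1)[OF assms] by (auto simp: fun_eq_iff scal_apply sum_apply sum_distrib_right)
  finally show ?thesis .
qed

lemma x_elt_empty: "x_elt W {} = T \<one>"
  by (simp add: x_elt_sum)

lemma x_elt_gen: "s \<in> S \<Longrightarrow> x_elt W {s} = T \<one> + T s"
  using gen_ne_one[of s] by (simp add: x_elt_sum generate_singleton)

lemma coset_sum_empty:
  assumes "J \<subseteq> S"
  shows "coset_sum J {} = x_elt W J"
  using coset_sum_mult_x[of "{}" J] assms hm_one[of "coset_sum J {}"] by (simp add: x_elt_empty)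

lemma poincare_empty [simp]: "\<pi> {} = 1"
  by (simp add: poincare_def)

lemma poincare_gen: "s \<in> S \<Longrightarrow> \<pi> {s} = 1 + qvar"
  using gen_ne_one[of s] by (simp add: poincare_def generate_singleton len_gen)

end

lemma fm_uminus [simp]: "a \<in> free_module B \<Longrightarrow> - a \<in> free_module B"
  using fm_diff[of 0 B a] by simp

section \<open>The path algebra as a convolution algebra\<close>

text \<open>
  The sum over the splittings of a path makes sense, and is associative, for arbitrary functions on
  pairs of a list of arrows and a vertex.
\<close>
definition conv :: "('w path \<Rightarrow> int poly) \<Rightarrow> ('w path \<Rightarrow> int poly) \<Rightarrow> 'w path \<Rightarrow> int poly"
    (infixl "\<bullet>" 70) where
  "x \<bullet> y = (\<lambda>(as, K). \<Sum>i\<le>length as. x (take i as, ptgt (drop i as, K)) * y (drop i as, K))"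

lemma ptgt_append: "ptgt (as @ bs, K) = ptgt (as, ptgt (bs, K))"
  by (cases as) auto

lemma sum_triangle: "(\<Sum>j\<le>n. \<Sum>i\<le>j. f i j) = (\<Sum>i\<le>n. \<Sum>j\<le>n - i. f i (i + j))" for n :: nat
proof -
  have "(\<Sum>j\<le>n. \<Sum>i\<le>j. f i j) = (\<Sum>(j, i) \<in> Sigma {..n} (\<lambda>j. {..j}). f i j)"
    by (simp add: sum.Sigma)
  also have "\<dots> = (\<Sum>(i, j) \<in> Sigma {..n} (\<lambda>i. {..n - i}). f i (i + j))"
    by (rule sum.reindex_bij_witness[where i = "\<lambda>(i, j). (i + j, i)" and j = "\<lambda>(j, i). (i, j - i)"]) auto
  finally show ?thesis by (simp add: sum.Sigma)
qed

text \<open>Both sides sum over the pairs of cut positions \<open>i \<le> j\<close> in the list of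
  arrows.\<close>

lemma conv_assoc: "x \<bullet> y \<bullet> z = x \<bullet> (y \<bullet> z)"
  for x y z :: "'w path \<Rightarrow> int poly"
proof
  fix p :: "'w path"
  obtain as K where p: "p = (as, K)" by (cases p)
  let ?n = "length as"
  let ?f = "\<lambda>i j. x (take i as, ptgt (drop i as, K)) *
      (y (drop i (take j as), ptgt (drop j as, K)) * z (drop j as, K))"
  have tgt: "ptgt (drop i (take j as), ptgt (drop j as, K)) = ptgt (drop i as, K)" if "i \<le> j" for i j
  proof -
    have "drop i as = drop i (take j as) @ drop j as"
      using that drop_append[of i "take j as" "drop j as"] by (auto simp: min_def)
    then show ?thesis by (metis ptgt_append)
  qed
  have "(x \<bullet> y \<bullet> z) p = (\<Sum>j\<le>?n. \<Sum>i\<le>j. ?f i j)"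
    unfolding p conv_def prod.case sum_distrib_right
    by (intro sum.cong refl) (auto simp: tgt min_def mult.assoc)
  also have "\<dots> = (\<Sum>i\<le>?n. \<Sum>j\<le>?n - i. ?f i (i + j))" by (rule sum_triangle)
  also have "\<dots> = (x \<bullet> (y \<bullet> z)) p"
    unfolding p conv_def prod.case sum_distrib_left
    by (intro sum.cong refl) (auto simp: take_drop add.commute)
  finally show "(x \<bullet> y \<bullet> z) p = (x \<bullet> (y \<bullet> z)) p" .
qed

lemma conv_add_left: "(x + y) \<bullet> z = x \<bullet> z + y \<bullet> z"
  and conv_add_right: "z \<bullet> (x + y) = z \<bullet> x + z \<bullet> y"
  and conv_diff_left: "(x - y) \<bullet> z = x \<bullet> z - y \<bullet> z"
  and conv_diff_right: "z \<bullet> (x - y) = z \<bullet> x - z \<bullet> y"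
  and conv_scal_left: "scal f x \<bullet> z = scal f (x \<bullet> z)"
  and conv_scal_right: "z \<bullet> scal f x = scal f (z \<bullet> x)"
  and conv_zero_left [simp]: "0 \<bullet> z = 0"
  and conv_zero_right [simp]: "z \<bullet> 0 = 0"
  by (auto simp: conv_def fun_eq_iff scal_apply algebra_simps sum.distrib sum_subtractf sum_distrib_left)

lemma conv_sum_left: "(\<Sum>i\<in>A. F i) \<bullet> z = (\<Sum>i\<in>A. F i \<bullet> z)"
  and conv_sum_right: "z \<bullet> (\<Sum>i\<in>A. F i) = (\<Sum>i\<in>A. z \<bullet> F i)"
  by (induction A rule: infinite_finite_induct) (auto simp: conv_add_left conv_add_right)

text \<open>A factorisation of a path is determined by the number of arrows in its first factor.
  This translates cut positions into pairs of composable paths.\<close>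

lemma finite_splits: "finite {(a, b). psrc a = ptgt b \<and> pconc a b = r}"
  and conv_splits: "(x \<bullet> y) r = (\<Sum>(a, b) | psrc a = ptgt b \<and> pconc a b = r. x a * y b)"
proof -
  obtain as K where r: "r = (as, K)" by (cases r)
  let ?g = "\<lambda>i. ((take i as, ptgt (drop i as, K)), (drop i as, K))"
  have im: "{(a, b). psrc a = ptgt b \<and> pconc a b = r} = ?g ` {..length as}"
  proof (intro equalityI subsetI)
    fix p assume "p \<in> {(a, b). psrc a = ptgt b \<and> pconc a b = r}"
    then obtain bs L cs M where p: "p = ((bs, L), (cs, M))" "L = ptgt (cs, M)" "bs @ cs = as" "M = K"
      unfolding r by (cases p) (auto elim!: psrc.elims pconc.elims)
    then show "p \<in> ?g ` {..length as}" by (intro image_eqI[of _ _ "length bs"]) auto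
  qed (auto simp: r)
  then show "finite {(a, b). psrc a = ptgt b \<and> pconc a b = r}" by simp
  have "inj_on ?g {..length as}"
    by (rule inj_onI) (metis Pair_inject append_take_drop_id atMost_iff length_take min.absorb2)
  then show "(x \<bullet> y) r = (\<Sum>(a, b) | psrc a = ptgt b \<and> pconc a b = r. x a * y b)"
    unfolding im by (simp add: sum.reindex r conv_def)
qed

lemma conv_basis:
  "basis_elt a \<bullet> basis_elt b = (if psrc a = ptgt b then basis_elt (pconc a b) else 0)"
proof
  fix r
  have "(basis_elt a \<bullet> basis_elt b) r =
      (\<Sum>p \<in> {(a, b). psrc a = ptgt b \<and> pconc a b = r}. if p = (a, b) then 1 else 0)"
    unfolding conv_splits by (intro sum.cong refl) (auto simp: basis_elt_def split: if_splits)
  also have "\<dots> = (if psrc a = ptgt b then basis_elt (pconc a b) else 0) r"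
    using finite_splits[of r] by (auto simp: basis_elt_def)
  finally show "(basis_elt a \<bullet> basis_elt b) r = (if psrc a = ptgt b then basis_elt (pconc a b) else 0) r" .
qed

lemma psrc_eq: "psrc p = snd p"
  by (cases p) simp

lemma pconc_facts:
  "psrc (pconc a b) = psrc b" "fst (pconc a b) = fst a @ fst b"
  "psrc a = ptgt b \<Longrightarrow> ptgt (pconc a b) = ptgt a"
  by (cases a; cases b; simp add: ptgt_append)+

lemma path_finitary: "is_path W S r \<Longrightarrow> psrc r \<in> finitary W S" "is_path W S r \<Longrightarrow> ptgt r \<in> finitary W S"
proof -
  have "K \<in> finitary W S \<and> ptgt (as, K) \<in> finitary W S" if "is_path W S (as, K)" for as K
    using that by (induction as) (auto simp: arrows_def)
  then show "is_path W S r \<Longrightarrow> psrc r \<in> finitary W S" "is_path W S r \<Longrightarrow> ptgt r \<in> finitary W S"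
    by (cases r; fastforce)+
qed

lemma is_path_append:
  "is_path W S (as @ bs, K) \<longleftrightarrow> is_path W S (as, ptgt (bs, K)) \<and> is_path W S (bs, K)"
proof (induction as)
  case Nil
  then show ?case using path_finitary(2)[of W S "(bs, K)"] by auto
next
  case (Cons a as)
  then show ?case by (auto simp add: ptgt_append)
qed

context coxeter_group
begin

section \<open>The path algebra as a ring\<close>

abbreviation R :: "('w path \<Rightarrow> int poly) ring" where "R \<equiv> path_alg W S"
abbreviation C :: "('w path \<Rightarrow> int poly) set" where "C \<equiv> free_module {p. is_path W S p}"

lemma R_simps [simp]: "carrier R = C" "zero R = 0" "add R = (+)"
  "one R = (\<Sum>K \<in> finitary W S. e_path K)"
  by (auto simp: path_alg_def e_path_def fun_eq_iff sum_apply)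

lemma C_supp: "x \<in> C \<Longrightarrow> x r \<noteq> 0 \<Longrightarrow> is_path W S r"
  by (auto simp: free_module_def)

text \<open>For finite supports, the sum over pairs of paths and the sum over splittings of a path
  differ only by zero terms. From here on products are computed with \<open>conv\<close>, whose
  associativity and bilinearity hold without conditions on supports.\<close>

lemma mult_conv:
  assumes "x \<in> C" "y \<in> C"
  shows "monoid.mult R x y = x \<bullet> y"
proof
  fix r :: "'w path"
  let ?S = "{(a, b). psrc a = ptgt b \<and> pconc a b = r}"
  let ?X = "{a. x a \<noteq> 0}" and ?Y = "{b. y b \<noteq> 0}"
  have fin: "finite ?X" "finite ?Y" using assms by (auto simp: free_module_def)
  have "monoid.mult R x y r = (\<Sum>p \<in> ?X \<times> ?Y. if p \<in> ?S then x (fst p) * y (snd p) else 0)"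
    by (simp add: path_alg_def sum.cartesian_product case_prod_beta)
  also have "\<dots> = (\<Sum>p \<in> (?X \<times> ?Y) \<inter> ?S. x (fst p) * y (snd p))"
    using fin by (simp add: sum.inter_restrict)
  also have "\<dots> = (\<Sum>p \<in> ?S. x (fst p) * y (snd p))"
    using finite_splits[of r] by (intro sum.mono_neutral_left) auto
  finally show "monoid.mult R x y r = (x \<bullet> y) r" by (simp add: conv_splits case_prod_beta)
qed

lemma basis_conv_closed: "is_path W S a \<Longrightarrow> is_path W S b \<Longrightarrow> basis_elt a \<bullet> basis_elt b \<in> C"
  by (cases a; cases b) (auto simp: conv_basis is_path_append)

lemma conv_closed [simp]:
  assumes "x \<in> C" "y \<in> C"
  shows "x \<bullet> y \<in> C"
proof -
  have "x \<bullet> y = (\<Sum>a | x a \<noteq> 0. scal (x a) (basis_elt a)) \<bullet> (\<Sum>b | y b \<noteq> 0. scal (y b) (basis_elt b))"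
    using fm_expand[OF assms(1)] fm_expand[OF assms(2)] by simp
  also have "\<dots> \<in> C"
    unfolding conv_sum_left conv_sum_right conv_scal_left conv_scal_right
    using assms by (intro fm_sum fm_scal basis_conv_closed) (auto simp: free_module_def)
  finally show ?thesis .
qed

lemma e_path_conv: "e_path L \<bullet> x = (\<lambda>r. if ptgt r = L then x r else 0)"
  for x :: "'w path \<Rightarrow> int poly"
proof
  fix r :: "'w path"
  obtain as K where r: "r = (as, K)" by (cases r)
  have "(e_path L \<bullet> x) r = (\<Sum>i\<le>length as. if i = 0 then (if ptgt (as, K) = L then x (as, K) else 0) else 0)"
    unfolding r conv_def prod.case
    by (intro sum.cong) (auto simp: e_path_def basis_elt_def take_eq_Nil)
  then show "(e_path L \<bullet> x) r = (if ptgt r = L then x r else 0)" by (simp add: r)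
qed

lemma conv_e_path: "x \<bullet> e_path L = (\<lambda>r. if psrc r = L then x r else 0)"
  for x :: "'w path \<Rightarrow> int poly"
proof
  fix r :: "'w path"
  obtain as K where r: "r = (as, K)" by (cases r)
  have "(x \<bullet> e_path L) r = (\<Sum>i\<le>length as. if i = length as then (if K = L then x (as, K) else 0) else 0)"
    unfolding r conv_def prod.case
    by (intro sum.cong) (auto simp: e_path_def basis_elt_def)
  then show "(x \<bullet> e_path L) r = (if psrc r = L then x r else 0)" by (simp add: r)
qed

lemma one_conv: "x \<in> C \<Longrightarrow> (\<Sum>K \<in> finitary W S. e_path K) \<bullet> x = x"
  and conv_one: "x \<in> C \<Longrightarrow> x \<bullet> (\<Sum>K \<in> finitary W S. e_path K) = x"
proof -
  have "ptgt r \<in> finitary W S \<and> psrc r \<in> finitary W S \<or> x r = 0" if "x \<in> C" for x r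
    using C_supp[OF that, of r] path_finitary[of W S r] by blast
  then show "x \<in> C \<Longrightarrow> (\<Sum>K \<in> finitary W S. e_path K) \<bullet> x = x"
    "x \<in> C \<Longrightarrow> x \<bullet> (\<Sum>K \<in> finitary W S. e_path K) = x"
    by (fastforce simp: conv_sum_left conv_sum_right e_path_conv conv_e_path fun_eq_iff sum_apply
        finite_finitary simp del: psrc.simps ptgt.simps)+
qed

lemma e_path_closed [simp]: "K \<in> finitary W S \<Longrightarrow> e_path K \<in> C"
  by (simp add: e_path_def)

lemma ring_R: "ring R"
proof (rule ringI)
  show "abelian_group R"
  proof (rule abelian_groupI)
    fix x assume "x \<in> carrier R"
    then show "\<exists>y \<in> carrier R. y \<oplus>\<^bsub>R\<^esub> x = \<zero>\<^bsub>R\<^esub>"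
      by (intro bexI[of _ "scal (- 1) x"]) (auto simp: fun_eq_iff scal_apply)
  qed (auto simp: algebra_simps)
  show "Group.monoid R"
    by (rule monoidI) (auto simp: mult_conv conv_assoc one_conv conv_one)
qed (auto simp: mult_conv conv_add_left conv_add_right)

lemma R_minus: "x \<in> C \<Longrightarrow> y \<in> C \<Longrightarrow> x \<ominus>\<^bsub>R\<^esub> y = x - y"
proof -
  assume xy: "x \<in> C" "y \<in> C"
  interpret ring R by (rule ring_R)
  have ny: "- y \<in> C" using fm_diff[of 0 _ y] xy(2) by simp
  have "\<ominus>\<^bsub>R\<^esub> y = - y" using xy(2) ny minus_equality[of "- y" y] by simp
  then show ?thesis by (simp add: a_minus_def)
qed

section \<open>The kernel of the homomorphism\<close>

text \<open>This is \<open>psi\<close> on a path with the summand forgotten. The arrows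
  \<open>Ups I J\<close> become inclusions and leave the element alone, so all paths operate on the
  one space \<open>H\<close>.\<close>

fun act :: "'w arrow list \<Rightarrow> ('w \<Rightarrow> int poly) \<Rightarrow> 'w \<Rightarrow> int poly" where
  "act [] h = h"
| "act (Ups I J # as) h = act as h"
| "act (Del J I # as) h = coset_sum J I \<star> act as h"

lemma act_append: "act (as @ bs) h = act as (act bs h)"
proof (induction as)
  case (Cons a as)
  then show ?case by (cases a) auto
qed simp

lemma coset_sum_fun: "(\<lambda>v. \<Sum>w \<in> min_coset_reps W S J I. basis_elt w v) = coset_sum J I"
  by (simp add: coset_sum_def fun_eq_iff sum_apply)

lemma hecke_simps [simp]: "zero (hecke W S) = 0" "carrier (hecke W S) = H"
  by (auto simp: hecke_def fun_eq_iff)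

lemma psi_path_act:
  "is_path W S (as, K) \<Longrightarrow>
    psi_path W S (as, K) m = (\<lambda>L. if L = ptgt (as, K) then act as (m K) else 0)"
proof (induction as)
  case (Cons a as)
  then have IH: "psi_path W S (as, K) m = (\<lambda>L. if L = ptgt (as, K) then act as (m K) else 0)"
    and a: "asrc a = ptgt (as, K)" by auto
  show ?case using a by (cases a) (auto simp: IH coset_sum_fun)
qed auto

lemma x_idealE:
  assumes "h \<in> x_ideal W S I"
  obtains h' where "h' \<in> H" "h = x_elt W I \<star> h'"
  using assms by (auto simp: x_ideal_def)

lemma x_ideal_closed: "I \<subseteq> S \<Longrightarrow> h \<in> x_ideal W S I \<Longrightarrow> h \<in> H"
  by (elim x_idealE) simp

lemma act_x_ideal:
  "is_path W S (as, K) \<Longrightarrow> h \<in> x_ideal W S K \<Longrightarrow> act as h \<in> x_ideal W S (ptgt (as, K))"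
proof (induction as)
  case (Cons a as)
  then have a: "a \<in> arrows W S" "asrc a = ptgt (as, K)" and IH: "act as h \<in> x_ideal W S (asrc a)" by auto
  from IH obtain h' where h': "h' \<in> H" "act as h = x_elt W (asrc a) \<star> h'" by (elim x_idealE)
  show ?case
  proof (cases a)
    case (Ups I J)
    then have I: "I \<subseteq> J" "J \<subseteq> S" using a finitaryD by (auto simp: arrows_def covers_def)
    obtain g where g: "g \<in> H" "x_elt W J = x_elt W I \<star> g" using x_elt_factor[OF I] by blast
    then have "act as h = x_elt W I \<star> (g \<star> h')" using h' Ups I hm_assoc[of "x_elt W I" g h'] by simp
    then show ?thesis using Ups g h' by (auto simp: x_ideal_def)
  next
    case (Del J I)
    then have I: "I \<subseteq> J" "J \<subseteq> S" using a finitaryD by (auto simp: arrows_def covers_def)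
    then have "act (a # as) h = x_elt W J \<star> h'"
      using Del h' hm_assoc[of "coset_sum J I" "x_elt W I" h'] coset_sum_mult_x[OF I] by simp
    then show ?thesis using Del h' by (auto simp: x_ideal_def)
  qed
qed simp

lemma linear_act:
  "is_path W S (as, K) \<Longrightarrow> linear_on (carrier W) (act as) \<and> (\<forall>h \<in> H. act as h \<in> H)"
proof (induction as)
  case (Cons a as)
  then have IH: "linear_on (carrier W) (act as)" "\<And>h. h \<in> H \<Longrightarrow> act as h \<in> H" and a: "a \<in> arrows W S" by auto
  show ?case
  proof (cases a)
    case (Del J I)
    then have "J \<subseteq> S" using a finitaryD by (auto simp: arrows_def)
    then show ?thesis using Del IH linear_on_comp[OF IH(1) linear_hm_right[of "coset_sum J I"]] by simp
  qed (use IH in simp)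
next
  case Nil
  have "act [] = (\<lambda>h. h)" by (rule ext) simp
  then show ?case by (simp add: linear_on_id)
qed

text \<open>The matrix entry of \<open>psi\<close> from the summand at \<open>K\<close> to the
  summand at \<open>L\<close>, evaluated at \<open>h\<close>. It makes sense for every
  \<open>h\<close>, and it is linear in the path algebra element.\<close>

definition entry :: "'w set \<Rightarrow> 'w set \<Rightarrow> ('w \<Rightarrow> int poly) \<Rightarrow> ('w path \<Rightarrow> int poly) \<Rightarrow> 'w \<Rightarrow> int poly" where
  "entry K L h = lin_ext (\<lambda>r. if psrc r = K \<and> ptgt r = L then act (fst r) h else 0)"

lemma linear_entry: "linear_on B (entry K L h)"
  unfolding entry_def by (rule linear_lin_ext)

lemma entry_basis [simp]:
  "entry K L h (basis_elt r) = (if psrc r = K \<and> ptgt r = L then act (fst r) h else 0)"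
  by (simp add: entry_def)

lemma entry_zero: "x \<in> C \<Longrightarrow> entry K L 0 x = 0"
proof -
  assume x: "x \<in> C"
  have "act (fst r) 0 = 0" if "x r \<noteq> 0" for r
    using that x linear_on_zero[of "carrier W" "act (fst r)"] linear_act[of "fst r" "snd r"] by (auto simp: free_module_def)
  then show ?thesis by (auto simp: entry_def lin_ext_def intro!: sum.neutral)
qed

lemma psi_entry:
  assumes x: "x \<in> C" and m: "m \<in> x_sum W S"
  shows "psi W S x m L = (\<Sum>K \<in> finitary W S. entry K L (m K) x)"
proof -
  have "psi W S x m L = lin_ext (\<lambda>p. psi_path W S p m L) x"
    using m by (simp add: psi_def lin_ext_fun)
  also have "\<dots> = (\<Sum>r | x r \<noteq> 0. \<Sum>K \<in> finitary W S.
      scal (x r) (if psrc r = K \<and> ptgt r = L then act (fst r) (m K) else 0))"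
    unfolding lin_ext_def
  proof (rule sum.cong)
    fix r assume "r \<in> {r. x r \<noteq> 0}"
    then have r: "is_path W S r" using x by (auto simp: free_module_def)
    then have p: "psi_path W S r m L = (if ptgt r = L then act (fst r) (m (psrc r)) else 0)"
      using psi_path_act[of "fst r" "snd r" m] by (cases r) auto
    have "scal (x r) (if ptgt r = L then act (fst r) (m (psrc r)) else 0) = (\<Sum>K \<in> finitary W S. if psrc r = K then
        scal (x r) (if ptgt r = L then act (fst r) (m K) else 0) else 0)"
      using path_finitary(1)[OF r] by (simp add: finite_finitary)
    also have "\<dots> = (\<Sum>K \<in> finitary W S. scal (x r) (if psrc r = K \<and> ptgt r = L then act (fst r) (m K) else 0))"
      by (intro sum.cong) auto
    finally show "scal (x r) (psi_path W S r m L) = (\<Sum>K \<in> finitary W S.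
        scal (x r) (if psrc r = K \<and> ptgt r = L then act (fst r) (m K) else 0))"
      by (simp only: p)
  qed simp
  finally show ?thesis by (subst (asm) sum.swap) (simp add: entry_def lin_ext_def)
qed

lemma x_ideal_zero: "I \<subseteq> S \<Longrightarrow> 0 \<in> x_ideal W S I"
  using hm_zero[of "x_elt W I"] by (auto simp: x_ideal_def intro!: exI[of _ 0])

text \<open>There are finitely many summands, so an endomorphism vanishes exactly when all its
  matrix entries do.\<close>

lemma K_ideal_iff:
  "x \<in> K_ideal W S \<longleftrightarrow> x \<in> C \<and>
     (\<forall>K \<in> finitary W S. \<forall>L \<in> finitary W S. \<forall>h \<in> x_ideal W S K. entry K L h x = 0)"
proof -
  have ker: "x \<in> K_ideal W S \<longleftrightarrow> x \<in> C \<and> (\<forall>m \<in> x_sum W S. \<forall>L. psi W S x m L = 0)"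
    by (auto simp: K_ideal_def a_kernel_def' E_alg_def psi_def fun_eq_iff restrict_def)
  have "(\<forall>m \<in> x_sum W S. \<forall>L. psi W S x m L = 0) \<longleftrightarrow>
      (\<forall>K \<in> finitary W S. \<forall>L \<in> finitary W S. \<forall>h \<in> x_ideal W S K. entry K L h x = 0)" (is "?l \<longleftrightarrow> ?r")
    if x: "x \<in> C"
  proof
    assume l: ?l
    show ?r
    proof (intro ballI)
      fix K L h assume K: "K \<in> finitary W S" "L \<in> finitary W S" and h: "h \<in> x_ideal W S K"
      \<comment> \<open>The family concentrated at \<open>K\<close> isolates a single matrix
        entry.\<close>
      let ?m = "\<lambda>I. if I = K then h else 0"
      have m: "?m \<in> x_sum W S" using K h x_ideal_zero finitaryD by (auto simp: x_sum_def)
      have "0 = (\<Sum>I \<in> finitary W S. entry I L (?m I) x)" using l m psi_entry[OF x m] by metis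
      also have "\<dots> = (\<Sum>I \<in> {K}. entry I L (?m I) x)"
        using K by (intro sum.mono_neutral_right) (auto simp: finite_finitary entry_zero[OF x])
      finally show "entry K L h x = 0" by simp
    qed
  next
    assume r: ?r
    show ?l
    proof (intro ballI allI)
      fix m L assume m: "m \<in> x_sum W S"
      have "entry K L (m K) x = 0" if "K \<in> finitary W S" for K
      proof (cases "L \<in> finitary W S")
        case False
        then have "\<And>p. x p \<noteq> 0 \<Longrightarrow> ptgt p \<noteq> L" using C_supp[OF x] path_finitary(2) by blast
        then show ?thesis by (auto simp: entry_def lin_ext_def intro!: sum.neutral)
      qed (use that r m in \<open>auto simp: x_sum_def\<close>)
      then show "psi W S x m L = 0" using psi_entry[OF x m] by simp
    qed
  qed
  then show ?thesis using ker by auto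
qed

lemma entry_conv_left:
  assumes "is_path W S r" "y \<in> C" "h \<in> H"
  shows "entry K L h (basis_elt r \<bullet> y) = (if ptgt r = L then act (fst r) (entry K (psrc r) h y) else 0)"
proof -
  have act: "linear_on (carrier W) (act (fst r))" using assms(1) linear_act[of "fst r" "snd r"] by simp
  have lin: "linear_on {p. is_path W S p} (\<lambda>y. basis_elt r \<bullet> y)"
    by (simp add: linear_on_def conv_add_right conv_scal_right)
  have ecl: "entry K M h z \<in> H" if "z \<in> C" for M z
    unfolding entry_def using that assms(3) linear_act by (intro lin_ext_closed) auto
  have l: "linear_on {p. is_path W S p} (\<lambda>y. entry K L h (basis_elt r \<bullet> y))"
    using assms(1) by (intro linear_on_comp[OF lin linear_entry[of "{p. is_path W S p}"]]) simp
  have "linear_on {p. is_path W S p} (\<lambda>y. act (fst r) (entry K (psrc r) h y))"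
    using ecl by (intro linear_on_comp[OF linear_entry act])
  then have rr: "linear_on {p. is_path W S p} (\<lambda>y. if ptgt r = L then act (fst r) (entry K (psrc r) h y) else 0)"
    by (cases "ptgt r = L") (simp_all add: linear_on_def)
  show ?thesis
    by (rule linear_on_eqI[OF l rr _ assms(2)])
       (simp add: linear_on_zero[OF act] linear_on_zero[OF linear_entry] conv_basis pconc_facts act_append)
qed

lemma entry_conv_right:
  assumes "is_path W S r" "x \<in> C"
  shows "entry K L h (x \<bullet> basis_elt r) = (if psrc r = K then entry (ptgt r) L (act (fst r) h) x else 0)"
proof -
  have lin: "linear_on {p. is_path W S p} (\<lambda>x. x \<bullet> basis_elt r)"
    by (simp add: linear_on_def conv_add_left conv_scal_left)
  have l: "linear_on {p. is_path W S p} (\<lambda>x. entry K L h (x \<bullet> basis_elt r))"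
    using assms(1) by (intro linear_on_comp[OF lin linear_entry[of "{p. is_path W S p}"]]) simp
  have rr: "linear_on {p. is_path W S p} (\<lambda>x. if psrc r = K then entry (ptgt r) L (act (fst r) h) x else 0)"
    using linear_entry by (cases "psrc r = K") (simp_all add: linear_on_def)
  show ?thesis
    by (rule linear_on_eqI[OF l rr _ assms(2)])
       (simp add: linear_on_zero[OF linear_entry] conv_basis pconc_facts act_append)
qed

text \<open>Checked on matrix entries. A path on the left is applied to an entry that is already
  zero. A path on the right moves the argument into the module at its target, by
  \<open>act_x_ideal\<close>, where the entry vanishes again.\<close>

lemma ideal_K: "ideal (K_ideal W S) R"
proof (rule idealI[OF ring_R])
  show "subgroup (K_ideal W S) (add_monoid R)"
  proof (rule group.subgroupI)
    show "group (add_monoid R)" by (rule abelian_group.a_group[OF ring.is_abelian_group[OF ring_R]])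
    have "0 \<in> K_ideal W S" by (simp add: K_ideal_iff linear_on_zero[OF linear_entry])
    then show "K_ideal W S \<noteq> {}" by blast
    fix x assume x: "x \<in> K_ideal W S"
    then have xC: "x \<in> C" by (simp add: K_ideal_iff)
    have "inv\<^bsub>add_monoid R\<^esub> x = 0 - x"
      using xC R_minus[of 0 x] ring.is_abelian_group[OF ring_R] abelian_group.minus_equality[of R]
      by (metis (no_types, lifting) R_simps(1,2) a_inv_def a_minus_def abelian_group.a_inv_closed abelian_monoid.l_zero abelian_group_def fm_zero)
    then show "inv\<^bsub>add_monoid R\<^esub> x \<in> K_ideal W S"
      using x linear_on_diff[OF linear_entry, of 0 "{p. is_path W S p}" x] linear_on_zero[OF linear_entry]
      by (simp add: K_ideal_iff)
  next
    fix x y assume "x \<in> K_ideal W S" "y \<in> K_ideal W S"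
    then show "x \<otimes>\<^bsub>add_monoid R\<^esub> y \<in> K_ideal W S"
      using linear_on_add[OF linear_entry, of x "{p. is_path W S p}" y] by (simp add: K_ideal_iff)
  qed (auto simp: K_ideal_iff)
next
  fix y x assume y: "y \<in> K_ideal W S" and x: "x \<in> carrier R"
  have yC: "y \<in> C" using y by (simp add: K_ideal_iff)
  have supp: "\<And>r. x r \<noteq> 0 \<Longrightarrow> is_path W S r" using x by (auto simp: free_module_def)
  have x_exp: "x = (\<Sum>r | x r \<noteq> 0. scal (x r) (basis_elt r))" using fm_expand x by auto
  have "entry K L h (x \<bullet> y) = 0" if K: "K \<in> finitary W S" "L \<in> finitary W S" "h \<in> x_ideal W S K" for K L h
  proof -
    have hH: "h \<in> H" using K x_ideal_closed finitaryD by blast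
    have e: "x \<bullet> y = (\<Sum>r | x r \<noteq> 0. scal (x r) (basis_elt r \<bullet> y))"
      by (subst x_exp) (simp add: conv_sum_left conv_scal_left)
    have "entry K L h (x \<bullet> y) = (\<Sum>r | x r \<noteq> 0. scal (x r) (entry K L h (basis_elt r \<bullet> y)))"
      unfolding e
      using supp yC by (subst linear_on_sum[OF linear_entry, where B = "{p. is_path W S p}"])
        (auto intro!: sum.cong linear_on_scal[OF linear_entry, where B = "{p. is_path W S p}"])
    also have "\<dots> = 0"
    proof (intro sum.neutral ballI)
      fix r assume "r \<in> {r. x r \<noteq> 0}"
      then have r: "is_path W S r" using supp by auto
      have "entry K (psrc r) h y = 0" using y K path_finitary(1)[OF r] by (simp add: K_ideal_iff)
      then show "scal (x r) (entry K L h (basis_elt r \<bullet> y)) = 0"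
        using entry_conv_left[OF r yC hH] linear_on_zero[of "carrier W" "act (fst r)"] linear_act[of "fst r" "snd r"] r by simp
    qed
    finally show ?thesis .
  qed
  then show "x \<otimes>\<^bsub>R\<^esub> y \<in> K_ideal W S" using x yC by (simp add: mult_conv K_ideal_iff)
  have "entry K L h (y \<bullet> x) = 0" if K: "K \<in> finitary W S" "L \<in> finitary W S" "h \<in> x_ideal W S K" for K L h
  proof -
    have e: "y \<bullet> x = (\<Sum>r | x r \<noteq> 0. scal (x r) (y \<bullet> basis_elt r))"
      by (subst x_exp) (simp add: conv_sum_right conv_scal_right)
    have "entry K L h (y \<bullet> x) = (\<Sum>r | x r \<noteq> 0. scal (x r) (entry K L h (y \<bullet> basis_elt r)))"
      unfolding e
      using supp yC by (subst linear_on_sum[OF linear_entry, where B = "{p. is_path W S p}"])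
        (auto intro!: sum.cong linear_on_scal[OF linear_entry, where B = "{p. is_path W S p}"])
    also have "\<dots> = 0"
    proof (intro sum.neutral ballI)
      fix r assume "r \<in> {r. x r \<noteq> 0}"
      then have r: "is_path W S r" using supp by auto
      have "entry (ptgt r) L (act (fst r) h) y = 0" if "psrc r = K"
        using y K path_finitary[OF r] act_x_ideal[of "fst r" "snd r" h] r that
        by (simp add: K_ideal_iff psrc_eq)
      then show "scal (x r) (entry K L h (y \<bullet> basis_elt r)) = 0"
        using entry_conv_right[OF r yC] by simp
    qed
    finally show ?thesis .
  qed
  then show "y \<otimes>\<^bsub>R\<^esub> x \<in> K_ideal W S" using x yC by (simp add: mult_conv K_ideal_iff)
qed

end

section \<open>Orderings and chains\<close>

context coxeter_group
begin

lemma is_ordering_empty: "is_ordering W S {} [{}]"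
  by (simp add: is_ordering_def)

lemma is_ordering_step:
  "is_ordering W S I cs \<Longrightarrow> J \<in> finitary W S \<Longrightarrow> covers I J \<Longrightarrow> is_ordering W S J (cs @ [J])"
  by (auto simp: is_ordering_def successively_append_iff)

lemma is_ordering_induct [consumes 1, case_names empty step]:
  assumes "is_ordering W S I cs" and "P {} [{}]"
    and step: "\<And>I J cs. is_ordering W S I cs \<Longrightarrow> I \<in> finitary W S \<Longrightarrow> J \<in> finitary W S \<Longrightarrow> covers I J \<Longrightarrow>
      P I cs \<Longrightarrow> P J (cs @ [J])"
  shows "P I cs"
  using assms(1)
proof (induction cs arbitrary: I rule: rev_induct)
  case Nil
  then show ?case by (simp add: is_ordering_def)
next
  case (snoc J cs)
  then have J: "J = I" by (simp add: is_ordering_def)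
  show ?case
  proof (cases "cs = []")
    case True
    then show ?thesis using snoc.prems assms(2) by (auto simp: is_ordering_def)
  next
    case False
    then have "is_ordering W S (last cs) cs" "last cs \<in> finitary W S" "J \<in> finitary W S" "covers (last cs) J"
      using snoc.prems by (auto simp: is_ordering_def successively_append_iff)
    then show ?thesis using step snoc.IH J by blast
  qed
qed

lemma is_ordering_cases:
  assumes "is_ordering W S J ds"
  obtains "J = {}" "ds = [{}]"
  | I cs where "ds = cs @ [J]" "is_ordering W S I cs" "I \<in> finitary W S" "J \<in> finitary W S" "covers I J"
proof -
  have "(J = {} \<and> ds = [{}]) \<or> (\<exists>I cs. ds = cs @ [J] \<and> is_ordering W S I cs \<and> I \<in> finitary W S \<and>
      J \<in> finitary W S \<and> covers I J)"
    using assms by (induction rule: is_ordering_induct) auto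
  then show thesis using that by blast
qed

lemma is_orderingD:
  assumes "is_ordering W S I cs"
  shows "cs \<noteq> []" "hd cs = {}" "last cs = I" "I \<in> finitary W S"
  using assms by (auto simp: is_ordering_def)

lemma covers_iff: "finite J \<Longrightarrow> covers I J \<longleftrightarrow> (\<exists>s \<in> J. I = J - {s})"
proof
  assume fin: "finite J" and "covers I J"
  then have "I \<subseteq> J" "card (J - I) = 1" using card_Diff_subset[of I J] finite_subset[of I J]
    by (auto simp: covers_def)
  then show "\<exists>s \<in> J. I = J - {s}" by (auto simp: card_1_singleton_iff)
next
  assume fin: "finite J" and "\<exists>s \<in> J. I = J - {s}"
  then obtain s where s: "s \<in> J" "I = J - {s}" by blast
  then show "covers I J" using card.remove[OF fin s(1)] by (auto simp: covers_def)
qed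

lemma ex_ordering: "I \<in> finitary W S \<Longrightarrow> \<exists>cs. is_ordering W S I cs"
proof (induction "card I" arbitrary: I)
  case 0
  then show ?case using is_ordering_empty finitaryD(3)[OF 0(2)] by auto
next
  case (Suc n)
  have fin: "finite I" using finitaryD(3)[OF Suc.prems] .
  then obtain s where s: "s \<in> I" using Suc(2) by (metis card.empty ex_in_conv nat.distinct(1))
  then have "n = card (I - {s})" using Suc(2) fin by simp
  moreover have "I - {s} \<in> finitary W S" using finitary_subset[OF Suc.prems] by blast
  ultimately obtain cs where "is_ordering W S (I - {s}) cs" using Suc(1) by blast
  then show ?case using is_ordering_step[OF _ Suc.prems] covers_iff[OF fin] s by blast
qed

lemma map2_Ups_snoc: "cs \<noteq> [] \<Longrightarrow> map2 Ups (cs @ [J]) (tl (cs @ [J])) = map2 Ups cs (tl cs) @ [Ups (last cs) J]"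
  by (induction cs rule: induct_list012) auto

lemma map2_Del_snoc: "cs \<noteq> [] \<Longrightarrow> map2 Del (tl (cs @ [J])) (cs @ [J]) = map2 Del (tl cs) cs @ [Del J (last cs)]"
  by (induction cs rule: induct_list012) auto

lemma arrows_covers:
  assumes "I \<in> finitary W S" "J \<in> finitary W S" "covers I J"
  shows "Ups I J \<in> arrows W S" "Del J I \<in> arrows W S"
  using assms by (auto simp: arrows_def)

text \<open>Along the downward chain nothing happens, and along the upward chain the coset sums
  telescope to \<open>x_elt W I\<close>.\<close>

lemma chain_path:
  assumes "is_ordering W S I cs"
  shows "is_path W S (map2 Ups cs (tl cs), I) \<and> ptgt (map2 Ups cs (tl cs), I) = {} \<and>
    is_path W S (rev (map2 Del (tl cs) cs), {}) \<and> ptgt (rev (map2 Del (tl cs) cs), {}) = I \<and>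
    (\<forall>h \<in> H. act (map2 Ups cs (tl cs)) h = h \<and> act (rev (map2 Del (tl cs) cs)) h = x_elt W I \<star> h)"
  using assms
proof (induction rule: is_ordering_induct)
  case empty
  then show ?case by (simp add: x_elt_empty one_hm)
next
  case (step I J cs)
  note o = is_orderingD[OF step(1)] and arr = arrows_covers[OF step(2-4)]
  have IJ: "I \<subseteq> J" "J \<subseteq> S" using step(3,4) finitaryD by (auto simp: covers_def)
  have "coset_sum J I \<star> (x_elt W I \<star> h) = x_elt W J \<star> h" if "h \<in> H" for h
    using that IJ hm_assoc[of "coset_sum J I" "x_elt W I" h] coset_sum_mult_x[OF IJ] by simp
  then show ?case
    using step o arr
    by (simp add: map2_Ups_snoc[OF o(1)] map2_Del_snoc[OF o(1)] is_path_append ptgt_append act_append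
        del: tl_append2)
qed

lemma ups_closed [simp]: "I \<in> finitary W S \<Longrightarrow> J \<in> finitary W S \<Longrightarrow> covers I J \<Longrightarrow> ups I J \<in> C"
  and del_closed [simp]: "I \<in> finitary W S \<Longrightarrow> J \<in> finitary W S \<Longrightarrow> covers I J \<Longrightarrow> del J I \<in> C"
  by (simp_all add: ups_def del_def arrows_covers)

lemma chain_closed:
  assumes "is_ordering W S I cs"
  shows "ups_chain cs \<in> C" "del_chain cs \<in> C"
  using chain_path[OF assms] is_orderingD[OF assms] by (auto simp: ups_chain_def del_chain_def)

lemma ups_chain_snoc:
  assumes "is_ordering W S I cs"
  shows "ups_chain (cs @ [J]) = ups_chain cs \<bullet> ups I J"
  using is_orderingD[OF assms] map2_Ups_snoc[of cs J]
  by (simp add: ups_chain_def ups_def conv_basis del: tl_append2)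

lemma del_chain_snoc:
  assumes "is_ordering W S I cs"
  shows "del_chain (cs @ [J]) = del J I \<bullet> del_chain cs"
  using is_orderingD[OF assms] map2_Del_snoc[of cs J] chain_path[OF assms]
  by (simp add: del_chain_def del_def conv_basis del: tl_append2)

lemma chain_empty: "ups_chain [{}] = e_path {}" "del_chain [{}] = e_path {}"
  by (simp_all add: ups_chain_def del_chain_def e_path_def)

lemma e_path_conv_basis: "ptgt r = L \<Longrightarrow> e_path L \<bullet> basis_elt r = basis_elt r"
  and conv_basis_e_path: "psrc r = L \<Longrightarrow> basis_elt r \<bullet> e_path L = basis_elt r"
  by (cases r; auto simp: e_path_def conv_basis)+

lemma chain_e_path:
  assumes "is_ordering W S I cs"
  shows "ups_chain cs \<bullet> e_path I = ups_chain cs" "e_path {} \<bullet> ups_chain cs = ups_chain cs"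
    "e_path I \<bullet> del_chain cs = del_chain cs" "del_chain cs \<bullet> e_path {} = del_chain cs"
  using is_orderingD[OF assms] chain_path[OF assms]
  by (simp_all add: ups_chain_def del_chain_def conv_basis_e_path e_path_conv_basis)

section \<open>The relations lie in the kernel\<close>

definition chi :: "'w \<Rightarrow> 'w path \<Rightarrow> int poly" where
  "chi s = basis_elt ([Ups {} {s}, Del {s} {}], {})"

lemma covers_gen: "covers {} {s :: 'w}"
  by (auto simp: covers_def)

lemma chi_eq: "chi s = ups {} {s} \<bullet> del {s} {}"
  by (simp add: chi_def ups_def del_def conv_basis)

lemma chi_path: "s \<in> S \<Longrightarrow> is_path W S ([Ups {} {s}, Del {s} {}], {})"
  using singleton_longest(1)[of s] covers_gen by (auto simp: arrows_def)

lemma chi_closed [simp]: "s \<in> S \<Longrightarrow> chi s \<in> C"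
  using chi_path by (simp add: chi_def del: is_path.simps)

lemma chi_word_simps:
  shows "chi_word W S [] = e_path {}"
    and "set (s # ys) \<subseteq> S \<Longrightarrow> chi_word W S (s # ys) = chi s \<bullet> chi_word W S ys"
    and chi_word_closed [simp]: "set ys \<subseteq> S \<Longrightarrow> chi_word W S ys \<in> C"
proof -
  have step: "chi_word W S (s # ys) = chi s \<bullet> chi_word W S ys" if "s \<in> S" "chi_word W S ys \<in> C" for s ys
    using that singleton_longest(1)[of s] covers_gen by (simp add: chi_word_def mult_conv chi_eq)
  show "chi_word W S [] = e_path {}" by (simp add: chi_word_def)
  have cl: "chi_word W S zs \<in> C" if "set zs \<subseteq> S" for zs
    using that
  proof (induction zs)
    case (Cons s zs)
    then show ?case using step[of s zs] by simp
  qed (simp add: chi_word_def)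
  show "set ys \<subseteq> S \<Longrightarrow> chi_word W S ys \<in> C" by (rule cl)
  show "set (s # ys) \<subseteq> S \<Longrightarrow> chi_word W S (s # ys) = chi s \<bullet> chi_word W S ys"
    using step[of s ys] cl[of ys] by simp
qed

lemma entry_closed: "x \<in> C \<Longrightarrow> h \<in> H \<Longrightarrow> entry K L h x \<in> H"
  unfolding entry_def using linear_act by (intro lin_ext_closed) auto

lemma entry_chi_conv:
  assumes "s \<in> S" "y \<in> C" "h \<in> H"
  shows "entry K {} h (chi s \<bullet> y) = x_elt W {s} \<star> entry K {} h y"
proof -
  have "entry K {} h (chi s \<bullet> y) = coset_sum {s} {} \<star> entry K {} h y"
    using entry_conv_left[OF chi_path[OF assms(1)] assms(2,3), of K "{}"]
    by (simp add: chi_def del: is_path.simps)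
  then show ?thesis using coset_sum_empty[of "{s}"] assms(1) by simp
qed

lemma x_word_simps: "x_word W S [] = T \<one>" "x_word W S (s # ys) = x_elt W {s} \<star> x_word W S ys"
  by (simp_all add: x_word_def hecke_def)

lemma x_word_closed: "set ys \<subseteq> S \<Longrightarrow> x_word W S ys \<in> H"
  by (induction ys) (auto simp: x_word_simps)

lemma entry_chi_word:
  assumes "set ys \<subseteq> S" "h \<in> H"
  shows "entry {} {} h (chi_word W S ys) = x_word W S ys \<star> h"
  using assms
proof (induction ys)
  case Nil
  then show ?case by (simp add: chi_word_simps x_word_simps e_path_def one_hm)
next
  case (Cons s ys)
  then show ?case
    by (simp add: chi_word_simps x_word_simps entry_chi_conv hm_assoc x_word_closed)
qed

lemma entry_empty_vertices:
  assumes "e_path {} \<bullet> x = x" "x \<bullet> e_path {} = x" "K \<noteq> {} \<or> L \<noteq> {}"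
  shows "entry K L h x = 0"
proof -
  have "psrc r = {} \<and> ptgt r = {}" if "x r \<noteq> 0" for r
    using fun_cong[OF assms(1), of r] fun_cong[OF assms(2), of r] that
    by (auto simp: e_path_conv conv_e_path split: if_splits)
  then show ?thesis using assms(3) by (fastforce simp: entry_def lin_ext_def intro!: sum.neutral)
qed

lemma chi_word_e_path:
  assumes "set ys \<subseteq> S"
  shows "e_path {} \<bullet> chi_word W S ys = chi_word W S ys" "chi_word W S ys \<bullet> e_path {} = chi_word W S ys"
proof -
  have e: "e_path {} \<bullet> e_path {} = (e_path {} :: 'w path \<Rightarrow> int poly)"
    by (simp add: e_path_def conv_basis)
  have c: "e_path {} \<bullet> chi s = chi s" for s by (simp add: chi_def e_path_conv_basis)
  show "e_path {} \<bullet> chi_word W S ys = chi_word W S ys"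
    using assms by (cases ys) (simp_all add: chi_word_simps e conv_assoc[symmetric] c)
  show "chi_word W S ys \<bullet> e_path {} = chi_word W S ys"
    using assms by (induction ys) (simp_all add: chi_word_simps e conv_assoc)
qed

lemma strict_subseqD:
  assumes "strict_subseq ys ws"
  shows "set ys \<subseteq> set ws" "length ys < length ws"
proof -
  have s: "subseq ys ws" "ys \<noteq> ws" using assms by (auto simp: strict_subseq_def)
  show "set ys \<subseteq> set ws" using list_emb_set[OF s(1)] by blast
  show "length ys < length ws"
    using s list_emb_length[OF s(1)] subseq_same_length[OF s(1)] by linarith
qed

lemma subword_comb_eq:
  "subword_comb a f ws = f ws + scal qvar (\<Sum>ys | strict_subseq ys ws. scal (a ys ws) (f ys))"
  by (auto simp: subword_comb_def fun_eq_iff sum_apply scal_apply)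

lemma linear_subword_comb:
  assumes "linear_on B F" "\<And>ys. set ys \<subseteq> set ws \<Longrightarrow> f ys \<in> free_module B"
  shows "F (subword_comb a f ws) = subword_comb a (\<lambda>ys. F (f ys)) ws"
proof -
  have f: "strict_subseq ys ws \<Longrightarrow> f ys \<in> free_module B" for ys using assms(2) strict_subseqD(1) by blast
  have "F (\<Sum>ys | strict_subseq ys ws. scal (a ys ws) (f ys)) =
      (\<Sum>ys | strict_subseq ys ws. scal (a ys ws) (F (f ys)))"
    using f by (subst linear_on_sum[OF assms(1)]) (auto intro!: sum.cong linear_on_scal[OF assms(1)])
  moreover have "(\<Sum>ys | strict_subseq ys ws. scal (a ys ws) (f ys)) \<in> free_module B"
    using f by (intro fm_sum fm_scal) auto
  ultimately show ?thesis
    unfolding subword_comb_eq using assms(2)[of ws]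
    by (simp add: linear_on_add[OF assms(1)] linear_on_scal[OF assms(1)])
qed

lemma subword_comb_closed:
  "(\<And>ys. set ys \<subseteq> set ws \<Longrightarrow> f ys \<in> free_module B) \<Longrightarrow> subword_comb a f ws \<in> free_module B"
  unfolding subword_comb_eq using strict_subseqD(1) by (intro fm_add fm_scal fm_sum) auto

lemma subword_comb_cong:
  assumes "\<And>ys. set ys \<subseteq> set ws \<Longrightarrow> f ys = g ys"
  shows "subword_comb a f ws = subword_comb a g ws"
proof -
  have "(\<Sum>ys | strict_subseq ys ws. scal (a ys ws) (f ys)) =
      (\<Sum>ys | strict_subseq ys ws. scal (a ys ws) (g ys))"
  proof (rule sum.cong)
    fix ys assume "ys \<in> {ys. strict_subseq ys ws}"
    then have "f ys = g ys" using strict_subseqD(1)[of ys ws] by (intro assms) simp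
    then show "scal (a ys ws) (f ys) = scal (a ys ws) (g ys)" by (simp only:)
  qed simp
  then show ?thesis unfolding subword_comb_eq using assms[of ws] by simp
qed

end

locale hasse_relations = coxeter_group W S for W :: "('w, 'm) monoid_scheme" (structure) and S :: "'w set" +
  fixes rex :: "'w set list \<Rightarrow> 'w list" and a :: "'w list \<Rightarrow> 'w list \<Rightarrow> int poly"
  assumes rex: "\<And>I cs. I \<in> finitary W S \<Longrightarrow> is_ordering W S I cs \<Longrightarrow> adapted_expr W S cs (rex cs)"
    and a: "\<And>I cs. I \<in> finitary W S \<Longrightarrow> is_ordering W S I cs \<Longrightarrow>
              x_elt W I = subword_comb a (x_word W S) (rex cs)"
begin

lemma rex_reduced: "is_ordering W S I cs \<Longrightarrow> reduced_expr W S (longest W S I) (rex cs)"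
  using rex[of I cs] is_orderingD[of I cs] by (auto simp: adapted_expr_def)

lemma rex_letters: "is_ordering W S I cs \<Longrightarrow> set (rex cs) \<subseteq> S"
  using rex_reduced reduced_exprD(1) by blast

abbreviation chi_ordering :: "'w set list \<Rightarrow> 'w path \<Rightarrow> int poly" where
  "chi_ordering cs \<equiv> subword_comb a (chi_word W S) (rex cs)"

lemma chi_ordering_closed: "is_ordering W S I cs \<Longrightarrow> chi_ordering cs \<in> C"
  using rex_letters[of I cs] by (intro subword_comb_closed chi_word_closed) auto

lemma quasi_idempotent_rels_K: "quasi_idempotent_rels W S \<subseteq> K_ideal W S"
proof
  fix x assume "x \<in> quasi_idempotent_rels W S"
  then obtain I J where IJ: "I \<in> finitary W S" "J \<in> finitary W S" "covers I J"
    and "x = (del J I \<otimes>\<^bsub>R\<^esub> ups I J) \<ominus>\<^bsub>R\<^esub> scal (\<pi> J div \<pi> I) (e_path J)"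
    by (auto simp: quasi_idempotent_rels_def)
  then have x: "x = del J I \<bullet> ups I J - scal (\<pi> J div \<pi> I) (e_path J)"
    by (simp add: mult_conv R_minus)
  have C: "del J I \<bullet> ups I J \<in> C" "scal (\<pi> J div \<pi> I) (e_path J) \<in> C" using IJ by simp_all
  have "entry K L h x = 0" if h: "h \<in> x_ideal W S K" "K \<in> finitary W S" for K L h
  proof (cases "K = J \<and> L = J")
    case True
    then obtain h' where h': "h' \<in> H" "h = x_elt W J \<star> h'" using h by (elim x_idealE) auto
    have "I \<subseteq> J" "J \<subseteq> S" using IJ finitaryD by (auto simp: covers_def)
    then have "coset_sum J I \<star> h = scal (\<pi> J div \<pi> I) h"
      using h' hm_assoc[of "coset_sum J I" "x_elt W J" h'] coset_sum_mult_x_top[OF _ IJ(2), of I]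
      by (simp add: hm_scal_left)
    then show ?thesis
      unfolding x linear_on_diff[OF linear_entry C] linear_on_scal[OF linear_entry e_path_closed[OF IJ(2)]]
      using True by (simp add: e_path_def del_def ups_def conv_basis)
  next
    case False
    then show ?thesis
      unfolding x linear_on_diff[OF linear_entry C] linear_on_scal[OF linear_entry e_path_closed[OF IJ(2)]]
      by (auto simp: e_path_def del_def ups_def conv_basis)
  qed
  then show "x \<in> K_ideal W S" using x C by (simp add: K_ideal_iff)
qed

text \<open>On an element \<open>x_elt W I \<star> h'\<close> the two upward composites both give
  \<open>x_elt W K \<star> h'\<close>, whichever intermediate set is used. The two downward
  composites both act as the identity.\<close>

lemma sandwich_rels_K: "sandwich_rels W S \<subseteq> K_ideal W S"
proof
  fix x assume "x \<in> sandwich_rels W S"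
  then obtain I J J' K where fin: "I \<in> finitary W S" "J \<in> finitary W S" "J' \<in> finitary W S" "K \<in> finitary W S"
    and cov: "covers I J" "covers J K" "covers I J'" "covers J' K"
    and "x = (ups I J \<otimes>\<^bsub>R\<^esub> ups J K) \<ominus>\<^bsub>R\<^esub> (ups I J' \<otimes>\<^bsub>R\<^esub> ups J' K) \<or>
         x = (del K J \<otimes>\<^bsub>R\<^esub> del J I) \<ominus>\<^bsub>R\<^esub> (del K J' \<otimes>\<^bsub>R\<^esub> del J' I)"
    by (auto simp: sandwich_rels_def)
  then have x: "x = ups I J \<bullet> ups J K - ups I J' \<bullet> ups J' K \<or>
      x = del K J \<bullet> del J I - del K J' \<bullet> del J' I"
    by (simp add: mult_conv R_minus)
  have C: "ups I J \<bullet> ups J K \<in> C" "ups I J' \<bullet> ups J' K \<in> C"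
    "del K J \<bullet> del J I \<in> C" "del K J' \<bullet> del J' I \<in> C" using fin cov by simp_all
  have "entry M L h x = 0" if h: "h \<in> x_ideal W S M" "M \<in> finitary W S" for M L h
  proof -
    have two: "coset_sum K J \<star> (coset_sum J I \<star> h) = x_elt W K \<star> h'"
      if "h' \<in> H" "h = x_elt W I \<star> h'" "covers I J" "covers J K" "J \<in> finitary W S" for h' J
    proof -
      have sub: "I \<subseteq> J" "J \<subseteq> S" "J \<subseteq> K" "K \<subseteq> S" using that fin finitaryD by (auto simp: covers_def)
      then show ?thesis
        using that hm_assoc[of "coset_sum J I" "x_elt W I" h'] hm_assoc[of "coset_sum K J" "x_elt W J" h']
          coset_sum_mult_x[of I J] coset_sum_mult_x[of J K] by simp
    qed
    have "coset_sum K J \<star> (coset_sum J I \<star> h) = coset_sum K J' \<star> (coset_sum J' I \<star> h)" if "M = I"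
      using h(1)[unfolded that] two fin cov by (elim x_idealE) metis
    moreover have "entry M L h x = entry M L h (ups I J \<bullet> ups J K) - entry M L h (ups I J' \<bullet> ups J' K) \<or>
        entry M L h x = entry M L h (del K J \<bullet> del J I) - entry M L h (del K J' \<bullet> del J' I)"
      using x linear_on_diff[OF linear_entry C(1,2)] linear_on_diff[OF linear_entry C(3,4)] by auto
    ultimately show ?thesis by (auto simp: del_def ups_def conv_basis)
  qed
  then show "x \<in> K_ideal W S" using x C by (auto simp: K_ideal_iff)
qed

text \<open>At the vertex \<open>{}\<close> the chain product acts as \<open>x_elt W I\<close> and
  each \<open>chi_word\<close> as the corresponding \<open>x_word\<close>. So the relation becomes
  the expansion of \<open>x_elt W I\<close> that defines the coefficients \<open>a\<close>.\<close>

lemma braid_rels_K: "braid_rels W S rex a \<subseteq> K_ideal W S"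
proof
  fix x assume "x \<in> braid_rels W S rex a"
  then obtain I cs where o: "is_ordering W S I cs"
    and "x = (ups_chain cs \<otimes>\<^bsub>R\<^esub> del_chain cs) \<ominus>\<^bsub>R\<^esub> chi_ordering cs"
    by (auto simp: braid_rels_def)
  then have x: "x = ups_chain cs \<bullet> del_chain cs - chi_ordering cs"
    using chain_closed[OF o] chi_ordering_closed[OF o] by (simp add: mult_conv R_minus)
  note I = is_orderingD[OF o] and p = chain_path[OF o]
  have C: "ups_chain cs \<bullet> del_chain cs \<in> C" "chi_ordering cs \<in> C"
    using chain_closed[OF o] chi_ordering_closed[OF o] by simp_all
  have chi_C: "set ys \<subseteq> set (rex cs) \<Longrightarrow> chi_word W S ys \<in> C" for ys using rex_letters[OF o] by auto
  have "entry K L h x = 0" if h: "h \<in> x_ideal W S K" "K \<in> finitary W S" for K L h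
  proof (cases "K = {} \<and> L = {}")
    case True
    have hH: "h \<in> H" using h x_ideal_closed finitaryD by blast
    have "entry {} {} h (ups_chain cs \<bullet> del_chain cs) = x_elt W I \<star> h"
      using p I hH finitaryD(1)[OF I(4)]
      by (simp add: ups_chain_def del_chain_def conv_basis act_append ptgt_append)
    moreover have "entry {} {} h (chi_ordering cs) = x_elt W I \<star> h"
    proof -
      have "entry {} {} h (chi_ordering cs) = subword_comb a (\<lambda>ys. entry {} {} h (chi_word W S ys)) (rex cs)"
        by (rule linear_subword_comb[OF linear_entry chi_C])
      also have "\<dots> = subword_comb a (\<lambda>ys. x_word W S ys \<star> h) (rex cs)"
        using rex_letters[OF o] hH by (intro subword_comb_cong) (simp add: entry_chi_word)
      also have "\<dots> = subword_comb a (x_word W S) (rex cs) \<star> h"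
        by (rule linear_subword_comb[OF linear_hm_left, symmetric, where B = "carrier W"])
          (use rex_letters[OF o] x_word_closed in auto)
      finally show ?thesis using a[OF I(4) o] by simp
    qed
    ultimately show ?thesis unfolding x using True by (simp add: linear_on_diff[OF linear_entry C])
  next
    \<comment> \<open>Both terms are made of closed paths at \<open>{}\<close>, so no other entry
      receives a contribution.\<close>
    case False
    have "e_path {} \<bullet> chi_ordering cs = chi_ordering cs"
    proof -
      have "e_path {} \<bullet> chi_ordering cs = subword_comb a (\<lambda>ys. e_path {} \<bullet> chi_word W S ys) (rex cs)"
        by (rule linear_subword_comb[where B = "{p. is_path W S p}"])
          (auto simp: linear_on_def conv_add_right conv_scal_right chi_C)
      also have "\<dots> = chi_ordering cs"
        using rex_letters[OF o] by (intro subword_comb_cong) (simp add: chi_word_e_path)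
      finally show ?thesis .
    qed
    moreover have "chi_ordering cs \<bullet> e_path {} = chi_ordering cs"
    proof -
      have "chi_ordering cs \<bullet> e_path {} = subword_comb a (\<lambda>ys. chi_word W S ys \<bullet> e_path {}) (rex cs)"
        by (rule linear_subword_comb[where B = "{p. is_path W S p}"])
          (auto simp: linear_on_def conv_add_left conv_scal_left chi_C)
      also have "\<dots> = chi_ordering cs"
        using rex_letters[OF o] by (intro subword_comb_cong) (simp add: chi_word_e_path)
      finally show ?thesis .
    qed
    ultimately have "e_path {} \<bullet> x = x" "x \<bullet> e_path {} = x"
      unfolding x conv_diff_left conv_diff_right conv_assoc[of "ups_chain cs"] conv_assoc[of "e_path {}", symmetric]
      by (simp_all add: chain_e_path[OF o])
    then show ?thesis using False by (intro entry_empty_vertices) auto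
  qed
  then show "x \<in> K_ideal W S" using x C by (simp add: K_ideal_iff)
qed

lemma J_rels_K: "J_rels W S rex a \<subseteq> K_ideal W S"
  unfolding J_rels_def using quasi_idempotent_rels_K sandwich_rels_K braid_rels_K by blast

end

text \<open>Rules for inductive sets of functions come out eta-expanded, so these would unfold sums.\<close>
lemmas [simp del] = plus_fun_apply zero_fun_apply

context hasse_relations
begin

section \<open>Congruence modulo the relations\<close>

definition Jid :: "('w path \<Rightarrow> int poly) set" where
  "Jid = Idl\<^bsub>R\<^esub> (J_rels W S rex a)"

lemma K_C: "K_ideal W S \<subseteq> C"
  by (auto simp: K_ideal_iff)

lemma ideal_Jid: "ideal Jid R"
  unfolding Jid_def using ring.genideal_ideal[OF ring_R] J_rels_K K_C by simp

lemma Jid_K: "Jid \<subseteq> K_ideal W S"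
  unfolding Jid_def by (rule ring.genideal_minimal[OF ring_R ideal_K J_rels_K])

lemma rels_Jid: "x \<in> J_rels W S rex a \<Longrightarrow> x \<in> Jid"
  unfolding Jid_def using ring.genideal_self[OF ring_R, of "J_rels W S rex a"] J_rels_K K_C by auto

lemma ideal_closed:
  assumes "ideal I R"
  shows "0 \<in> I" "x \<in> I \<Longrightarrow> y \<in> I \<Longrightarrow> x + y \<in> I"
    "x \<in> I \<Longrightarrow> y \<in> C \<Longrightarrow> y \<bullet> x \<in> I" "x \<in> I \<Longrightarrow> y \<in> C \<Longrightarrow> x \<bullet> y \<in> I"
    "x \<in> I \<Longrightarrow> scal f x \<in> I" "x \<in> I \<Longrightarrow> y \<in> I \<Longrightarrow> x - y \<in> I"
proof -
  interpret ideal I R by fact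
  have sub: "x \<in> I \<Longrightarrow> x \<in> C" for x using a_subset by auto
  show "0 \<in> I" using additive_subgroup.zero_closed[OF ideal.axioms(1)[OF assms]] by simp
  show add: "x \<in> I \<Longrightarrow> y \<in> I \<Longrightarrow> x + y \<in> I" for x y
    using additive_subgroup.a_closed[OF ideal.axioms(1)[OF assms], of x y] by simp
  show left: "x \<in> I \<Longrightarrow> y \<in> C \<Longrightarrow> y \<bullet> x \<in> I" for x y
    using I_l_closed[of x y] sub[of x] by (simp add: mult_conv)
  show "x \<in> I \<Longrightarrow> y \<in> C \<Longrightarrow> x \<bullet> y \<in> I"
    using I_r_closed[of x y] sub[of x] by (simp add: mult_conv)
  have one: "(\<Sum>K \<in> finitary W S. e_path K) \<in> C" by (rule fm_sum) simp
  show sc: "x \<in> I \<Longrightarrow> scal f x \<in> I" for x f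
    using left[of x "scal f (\<Sum>K \<in> finitary W S. e_path K)"] fm_scal[OF one] one_conv[OF sub, of x]
    by (simp add: conv_scal_left)
  have "x - y = x + scal (- 1) y" by (auto simp: fun_eq_iff scal_apply plus_fun_apply)
  then show "x \<in> I \<Longrightarrow> y \<in> I \<Longrightarrow> x - y \<in> I" using add[of x "scal (- 1) y"] sc[of y "- 1"] by metis
qed

lemma ideal_sum: "ideal I R \<Longrightarrow> (\<And>i. i \<in> A \<Longrightarrow> F i \<in> I) \<Longrightarrow> (\<Sum>i\<in>A. F i) \<in> I"
  by (induction A rule: infinite_finite_induct) (auto simp: ideal_closed)

lemmas Jid_closed = ideal_closed[OF ideal_Jid]

definition cg :: "('w path \<Rightarrow> int poly) \<Rightarrow> ('w path \<Rightarrow> int poly) \<Rightarrow> bool"  (infix "\<approx>" 50) where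
  "x \<approx> y \<longleftrightarrow> x - y \<in> Jid"

lemma cg_refl [simp]: "x \<approx> x"
  by (simp add: cg_def Jid_closed)

lemma cg_zero: "x \<approx> 0 \<longleftrightarrow> x \<in> Jid"
  by (simp add: cg_def)

lemma cg_sym: "x \<approx> y \<Longrightarrow> y \<approx> x"
  using Jid_closed(6)[OF Jid_closed(1), of "x - y"] by (simp add: cg_def)

lemma cg_trans [trans]: "x \<approx> y \<Longrightarrow> y \<approx> z \<Longrightarrow> x \<approx> z"
  using Jid_closed(2)[of "x - y" "y - z"] by (simp add: cg_def)

lemma cg_eq_trans [trans]: "x = y \<Longrightarrow> y \<approx> z \<Longrightarrow> x \<approx> z"
  and eq_cg_trans [trans]: "x \<approx> y \<Longrightarrow> y = z \<Longrightarrow> x \<approx> z"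
  by simp_all

lemma cg_add: "x \<approx> x' \<Longrightarrow> y \<approx> y' \<Longrightarrow> x + y \<approx> x' + y'"
  using Jid_closed(2)[of "x - x'" "y - y'"] by (simp add: cg_def algebra_simps)

lemma cg_diff: "x \<approx> x' \<Longrightarrow> y \<approx> y' \<Longrightarrow> x - y \<approx> x' - y'"
  using Jid_closed(6)[of "x - x'" "y - y'"] by (simp add: cg_def algebra_simps)

lemma cg_scal: "x \<approx> y \<Longrightarrow> scal f x \<approx> scal f y"
  using Jid_closed(5)[of "x - y" f] by (simp add: cg_def scal_diff)

lemma cg_left: "y \<approx> y' \<Longrightarrow> x \<in> C \<Longrightarrow> x \<bullet> y \<approx> x \<bullet> y'"
  using Jid_closed(3)[of "y - y'" x] by (simp add: cg_def conv_diff_right)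

lemma cg_right: "x \<approx> x' \<Longrightarrow> y \<in> C \<Longrightarrow> x \<bullet> y \<approx> x' \<bullet> y"
  using Jid_closed(4)[of "x - x'" y] by (simp add: cg_def conv_diff_left)

lemma entry_cong:
  assumes "x \<approx> y" "x \<in> C" "y \<in> C" "K \<in> finitary W S" "L \<in> finitary W S" "h \<in> x_ideal W S K"
  shows "entry K L h x = entry K L h y"
proof -
  have "x - y \<in> K_ideal W S" using assms(1) Jid_K by (auto simp: cg_def)
  then have "entry K L h (x - y) = 0" using assms by (simp add: K_ideal_iff)
  then show ?thesis using linear_on_diff[OF linear_entry assms(2,3)] by simp
qed

section \<open>The relations as congruences\<close>

lemma quasi_idempotent:
  assumes "I \<in> finitary W S" "J \<in> finitary W S" "covers I J"
  shows "del J I \<bullet> ups I J \<approx> scal (\<pi> J div \<pi> I) (e_path J)"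
proof -
  have "(del J I \<otimes>\<^bsub>R\<^esub> ups I J) \<ominus>\<^bsub>R\<^esub> scal (\<pi> J div \<pi> I) (e_path J) \<in> Jid"
    using assms by (intro rels_Jid) (auto simp: J_rels_def quasi_idempotent_rels_def)
  then show ?thesis using assms by (simp add: cg_def mult_conv R_minus)
qed

lemma sandwich:
  assumes "I \<in> finitary W S" "J \<in> finitary W S" "J' \<in> finitary W S" "K \<in> finitary W S"
    and "covers I J" "covers J K" "covers I J'" "covers J' K"
  shows "ups I J \<bullet> ups J K \<approx> ups I J' \<bullet> ups J' K" "del K J \<bullet> del J I \<approx> del K J' \<bullet> del J' I"
proof -
  have "(ups I J \<otimes>\<^bsub>R\<^esub> ups J K) \<ominus>\<^bsub>R\<^esub> (ups I J' \<otimes>\<^bsub>R\<^esub> ups J' K) \<in> Jid"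
    "(del K J \<otimes>\<^bsub>R\<^esub> del J I) \<ominus>\<^bsub>R\<^esub> (del K J' \<otimes>\<^bsub>R\<^esub> del J' I) \<in> Jid"
    using assms unfolding J_rels_def sandwich_rels_def
    by (intro rels_Jid[unfolded J_rels_def sandwich_rels_def] UnI1 UnI2 UN_I[of "(I, J, J', K)"]; simp)+
  then show "ups I J \<bullet> ups J K \<approx> ups I J' \<bullet> ups J' K" "del K J \<bullet> del J I \<approx> del K J' \<bullet> del J' I"
    using assms by (simp_all add: cg_def mult_conv R_minus)
qed

lemma extended_braid:
  assumes "is_ordering W S I cs" "I \<noteq> {}"
  shows "ups_chain cs \<bullet> del_chain cs \<approx> chi_ordering cs"
proof -
  have "(ups_chain cs \<otimes>\<^bsub>R\<^esub> del_chain cs) \<ominus>\<^bsub>R\<^esub> chi_ordering cs \<in> Jid"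
    using assms is_orderingD(4)[OF assms(1)]
    by (intro rels_Jid) (auto simp: J_rels_def braid_rels_def)
  then show ?thesis
    using chain_closed[OF assms(1)] chi_ordering_closed[OF assms(1)] by (simp add: cg_def mult_conv R_minus)
qed

lemma del_ups_chain:
  assumes "is_ordering W S I cs"
  shows "del_chain cs \<bullet> ups_chain cs \<approx> scal (\<pi> I) (e_path I)"
  using assms
proof (induction rule: is_ordering_induct)
  case empty
  then show ?case by (simp add: chain_empty e_path_def conv_basis)
next
  case (step I J cs)
  note C = chain_closed[OF step(1)] ups_closed[OF step(2-4)] del_closed[OF step(2-4)]
  have e: "e_path I \<bullet> ups I J = ups I J" by (simp add: ups_def e_path_conv_basis)
  have "del_chain (cs @ [J]) \<bullet> ups_chain (cs @ [J]) = del J I \<bullet> ((del_chain cs \<bullet> ups_chain cs) \<bullet> ups I J)"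
    by (simp add: del_chain_snoc[OF step(1)] ups_chain_snoc[OF step(1)] conv_assoc)
  also have "\<dots> \<approx> del J I \<bullet> (scal (\<pi> I) (e_path I) \<bullet> ups I J)"
    using C by (intro cg_left cg_right step.IH)
  also have "\<dots> = scal (\<pi> I) (del J I \<bullet> ups I J)" by (simp add: conv_scal_left conv_scal_right e)
  also have "\<dots> \<approx> scal (\<pi> I) (scal (\<pi> J div \<pi> I) (e_path J))"
    by (intro cg_scal quasi_idempotent step)
  also have "\<dots> = scal (\<pi> J) (e_path J)"
    using poincare_div(2)[of I J] step(3,4) by (auto simp: covers_def mult.commute)
  finally show ?case .
qed

text \<open>Induction on the size of \<open>I\<close>. If the last steps start from different sets
  \<open>A\<close> and \<open>B\<close>, both chains are compared with chains through the
  intersection of \<open>A\<close> and \<open>B\<close>, which it is covered by, and one sandwich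
  relation exchanges \<open>A\<close> for \<open>B\<close>.\<close>

lemma chain_independent:
  assumes "is_ordering W S I cs" "is_ordering W S I ds"
  shows "ups_chain cs \<approx> ups_chain ds \<and> del_chain cs \<approx> del_chain ds"
  using assms
proof (induction "card I" arbitrary: I cs ds rule: less_induct)
  case less
  show ?case
  proof (cases "I = {}")
    case True
    have "cs = [{}]" using less.prems(1) True by (cases rule: is_ordering_cases) (auto simp: covers_def)
    moreover have "ds = [{}]" using less.prems(2) True by (cases rule: is_ordering_cases) (auto simp: covers_def)
    ultimately show ?thesis by simp
  next
    case False
    obtain A cs' where A: "cs = cs' @ [I]" "is_ordering W S A cs'" "A \<in> finitary W S" "I \<in> finitary W S" "covers A I"
      using less.prems(1) False by (cases rule: is_ordering_cases) auto
    obtain B ds' where B: "ds = ds' @ [I]" "is_ordering W S B ds'" "B \<in> finitary W S" "covers B I"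
      using less.prems(2) False by (cases rule: is_ordering_cases) auto
    have fin: "finite I" using finitaryD(3)[OF A(4)] .
    have card: "card A < card I" "card B < card I" using A B by (auto simp: covers_def)
    note C = ups_closed[OF A(3-5)] del_closed[OF A(3-5)] ups_closed[OF B(3) A(4) B(4)] del_closed[OF B(3) A(4) B(4)]
    note sn = ups_chain_snoc[OF A(2)] del_chain_snoc[OF A(2)] ups_chain_snoc[OF B(2)] del_chain_snoc[OF B(2)]
    show ?thesis
    proof (cases "A = B")
      case True
      have "ups_chain cs' \<approx> ups_chain ds'" "del_chain cs' \<approx> del_chain ds'"
        using less.hyps[OF card(1) A(2)] B(2) True by auto
      then have "ups_chain cs' \<bullet> ups A I \<approx> ups_chain ds' \<bullet> ups A I"
        "del I A \<bullet> del_chain cs' \<approx> del I A \<bullet> del_chain ds'"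
        using cg_right[OF _ C(1)] cg_left[OF _ C(2)] by blast+
      then show ?thesis using sn A(1) B(1) True by simp
    next
      case False
      obtain s t where s: "s \<in> I" "A = I - {s}" and t: "t \<in> I" "B = I - {t}"
        using covers_iff[OF fin, of A] covers_iff[OF fin, of B] A(5) B(4) by auto
      let ?D = "I - {s, t}"
      have D: "?D \<in> finitary W S" using finitary_subset[OF A(4)] by blast
      have dA: "?D = A - {t}" "t \<in> A" and dB: "?D = B - {s}" "s \<in> B" using s t False by auto
      have "\<exists>u \<in> A. ?D = A - {u}" "\<exists>u \<in> B. ?D = B - {u}" using dA dB by (metis, metis)
      then have cov: "covers ?D A" "covers ?D B"
        by (simp_all only: covers_iff[OF finitaryD(3)[OF A(3)]] covers_iff[OF finitaryD(3)[OF B(3)]])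
      obtain es where es: "is_ordering W S ?D es" using ex_ordering[OF D] by blast
      note oA = is_ordering_step[OF es A(3) cov(1)] and oB = is_ordering_step[OF es B(3) cov(2)]
      have IA: "ups_chain cs' \<approx> ups_chain (es @ [A])" "del_chain cs' \<approx> del_chain (es @ [A])"
        using less.hyps[OF card(1) A(2) oA] by auto
      have IB: "ups_chain (es @ [B]) \<approx> ups_chain ds'" "del_chain (es @ [B]) \<approx> del_chain ds'"
        using less.hyps[OF card(2) oB B(2)] by auto
      note sw = sandwich[OF D A(3) B(3) A(4) cov(1) A(5) cov(2) B(4)]
      note Ce = chain_closed[OF es]
      have "ups_chain cs = ups_chain cs' \<bullet> ups A I" using A(1) sn by simp
      also have "\<dots> \<approx> ups_chain (es @ [A]) \<bullet> ups A I" using IA C by (intro cg_right)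
      also have "\<dots> = ups_chain es \<bullet> (ups ?D A \<bullet> ups A I)" by (simp add: ups_chain_snoc[OF es] conv_assoc)
      also have "\<dots> \<approx> ups_chain es \<bullet> (ups ?D B \<bullet> ups B I)" using sw Ce by (intro cg_left)
      also have "\<dots> = ups_chain (es @ [B]) \<bullet> ups B I" by (simp add: ups_chain_snoc[OF es] conv_assoc)
      also have "\<dots> \<approx> ups_chain ds' \<bullet> ups B I" using IB C by (intro cg_right)
      also have "\<dots> = ups_chain ds" using B(1) sn by simp
      finally have U: "ups_chain cs \<approx> ups_chain ds" .
      have "del_chain cs = del I A \<bullet> del_chain cs'" using A(1) sn by simp
      also have "\<dots> \<approx> del I A \<bullet> del_chain (es @ [A])" using IA C by (intro cg_left)
      also have "\<dots> = del I A \<bullet> del A ?D \<bullet> del_chain es" by (simp add: del_chain_snoc[OF es] conv_assoc)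
      also have "\<dots> \<approx> del I B \<bullet> del B ?D \<bullet> del_chain es" using sw Ce by (intro cg_right)
      also have "\<dots> = del I B \<bullet> del_chain (es @ [B])" by (simp add: del_chain_snoc[OF es] conv_assoc)
      also have "\<dots> \<approx> del I B \<bullet> del_chain ds'" using IB C by (intro cg_left)
      also have "\<dots> = del_chain ds" using B(1) sn by simp
      finally show ?thesis using U by simp
    qed
  qed
qed

lemma path_combsD:
  assumes "p \<in> path_combs W S I J"
  shows "p \<in> C" "e_path J \<bullet> p = p" "p \<bullet> e_path I = p"
proof -
  show "p \<in> C" using assms unfolding path_combs_def by (rule fm_mono) auto
  have "\<And>r. p r \<noteq> 0 \<Longrightarrow> ptgt r = J \<and> psrc r = I" using assms by (auto simp: path_combs_def free_module_def)
  then show "e_path J \<bullet> p = p" "p \<bullet> e_path I = p"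
    by (auto simp: e_path_conv conv_e_path fun_eq_iff simp del: ptgt.simps psrc.simps)
qed

text \<open>Entries lie in a free module over an integral domain, where a nonzero polynomial can be
  cancelled. Torsion modulo the relations is therefore always in the kernel, as
  \<open>P_torsion\<close> demands.\<close>

lemma K_ideal_cancel:
  assumes "scal f x \<in> K_ideal W S" "f \<noteq> 0" "x \<in> C"
  shows "x \<in> K_ideal W S"
proof -
  have "entry K L h x = 0" if "K \<in> finitary W S" "L \<in> finitary W S" "h \<in> x_ideal W S K" for K L h
  proof -
    have "scal f (entry K L h x) = 0"
      using assms(1) that linear_on_scal[OF linear_entry assms(3)] by (simp add: K_ideal_iff)
    then show ?thesis using scal_eq_0[OF assms(2), of "entry K L h x"] by blast
  qed
  then show ?thesis using assms(3) by (simp add: K_ideal_iff)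
qed

text \<open>The factor \<open>g\<close> serves both halves of the result: it is \<open>1\<close>
  when the sandwiched element vanishes by hypothesis, and the product of inserted polynomials when
  \<open>p\<close> is only known to be in the kernel.\<close>

lemma P_torsionI:
  assumes p: "p \<in> path_combs W S I J" and cI: "is_ordering W S I cI" and cJ: "is_ordering W S J cJ"
    and g: "g \<in> P_polys" and J: "scal g (ups_chain cJ \<bullet> p \<bullet> del_chain cI) \<in> Jid"
  shows "P_torsion W S rex a p"
proof -
  note pC = path_combsD[OF p] and C = chain_closed[OF cI] chain_closed[OF cJ]
  let ?f = "g * (\<pi> J * \<pi> I)"
  have f: "?f \<in> P_polys" using g poincare_P is_orderingD(4)[OF cI] is_orderingD(4)[OF cJ] P_polys_mult by blast
  have "scal g (del_chain cJ \<bullet> (ups_chain cJ \<bullet> p \<bullet> del_chain cI) \<bullet> ups_chain cI) \<in> Jid"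
    using Jid_closed(4)[OF Jid_closed(3)[OF J C(4)] C(1)] by (simp add: conv_scal_left conv_scal_right)
  moreover have "scal g (del_chain cJ \<bullet> (ups_chain cJ \<bullet> p \<bullet> del_chain cI) \<bullet> ups_chain cI) \<approx> scal ?f p"
  proof -
    have "del_chain cJ \<bullet> (ups_chain cJ \<bullet> p \<bullet> del_chain cI) \<bullet> ups_chain cI =
        (del_chain cJ \<bullet> ups_chain cJ) \<bullet> (p \<bullet> (del_chain cI \<bullet> ups_chain cI))"
      by (simp add: conv_assoc)
    also have "\<dots> \<approx> (del_chain cJ \<bullet> ups_chain cJ) \<bullet> (p \<bullet> scal (\<pi> I) (e_path I))"
      using C pC(1) by (intro cg_left del_ups_chain cI) simp_all
    also have "\<dots> \<approx> scal (\<pi> J) (e_path J) \<bullet> (p \<bullet> scal (\<pi> I) (e_path I))"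
      using pC(1) is_orderingD(4)[OF cI] by (intro cg_right del_ups_chain cJ) simp_all
    also have "\<dots> = scal (\<pi> J * \<pi> I) p"
      using pC by (simp add: conv_scal_left conv_scal_right mult.commute)
    finally show ?thesis using cg_scal by fastforce
  qed
  ultimately have "scal ?f p \<in> Jid" using cg_sym cg_trans cg_zero by blast
  moreover from this have "p \<in> K_ideal W S"
    using K_ideal_cancel[of ?f p] Jid_K P_polys_nonzero[OF f] pC(1) by blast
  ultimately show ?thesis using f by (auto simp: P_torsion_def Jid_def)
qed

section \<open>Spans modulo the relations\<close>

text \<open>The span modulo the relations. Building closure under congruence into the set allows
  rewriting and linear combination to alternate without tracking coefficients.\<close>

inductive_set spn :: "('w path \<Rightarrow> int poly) set \<Rightarrow> ('w path \<Rightarrow> int poly) set"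
  for F :: "('w path \<Rightarrow> int poly) set" where
  base: "x \<in> F \<Longrightarrow> x \<in> spn F"
| zero: "0 \<in> spn F"
| add: "x \<in> spn F \<Longrightarrow> y \<in> spn F \<Longrightarrow> x + y \<in> spn F"
| scal: "x \<in> spn F \<Longrightarrow> scal f x \<in> spn F"
| congr: "x \<in> spn F \<Longrightarrow> y \<in> C \<Longrightarrow> y \<approx> x \<Longrightarrow> y \<in> spn F"

lemma spn_C: "x \<in> spn F \<Longrightarrow> F \<subseteq> C \<Longrightarrow> x \<in> C"
  by (induction rule: spn.induct) auto

lemma spn_sub: "x \<in> spn F \<Longrightarrow> F \<subseteq> spn G \<Longrightarrow> x \<in> spn G"
  by (induction rule: spn.induct) (auto intro: spn.intros)

lemma spn_sum: "(\<And>i. i \<in> A \<Longrightarrow> f i \<in> spn F) \<Longrightarrow> (\<Sum>i\<in>A. f i) \<in> spn F"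
  by (induction A rule: infinite_finite_induct) (auto intro: spn.zero spn.add)

lemma spn_conv:
  assumes "x \<in> spn F" "y \<in> spn G" "F \<subseteq> C" "G \<subseteq> C"
    and fg: "\<And>f g. f \<in> F \<Longrightarrow> g \<in> G \<Longrightarrow> f \<bullet> g \<in> spn E"
  shows "x \<bullet> y \<in> spn E"
proof -
  have yC: "y \<in> C" using assms(2,4) by (rule spn_C)
  have "f \<bullet> y \<in> spn E" if f: "f \<in> F" for f
    using assms(2)
  proof induction
    case (congr x y)
    have fC: "f \<in> C" using f assms(3) by blast
    show ?case using congr.IH conv_closed[OF fC congr.hyps(2)] cg_left[OF congr.hyps(3) fC] by (rule spn.congr)
  qed (auto simp: conv_add_right conv_scal_right fg[OF f] intro: spn.zero spn.add spn.scal)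
  with assms(1) show ?thesis
  proof induction
    case (congr x x')
    have "x \<bullet> y \<in> spn E" using congr.IH congr.prems by blast
    then show ?case using conv_closed[OF congr.hyps(2) yC] cg_right[OF congr.hyps(3) yC] by (rule spn.congr)
  qed (auto simp: conv_add_left conv_scal_left intro: spn.zero spn.add spn.scal)
qed

lemma spn_subword_comb:
  assumes "\<And>ys. set ys \<subseteq> set ws \<Longrightarrow> f ys \<in> spn F"
  shows "subword_comb a f ws \<in> spn F"
  unfolding subword_comb_eq using assms strict_subseqD(1)[of _ ws]
  by (intro spn.add spn.scal spn_sum) auto

text \<open>Coefficients are recovered only here, for the argument by linear independence.\<close>

lemma spn_lin_ext:
  assumes "x \<in> spn (f ` B)" "f ` B \<subseteq> C"
  shows "\<exists>c \<in> free_module B. x \<approx> lin_ext f c"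
  using assms(1)
proof induction
  case (base x)
  then obtain b where "b \<in> B" "x = f b" by blast
  then show ?case by (intro bexI[of _ "basis_elt b"]) auto
next
  case zero
  show ?case using linear_on_zero[OF linear_lin_ext, of f] by (intro bexI[of _ 0]) auto
next
  case (add x y)
  then obtain c d where "c \<in> free_module B" "x \<approx> lin_ext f c" "d \<in> free_module B" "y \<approx> lin_ext f d" by blast
  then show ?case
    using linear_on_add[OF linear_lin_ext, of c B d f] cg_add by (intro bexI[of _ "c + d"]) auto
next
  case (scal x g)
  then obtain c where "c \<in> free_module B" "x \<approx> lin_ext f c" by blast
  then show ?case
    using linear_on_scal[OF linear_lin_ext, of c B f g] cg_scal by (intro bexI[of _ "scal g c"]) auto
next
  case (congr x y)
  then show ?case using cg_trans by blast
qed

section \<open>Loops at the empty vertex\<close>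

definition Chi :: "('w path \<Rightarrow> int poly) set" where
  "Chi = chi_word W S ` {ys. set ys \<subseteq> S}"

lemma Chi_C: "Chi \<subseteq> C"
  by (auto simp: Chi_def)

lemma chi_word_append:
  "set xs \<subseteq> S \<Longrightarrow> set ys \<subseteq> S \<Longrightarrow> chi_word W S (xs @ ys) = chi_word W S xs \<bullet> chi_word W S ys"
  by (induction xs) (simp_all add: chi_word_simps chi_word_e_path conv_assoc)

lemma spn_Chi_conv: "x \<in> spn Chi \<Longrightarrow> y \<in> spn Chi \<Longrightarrow> x \<bullet> y \<in> spn Chi"
proof (rule spn_conv[OF _ _ Chi_C Chi_C])
  fix f g assume "f \<in> Chi" "g \<in> Chi"
  then obtain xs ys where "set xs \<subseteq> S" "f = chi_word W S xs" "set ys \<subseteq> S" "g = chi_word W S ys"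
    by (auto simp: Chi_def)
  then show "f \<bullet> g \<in> spn Chi"
    using chi_word_append[of xs ys] by (intro spn.base) (auto simp: Chi_def intro!: image_eqI[of _ _ "xs @ ys"])
qed

text \<open>The braid relation speaks of one chain traversed both ways, so the second chain is first
  replaced by the first. For \<open>I = {}\<close> there is no braid relation, and the product is
  the empty word.\<close>

lemma ups_del_Chi:
  assumes "is_ordering W S I cs" "is_ordering W S I ds"
  shows "ups_chain cs \<bullet> del_chain ds \<in> spn Chi"
proof -
  note C = chain_closed[OF assms(1)] chain_closed[OF assms(2)]
  have e: "ups_chain cs \<bullet> del_chain ds \<approx> ups_chain cs \<bullet> del_chain cs"
    using chain_independent[OF assms(2,1)] C by (intro cg_left) auto
  have "ups_chain cs \<bullet> del_chain cs \<in> spn Chi"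
  proof (cases "I = {}")
    case True
    have "cs = [{}]" using assms(1) True by (cases rule: is_ordering_cases) (auto simp: covers_def)
    then have "ups_chain cs \<bullet> del_chain cs = chi_word W S []"
      using chain_e_path[OF assms(1)] by (simp add: chain_empty chi_word_simps)
    then show ?thesis by (intro spn.base) (auto simp: Chi_def intro!: image_eqI[of _ _ "[]"])
  next
    case False
    have "chi_ordering cs \<in> spn Chi"
      using rex_letters[OF assms(1)] by (intro spn_subword_comb spn.base) (auto simp: Chi_def)
    then show ?thesis by (rule spn.congr[OF _ _ extended_braid[OF assms(1) False]]) (use C in simp)
  qed
  then show ?thesis by (rule spn.congr[OF _ _ e]) (use C in simp)
qed

lemma path_Chi:
  assumes "is_path W S (as, I)" "is_ordering W S I cI" "is_ordering W S (ptgt (as, I)) cJ"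
  shows "\<exists>f \<in> P_polys. scal f (ups_chain cJ \<bullet> basis_elt (as, I) \<bullet> del_chain cI) \<in> spn Chi"
  using assms(1,3)
proof (induction as arbitrary: cJ)
  case Nil
  have "ups_chain cJ \<bullet> basis_elt ([], I) = ups_chain cJ"
    using chain_e_path(1)[of I cJ] Nil by (simp add: e_path_def)
  then show ?case using ups_del_Chi[of I cJ cI] Nil assms(2) by (intro bexI[of _ 1] P_polys_one) simp
next
  case (Cons b as)
  let ?K = "ptgt (as, I)" and ?J = "atgt b"
  have b: "b \<in> arrows W S" "asrc b = ?K" "is_path W S (as, I)" using Cons.prems(1) by auto
  have K: "?K \<in> finitary W S" using path_finitary(2)[OF b(3)] .
  have cJ: "is_ordering W S ?J cJ" using Cons.prems(2) by simp
  obtain cK where cK: "is_ordering W S ?K cK" using ex_ordering[OF K] by blast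
  obtain f where f: "f \<in> P_polys" "scal f (ups_chain cK \<bullet> basis_elt (as, I) \<bullet> del_chain cI) \<in> spn Chi"
    using Cons.IH[OF b(3) cK] by blast
  let ?b = "basis_elt ([b], ?K)"
  have bC: "?b \<in> C" "basis_elt (as, I) \<in> C" using b K by auto
  note C = chain_closed[OF cJ] chain_closed[OF cK] chain_closed[OF assms(2)]
  have eq: "basis_elt (b # as, I) = ?b \<bullet> basis_elt (as, I)" by (simp add: conv_basis)
  have eb: "e_path ?K \<bullet> basis_elt (as, I) = basis_elt (as, I)" by (simp add: e_path_conv_basis)
  \<comment> \<open>A single arrow is absorbed by a neighbouring chain: an arrow \<open>Ups\<close>
    prolongs the chain on its left, an arrow \<open>Del\<close> the chain on its right.\<close>
  have left: "ups_chain cJ \<bullet> ?b \<bullet> del_chain cK \<in> spn Chi"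
  proof (cases b)
    case (Ups L M)
    then have LM: "M = ?K" "L = ?J" "?J \<in> finitary W S" "covers ?J ?K" using b by (auto simp: arrows_def)
    have "?b = ups ?J ?K" using Ups LM by (simp add: ups_def)
    then have "ups_chain cJ \<bullet> ?b = ups_chain (cJ @ [?K])" using ups_chain_snoc[OF cJ] by simp
    then show ?thesis using ups_del_Chi[OF is_ordering_step[OF cJ K LM(4)] cK] by simp
  next
    case (Del L M)
    then have LM: "M = ?K" "L = ?J" "?J \<in> finitary W S" "covers ?K ?J" using b by (auto simp: arrows_def)
    have "?b = del ?J ?K" using Del LM by (simp add: del_def)
    then have "?b \<bullet> del_chain cK = del_chain (cK @ [?J])" using del_chain_snoc[OF cK] by simp
    then show ?thesis using ups_del_Chi[OF cJ is_ordering_step[OF cK LM(3,4)]] by (simp add: conv_assoc)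
  qed
  have prod: "(ups_chain cJ \<bullet> ?b \<bullet> del_chain cK) \<bullet> scal f (ups_chain cK \<bullet> basis_elt (as, I) \<bullet> del_chain cI) \<in> spn Chi"
    by (rule spn_Chi_conv[OF left f(2)])
  have "(ups_chain cJ \<bullet> ?b \<bullet> del_chain cK) \<bullet> scal f (ups_chain cK \<bullet> basis_elt (as, I) \<bullet> del_chain cI) =
      scal f (ups_chain cJ \<bullet> ?b \<bullet> ((del_chain cK \<bullet> ups_chain cK) \<bullet> (basis_elt (as, I) \<bullet> del_chain cI)))"
    by (simp add: conv_scal_right conv_assoc)
  also have "\<dots> \<approx> scal f (ups_chain cJ \<bullet> ?b \<bullet> (scal (\<pi> ?K) (e_path ?K) \<bullet> (basis_elt (as, I) \<bullet> del_chain cI)))"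
    using C bC by (intro cg_scal cg_left cg_right del_ups_chain[OF cK]) simp_all
  also have "\<dots> = scal (f * \<pi> ?K) (ups_chain cJ \<bullet> basis_elt (b # as, I) \<bullet> del_chain cI)"
    unfolding eq by (simp add: conv_scal_left conv_scal_right conv_assoc conv_assoc[symmetric, of "e_path ?K"] eb)
  finally have cg: "(ups_chain cJ \<bullet> ?b \<bullet> del_chain cK) \<bullet> scal f (ups_chain cK \<bullet> basis_elt (as, I) \<bullet> del_chain cI) \<approx>
      scal (f * \<pi> ?K) (ups_chain cJ \<bullet> basis_elt (b # as, I) \<bullet> del_chain cI)" .
  have "basis_elt (b # as, I) \<in> C" unfolding eq using bC by simp
  then have "scal (f * \<pi> ?K) (ups_chain cJ \<bullet> basis_elt (b # as, I) \<bullet> del_chain cI) \<in> C"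
    using C by simp
  then have "scal (f * \<pi> ?K) (ups_chain cJ \<bullet> basis_elt (b # as, I) \<bullet> del_chain cI) \<in> spn Chi"
    using cg_sym[OF cg] by (rule spn.congr[OF prod])
  then show ?case using f(1) poincare_P[OF K] P_polys_mult by blast
qed

text \<open>Each path brings its own polynomial. Finitely many of them have a common multiple in
  \<open>P_polys\<close>, namely their product.\<close>

lemma comb_Chi:
  assumes p: "p \<in> path_combs W S I J" and cI: "is_ordering W S I cI" and cJ: "is_ordering W S J cJ"
  shows "\<exists>f \<in> P_polys. scal f (ups_chain cJ \<bullet> p \<bullet> del_chain cI) \<in> spn Chi"
proof -
  let ?u = "\<lambda>x. ups_chain cJ \<bullet> x \<bullet> del_chain cI"
  have paths: "\<exists>f \<in> P_polys. scal f (?u (basis_elt r)) \<in> spn Chi" if "p r \<noteq> 0" for r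
  proof -
    have "is_path W S r" "psrc r = I" "ptgt r = J" using that p by (auto simp: path_combs_def free_module_def)
    then show ?thesis using path_Chi[of "fst r" I cI cJ] cI cJ by (cases r) auto
  qed
  have "\<exists>f \<in> P_polys. scal f (?u (\<Sum>r\<in>A. scal (p r) (basis_elt r))) \<in> spn Chi"
    if "finite A" "A \<subseteq> {r. p r \<noteq> 0}" for A
    using that
  proof (induction A)
    case empty
    show ?case using P_polys_one spn.zero by auto
  next
    case (insert r A)
    obtain f g where f: "f \<in> P_polys" "scal f (?u (\<Sum>r\<in>A. scal (p r) (basis_elt r))) \<in> spn Chi"
      and g: "g \<in> P_polys" "scal g (?u (basis_elt r)) \<in> spn Chi"
      using insert paths[of r] by auto
    have "scal (f * g) (?u (\<Sum>r\<in>insert r A. scal (p r) (basis_elt r))) =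
        scal (f * p r) (scal g (?u (basis_elt r))) + scal g (scal f (?u (\<Sum>r\<in>A. scal (p r) (basis_elt r))))"
      using insert(1,2)
      by (simp add: conv_add_left conv_add_right conv_scal_left conv_scal_right scal_add mult.commute mult.left_commute)
    also have "\<dots> \<in> spn Chi" by (rule spn.add[OF spn.scal[OF g(2)] spn.scal[OF f(2)]])
    finally show ?case using P_polys_mult[OF f(1) g(1)] by blast
  qed
  from this[of "{r. p r \<noteq> 0}"] show ?thesis
    using p fm_expand[OF p[unfolded path_combs_def]] by (auto simp: path_combs_def free_module_def)
qed

section \<open>Standard basis elements in the quotient\<close>

definition tau :: "'w \<Rightarrow> 'w path \<Rightarrow> int poly" where
  "tau s = chi s - e_path {}"

definition tau_word :: "'w list \<Rightarrow> 'w path \<Rightarrow> int poly" where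
  "tau_word ys = foldr (\<lambda>s x. tau s \<bullet> x) ys (e_path {})"

lemma tau_word_simps [simp]:
  "tau_word [] = e_path {}" "tau_word (s # ys) = tau s \<bullet> tau_word ys"
  by (simp_all add: tau_word_def)

lemma tau_closed [simp]: "s \<in> S \<Longrightarrow> tau s \<in> C"
  by (simp add: tau_def)

lemma tau_word_closed [simp]: "set ys \<subseteq> S \<Longrightarrow> tau_word ys \<in> C"
  by (induction ys) auto

lemma e_path_idem: "e_path {} \<bullet> e_path {} = (e_path {} :: 'w path \<Rightarrow> int poly)"
  by (simp add: e_path_def conv_basis)

lemma chi_e_path: "e_path {} \<bullet> chi s = chi s" "chi s \<bullet> e_path {} = chi s"
  by (simp_all add: chi_def e_path_conv_basis conv_basis_e_path)

lemma tau_word_e_path: "e_path {} \<bullet> tau_word ys = tau_word ys"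
proof (cases ys)
  case (Cons s zs)
  have "e_path {} \<bullet> tau s = tau s" by (simp add: tau_def conv_diff_right chi_e_path e_path_idem)
  then show ?thesis by (simp add: Cons conv_assoc[symmetric])
qed (simp add: e_path_idem)

lemma tau_word_append: "tau_word (xs @ ys) = tau_word xs \<bullet> tau_word ys"
  by (induction xs) (simp_all add: tau_word_e_path conv_assoc)

lemma chi_square:
  assumes "s \<in> S"
  shows "chi s \<bullet> chi s \<approx> scal (1 + qvar) (chi s)"
proof -
  have s: "{} \<in> finitary W S" "{s} \<in> finitary W S" "covers {} {s}"
    using singleton_longest(1)[OF assms] covers_gen by auto
  note C = ups_closed[OF s] del_closed[OF s]
  have e: "e_path {s} \<bullet> del {s} {} = del {s} {}" by (simp add: del_def e_path_conv_basis)
  have "chi s \<bullet> chi s = ups {} {s} \<bullet> ((del {s} {} \<bullet> ups {} {s}) \<bullet> del {s} {})"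
    by (simp add: chi_eq conv_assoc)
  also have "\<dots> \<approx> ups {} {s} \<bullet> (scal (\<pi> {s} div \<pi> {}) (e_path {s}) \<bullet> del {s} {})"
    by (rule cg_left[OF cg_right[OF quasi_idempotent[OF s] C(2)] C(1)])
  also have "\<dots> = scal (1 + qvar) (chi s)"
    using assms by (simp add: conv_scal_left conv_scal_right e chi_eq poincare_gen)
  finally show ?thesis .
qed

text \<open>With \<open>chi s\<close> squaring to \<open>1 + q\<close> times itself,
  \<open>(chi s - 1)^2 = (q - 1) (chi s - 1) + q\<close>. The trailing word absorbs the idempotent
  \<open>e_path {}\<close>, which plays the part of \<open>1\<close>.\<close>

lemma tau_quadratic:
  assumes "s \<in> S" "set ys \<subseteq> S"
  shows "tau s \<bullet> (tau s \<bullet> tau_word ys) \<approx> scal (qvar - 1) (tau s \<bullet> tau_word ys) + scal qvar (tau_word ys)"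
proof -
  have "tau s \<bullet> (tau s \<bullet> tau_word ys) =
      (chi s \<bullet> chi s) \<bullet> tau_word ys - scal 2 (chi s \<bullet> tau_word ys) + tau_word ys"
    by (simp add: tau_def conv_diff_left conv_diff_right tau_word_e_path conv_assoc
        conv_assoc[symmetric, of "e_path {}"] chi_e_path fun_eq_iff scal_apply plus_fun_apply)
  also have "\<dots> \<approx> scal (1 + qvar) (chi s) \<bullet> tau_word ys - scal 2 (chi s \<bullet> tau_word ys) + tau_word ys"
    using cg_right[OF chi_square[OF assms(1)], of "tau_word ys"] assms(2)
    by (intro cg_add cg_diff cg_refl) simp
  also have "\<dots> = scal (qvar - 1) (tau s \<bullet> tau_word ys) + scal qvar (tau_word ys)"
    by (simp add: tau_def conv_diff_left tau_word_e_path conv_scal_left fun_eq_iff scal_apply plus_fun_apply algebra_simps)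
  finally show ?thesis .
qed

text \<open>So \<open>T \<one>\<close> is an admissible test vector for kernel elements at the
  vertex \<open>{}\<close>.\<close>

lemma one_x_ideal: "T \<one> \<in> x_ideal W S {}"
  by (auto simp: x_ideal_def x_elt_empty one_hm intro!: exI[of _ "T \<one>"])

text \<open>\<open>chi s\<close> acts as \<open>x_elt W {s} = T \<one> + T s\<close>, so
  \<open>tau s\<close> acts as \<open>T s\<close>, which is \<open>lmul s\<close>.\<close>

lemma entry_tau_word: "set ys \<subseteq> S \<Longrightarrow> entry {} {} (T \<one>) (tau_word ys) = foldr lmul ys (T \<one>)"
proof (induction ys)
  case Nil
  then show ?case by (simp add: e_path_def)
next
  case (Cons s ys)
  then have s: "s \<in> S" "set ys \<subseteq> S" by auto
  let ?h = "entry {} {} (T \<one>) (tau_word ys)"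
  have h: "?h \<in> H" using s by (intro entry_closed) auto
  have "tau_word (s # ys) = chi s \<bullet> tau_word ys - tau_word ys"
    by (simp add: tau_def conv_diff_left tau_word_e_path)
  then have "entry {} {} (T \<one>) (tau_word (s # ys)) = x_elt W {s} \<star> ?h - ?h"
    using s linear_on_diff[OF linear_entry, of "chi s \<bullet> tau_word ys" "{p. is_path W S p}" "tau_word ys"]
    by (simp add: entry_chi_conv)
  also have "\<dots> = T s \<star> ?h"
    using linear_on_add[OF linear_hm_left, of "T \<one>" "carrier W" "T s" ?h] s h
    by (simp add: x_elt_gen one_hm S_carrier)
  finally show ?case using Cons.IH s lmul_hm[OF s(1) h] by simp
qed

lemma entry_tau_reduced: "reduced_expr W S w ws \<Longrightarrow> entry {} {} (T \<one>) (tau_word ws) = T w"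
  using entry_tau_word[of ws] foldr_lmul_reduced by (simp add: reduced_expr_def)

abbreviation tau_red :: "'w \<Rightarrow> 'w path \<Rightarrow> int poly" where
  "tau_red w \<equiv> tau_word (red w)"

lemma red_letters: "w \<in> carrier W \<Longrightarrow> set (red w) \<subseteq> S"
  using reduced_exprD(1)[OF reduced_red] .

lemma tau_red_C: "B \<subseteq> carrier W \<Longrightarrow> tau_red ` B \<subseteq> C"
  using red_letters by auto

text \<open>\<open>tau_red w\<close> sends \<open>T \<one>\<close> to \<open>T w\<close>, so
  evaluation at \<open>T \<one>\<close> reads off the coefficient function.\<close>

lemma entry_lin_ext_tau_red:
  assumes "c \<in> H"
  shows "lin_ext tau_red c \<in> C" "entry {} {} (T \<one>) (lin_ext tau_red c) = c"
proof -
  have supp: "\<And>w. c w \<noteq> 0 \<Longrightarrow> w \<in> carrier W" using assms by (auto simp: free_module_def)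
  show C: "lin_ext tau_red c \<in> C" using assms red_letters by (intro lin_ext_closed) auto
  have "entry {} {} (T \<one>) (lin_ext tau_red c) = lin_ext T c"
    unfolding lin_ext_def using supp red_letters entry_tau_reduced[OF reduced_red]
    by (subst linear_on_sum[OF linear_entry, where B = "{p. is_path W S p}"])
      (auto intro!: sum.cong simp: linear_on_scal[OF linear_entry, where B = "{p. is_path W S p}"])
  then show "entry {} {} (T \<one>) (lin_ext tau_red c) = c" using fm_expand[OF assms] by (simp add: lin_ext_def)
qed

text \<open>The \<open>T\<^sub>w\<close> being linearly independent, a combination of the \<open>tau_red w\<close> is detected by the Hecke algebra.\<close>
lemma tau_red_independent:
  assumes "x \<in> spn (tau_red ` B)" "B \<subseteq> carrier W" "entry {} {} (T \<one>) x = 0"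
  shows "x \<approx> 0"
proof -
  obtain c where c: "c \<in> free_module B" "x \<approx> lin_ext tau_red c"
    using spn_lin_ext[OF assms(1) tau_red_C[OF assms(2)]] by blast
  have cH: "c \<in> H" using fm_mono[OF c(1) assms(2)] .
  have "x \<in> C" using spn_C[OF assms(1) tau_red_C[OF assms(2)]] .
  then have "entry {} {} (T \<one>) x = entry {} {} (T \<one>) (lin_ext tau_red c)"
    using entry_cong[OF c(2)] entry_lin_ext_tau_red(1)[OF cH] one_x_ideal by simp
  then have "c = 0" using assms(3) entry_lin_ext_tau_red(2)[OF cH] by simp
  then show ?thesis using c(2) linear_on_zero[OF linear_lin_ext, of tau_red] by simp
qed

text \<open>Independence of the reduced expression is split by length, because the braid relation at
  one length holds only modulo shorter words, which the lower levels must first bring to normal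
  form.\<close>

definition matsumoto :: "nat \<Rightarrow> bool" where
  "matsumoto k \<longleftrightarrow> (\<forall>w us vs. \<ell> w = k \<longrightarrow> reduced_expr W S w us \<longrightarrow> reduced_expr W S w vs \<longrightarrow>
     tau_word us \<approx> tau_word vs)"

lemma matsumotoD:
  "matsumoto k \<Longrightarrow> \<ell> w = k \<Longrightarrow> reduced_expr W S w us \<Longrightarrow> reduced_expr W S w vs \<Longrightarrow> tau_word us \<approx> tau_word vs"
  by (simp add: matsumoto_def)

definition ball :: "nat \<Rightarrow> 'w set" where
  "ball n = {w \<in> carrier W. \<ell> w \<le> n}"

lemma ball_carrier: "ball n \<subseteq> carrier W"
  by (auto simp: ball_def)

text \<open>The multiplication rule of the Hecke algebra, modulo the relations. Prepending
  \<open>s\<close> yields some reduced word and not the chosen one, so levels up to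
  \<open>Suc n\<close> are invoked to pass to \<open>red\<close>.\<close>

lemma tau_mult_red:
  assumes m: "\<And>j. j \<le> Suc n \<Longrightarrow> matsumoto j" and s: "s \<in> S" and w: "w \<in> ball n"
  shows "tau s \<bullet> tau_red w \<in> spn (tau_red ` ball (Suc n))"
proof -
  have wc: "w \<in> carrier W" "\<ell> w \<le> n" using w by (auto simp: ball_def)
  have swc: "s \<otimes> w \<in> carrier W" using wc s S_carrier by simp
  have sC: "tau s \<in> C" "tau_red w \<in> C" "tau_red (s \<otimes> w) \<in> C"
    using s red_letters wc swc by simp_all
  note rw = reduced_red[OF wc(1)] and rsw = reduced_red[OF swc]
  consider (up) "\<ell> (s \<otimes> w) = Suc (\<ell> w)" | (down) "\<ell> w = Suc (\<ell> (s \<otimes> w))"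
    using len_gen_mult_cases(1)[OF s wc(1)] by blast
  then show ?thesis
  proof cases
    case up
    have "reduced_expr W S (s \<otimes> w) (s # red w)" using rw up s by (auto simp: reduced_expr_def)
    then have "tau_word (s # red w) \<approx> tau_red (s \<otimes> w)"
      using m[of "\<ell> (s \<otimes> w)"] up wc(2) rsw matsumotoD[of _ "s \<otimes> w" "s # red w" "red (s \<otimes> w)"] by auto
    moreover have "tau_red (s \<otimes> w) \<in> spn (tau_red ` ball (Suc n))"
      using up wc swc by (intro spn.base imageI) (auto simp: ball_def)
    ultimately show ?thesis using sC by (auto intro: spn.congr)
  next
    case down
    let ?u = "s \<otimes> w"
    have "reduced_expr W S w (s # red ?u)"
      using rsw down s wc by (auto simp: reduced_expr_def gen_cancel)
    then have e: "tau_red w \<approx> tau s \<bullet> tau_red ?u"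
      using m[of "\<ell> w"] wc(2) rw matsumotoD[of "\<ell> w" w "red w" "s # red ?u"] by simp
    have "tau s \<bullet> tau_red w \<approx> tau s \<bullet> (tau s \<bullet> tau_red ?u)" using cg_left[OF e sC(1)] .
    also have "\<dots> \<approx> scal (qvar - 1) (tau s \<bullet> tau_red ?u) + scal qvar (tau_red ?u)"
      using tau_quadratic[OF s red_letters[OF swc]] .
    also have "\<dots> \<approx> scal (qvar - 1) (tau_red w) + scal qvar (tau_red ?u)"
      by (rule cg_add[OF cg_scal[OF cg_sym[OF e]] cg_refl])
    finally have c: "tau s \<bullet> tau_red w \<approx> scal (qvar - 1) (tau_red w) + scal qvar (tau_red ?u)" .
    have "tau_red w \<in> spn (tau_red ` ball (Suc n))" "tau_red ?u \<in> spn (tau_red ` ball (Suc n))"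
      using down wc swc by (auto simp: ball_def intro!: spn.base imageI)
    from spn.add[OF spn.scal[OF this(1)] spn.scal[OF this(2)]]
    show ?thesis by (rule spn.congr[OF _ _ c]) (use sC in simp)
  qed
qed

lemma tau_word_span:
  assumes "\<And>j. j \<le> n \<Longrightarrow> matsumoto j" "set zs \<subseteq> S" "length zs \<le> n"
  shows "tau_word zs \<in> spn (tau_red ` ball (length zs))"
  using assms(2,3)
proof (induction zs)
  case Nil
  have "red \<one> = []" using reduced_red[of \<one>] by (simp add: reduced_expr_def)
  then have "e_path {} = tau_red \<one>" by simp
  then show ?case by (auto simp: ball_def intro!: spn.base image_eqI[of _ _ \<one>])
next
  case (Cons s zs)
  have s: "s \<in> S" using Cons.prems by simp
  have IH: "tau_word zs \<in> spn (tau_red ` ball (length zs))" using Cons by simp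
  have "tau s \<bullet> tau_word zs \<in> spn (tau_red ` ball (Suc (length zs)))"
  proof (rule spn_conv[OF spn.base[of "tau s" "{tau s}"] IH])
    show "tau_red ` ball (length zs) \<subseteq> C" by (rule tau_red_C[OF ball_carrier])
    fix f g assume "f \<in> {tau s}" "g \<in> tau_red ` ball (length zs)"
    then show "f \<bullet> g \<in> spn (tau_red ` ball (Suc (length zs)))"
      using tau_mult_red[of "length zs" s] assms(1) Cons.prems s by auto
  qed (use s in auto)
  then show ?case by simp
qed

definition short :: "nat \<Rightarrow> ('w path \<Rightarrow> int poly) set" where
  "short n = tau_word ` {zs. set zs \<subseteq> S \<and> length zs < n}"

lemma short_C: "short n \<subseteq> C"
  by (auto simp: short_def)

lemma spn_diff:
  assumes "x \<in> spn F" "y \<in> spn F"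
  shows "x - y \<in> spn F"
proof -
  have "x - y = x + scal (- 1) y" by (auto simp: fun_eq_iff scal_apply plus_fun_apply)
  then show ?thesis using spn.add[OF assms(1) spn.scal[OF assms(2)], of "- 1"] by metis
qed

lemma short_mono: "m \<le> n \<Longrightarrow> x \<in> spn (short m) \<Longrightarrow> x \<in> spn (short n)"
  by (rule spn_sub) (auto simp: short_def intro!: spn.base)

lemma tau_short: "set zs \<subseteq> S \<Longrightarrow> length zs < n \<Longrightarrow> tau_word zs \<in> spn (short n)"
  by (auto simp: short_def intro!: spn.base)

text \<open>Expanding every \<open>chi s\<close> as \<open>tau s + e_path {}\<close>, all terms but
  the leading one have lost a letter.\<close>

lemma chi_minus_tau: "set ys \<subseteq> S \<Longrightarrow> chi_word W S ys - tau_word ys \<in> spn (short (length ys))"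
proof (induction ys)
  case Nil
  show ?case using spn.zero by (simp add: chi_word_simps)
next
  case (Cons s ys)
  then have s: "s \<in> S" "set ys \<subseteq> S" by auto
  let ?d = "chi_word W S ys - tau_word ys" and ?n = "length ys"
  have IH: "?d \<in> spn (short ?n)" by (rule Cons.IH[OF s(2)])
  have "tau s \<bullet> ?d \<in> spn (short (Suc ?n))"
  proof (rule spn_conv[OF spn.base[of "tau s" "{tau s}"] IH _ short_C])
    fix f g assume "f \<in> {tau s}" "g \<in> short ?n"
    then obtain zs where zs: "f = tau s" "g = tau_word zs" "set zs \<subseteq> S" "length zs < ?n"
      by (auto simp: short_def)
    then show "f \<bullet> g \<in> spn (short (Suc ?n))"
      using tau_short[of "s # zs" "Suc ?n"] s by simp
  qed (use s in auto)
  moreover have "chi_word W S ys \<in> spn (short (Suc ?n))"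
    using spn.add[OF short_mono[OF _ IH, of "Suc ?n"] tau_short[of ys "Suc ?n"]] s by simp
  moreover have "chi_word W S (s # ys) - tau_word (s # ys) = tau s \<bullet> ?d + chi_word W S ys"
  proof -
    have "chi_word W S (s # ys) = (tau s + e_path {}) \<bullet> chi_word W S ys"
      using Cons.prems by (simp add: chi_word_simps tau_def)
    also have "\<dots> = tau s \<bullet> chi_word W S ys + chi_word W S ys"
      using chi_word_e_path(1)[OF s(2)] by (simp add: conv_add_left)
    finally show ?thesis by (simp add: conv_diff_right)
  qed
  ultimately show ?case using spn.add by simp
qed

lemma chi_ordering_minus_tau:
  assumes "is_ordering W S I cs"
  shows "chi_ordering cs - tau_word (rex cs) \<in> spn (short (length (rex cs)))"
proof -
  let ?w = "rex cs" and ?X = "\<Sum>ys | strict_subseq ys (rex cs). scal (a ys (rex cs)) (chi_word W S ys)"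
  have L: "set ?w \<subseteq> S" using rex_letters[OF assms] .
  have sh: "chi_word W S ys \<in> spn (short (length ?w))" if ys: "strict_subseq ys ?w" for ys
  proof -
    have y: "set ys \<subseteq> S" "length ys < length ?w" using strict_subseqD[OF ys] L by auto
    then have "chi_word W S ys - tau_word ys \<in> spn (short (length ?w))"
      using short_mono[OF _ chi_minus_tau[OF y(1)], of "length ?w"] by simp
    from spn.add[OF this tau_short[OF y]] show ?thesis by simp
  qed
  have "?X \<in> spn (short (length ?w))"
  proof (rule spn_sum)
    fix ys assume "ys \<in> {ys. strict_subseq ys ?w}"
    then show "scal (a ys ?w) (chi_word W S ys) \<in> spn (short (length ?w))" using spn.scal[OF sh] by simp
  qed
  from spn.add[OF chi_minus_tau[OF L] spn.scal[OF this]]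
  have "chi_word W S ?w - tau_word ?w + scal qvar ?X \<in> spn (short (length ?w))" .
  then show ?thesis unfolding subword_comb_eq by (simp add: algebra_simps)
qed

text \<open>
  Both words are leading terms of the same element modulo the relations. Their difference is a
  combination of shorter words, which by induction reduce to the \<open>tau_red w\<close>, and it vanishes in the
  Hecke algebra.
\<close>
lemma tau_rex_independent:
  assumes cs: "is_ordering W S I cs" and ds: "is_ordering W S I ds" and I: "I \<noteq> {}"
    and m: "\<And>j. j < \<ell> (longest W S I) \<Longrightarrow> matsumoto j"
  shows "tau_word (rex cs) \<approx> tau_word (rex ds)"
proof -
  let ?k = "\<ell> (longest W S I)" and ?d = "tau_word (rex cs) - tau_word (rex ds)"
  note rc = rex_reduced[OF cs] and rd = rex_reduced[OF ds]
  have len: "length (rex cs) = ?k" "length (rex ds) = ?k" using rc rd by (auto simp: reduced_expr_def)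
  have C: "chi_ordering cs \<in> C" "chi_ordering ds \<in> C" "tau_word (rex cs) \<in> C" "tau_word (rex ds) \<in> C"
    using chi_ordering_closed[OF cs] chi_ordering_closed[OF ds] rex_letters[OF cs] rex_letters[OF ds] by simp_all
  have "chi_ordering cs \<approx> ups_chain cs \<bullet> del_chain cs" using extended_braid[OF cs I] cg_sym by blast
  also have "\<dots> \<approx> ups_chain ds \<bullet> del_chain cs"
    using chain_independent[OF cs ds] chain_closed[OF cs] cg_right by blast
  also have "\<dots> \<approx> ups_chain ds \<bullet> del_chain ds"
    using chain_independent[OF cs ds] chain_closed[OF ds] cg_left by blast
  also have "\<dots> \<approx> chi_ordering ds" by (rule extended_braid[OF ds I])
  finally have e: "chi_ordering cs \<approx> chi_ordering ds" .
  \<comment> \<open>As \<open>chi_ordering cs\<close> and \<open>chi_ordering ds\<close> are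
    congruent, the difference of the leading words is congruent to this difference of the lower
    parts.\<close>
  let ?x = "chi_ordering ds - tau_word (rex ds) - (chi_ordering cs - tau_word (rex cs))"
  have "?d \<approx> ?x"
    using e cg_sym[OF e] by (simp add: cg_def algebra_simps)
  moreover have "?x \<in> spn (short ?k)"
    using spn_diff[OF chi_ordering_minus_tau[OF ds] chi_ordering_minus_tau[OF cs, unfolded len, folded len(2)]] len by simp
  ultimately have "?d \<in> spn (short ?k)" using C spn.congr[of ?x "short ?k" ?d] by simp
  then have sp: "?d \<in> spn (tau_red ` carrier W)"
  proof (rule spn_sub)
    show "short ?k \<subseteq> spn (tau_red ` carrier W)"
    proof
      fix x assume "x \<in> short ?k"
      then obtain zs where zs: "x = tau_word zs" "set zs \<subseteq> S" "length zs < ?k" by (auto simp: short_def)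
      have "tau_word zs \<in> spn (tau_red ` ball (length zs))"
        using m zs by (intro tau_word_span[of "length zs"]) auto
      then show "x \<in> spn (tau_red ` carrier W)"
        unfolding zs(1) by (rule spn_sub) (use ball_carrier in \<open>auto intro!: spn.base\<close>)
    qed
  qed
  have "entry {} {} (T \<one>) ?d = 0"
    using linear_on_diff[OF linear_entry C(3,4)] entry_tau_reduced[OF rc] entry_tau_reduced[OF rd] by simp
  from tau_red_independent[OF sp subset_refl this] show ?thesis by (simp add: cg_def)
qed

lemma doubleton_orderings:
  assumes "{s, t} \<in> finitary W S" "s \<noteq> t"
  shows "is_ordering W S {s, t} [{}, {s}, {s, t}]"
proof -
  have "{s} \<in> finitary W S" using finitary_subset[OF assms(1)] by blast
  moreover have "covers {s} {s, t}" using assms(2) by (auto simp: covers_def)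
  ultimately show ?thesis using assms(1) covers_gen by (simp add: is_ordering_def)
qed

lemma reduced_snoc:
  assumes "reduced_expr W S w (us @ [s])"
  shows "reduced_expr W S (w \<otimes> s) us" "s \<in> S" "\<ell> w = Suc (\<ell> (w \<otimes> s))" "length us = \<ell> (w \<otimes> s)"
proof -
  have r: "reduced_expr W S (wp us) us" using reduced_append(1)[OF assms] .
  have S: "set us \<subseteq> S" "s \<in> S" using assms by (auto simp: reduced_expr_def)
  have "w = wp us \<otimes> s" using assms S by (auto simp: reduced_expr_def wp_append S_carrier)
  then have "w \<otimes> s = wp us" using S by (simp add: gen_cancel_right)
  then show "reduced_expr W S (w \<otimes> s) us" "s \<in> S" "\<ell> w = Suc (\<ell> (w \<otimes> s))" "length us = \<ell> (w \<otimes> s)"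
    using r S assms by (auto simp: reduced_expr_def)
qed

text \<open>
  If reduced words of \<open>w\<close> end in \<open>s\<close> and in \<open>t\<close>, then \<open>w = z d\<close> with \<open>d\<close> the longest element of
  \<open>\<langle>s, t\<rangle>\<close> and additive lengths, and \<open>d\<close> has the reduced words of the two orderings of \<open>{s, t}\<close>.
\<close>
lemma matsumoto_step:
  assumes m: "\<And>j. j < k \<Longrightarrow> matsumoto j"
  shows "matsumoto k"
  unfolding matsumoto_def
proof (intro allI impI)
  fix w us vs
  assume k: "\<ell> w = k" and us: "reduced_expr W S w us" and vs: "reduced_expr W S w vs"
  have wc: "w \<in> carrier W" using reduced_exprD(4)[OF us] .
  have len: "length us = k" "length vs = k" using us vs k by (auto simp: reduced_expr_def)
  show "tau_word us \<approx> tau_word vs"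
  proof (cases "k = 0")
    case True
    then show ?thesis using len by simp
  next
    case False
    then obtain u s v t where uv: "us = u @ [s]" "vs = v @ [t]"
      using len by (metis length_0_conv rev_exhaust)
    note ru = reduced_snoc[OF us[unfolded uv]] and rv = reduced_snoc[OF vs[unfolded uv]]
    \<comment> \<open>Words of \<open>w\<close> with the same last letter are compared after that
      letter is removed, one level down.\<close>
    have last: "tau_word (x @ [r]) \<approx> tau_word (y @ [r])"
      if "reduced_expr W S (w \<otimes> r) x" "reduced_expr W S (w \<otimes> r) y" "r \<in> S" "\<ell> w = Suc (\<ell> (w \<otimes> r))" for x y r
    proof -
      have "tau_word x \<approx> tau_word y" using matsumotoD[OF m[of "\<ell> (w \<otimes> r)"] _ that(1,2)] that(4) k by simp
      then show ?thesis unfolding tau_word_append by (rule cg_right) (use that(3) in simp)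
    qed
    show ?thesis
    proof (cases "s = t")
      case True
      then show ?thesis using last[of s u v] ru rv uv by simp
    next
      case False
      let ?I = "{s, t}"
      have I: "?I \<subseteq> S" using ru rv by simp
      obtain z d where zd: "coset_min ?I z" "d \<in> generate W ?I" "w = z \<otimes> d"
        using coset_decomp[OF I wc] by blast
      have c: "z \<in> carrier W" "d \<in> carrier W" using zd generate_closed[OF I] by (auto simp: coset_min_def)
      have add: "\<ell> (z \<otimes> x) = \<ell> z + \<ell> x" if "x \<in> generate W ?I" for x
        using coset_min_additive[OF I zd(1) that] .
      \<comment> \<open>Since lengths add over \<open>z\<close>, the descents \<open>s\<close> and
        \<open>t\<close> of \<open>w\<close> are descents of \<open>d\<close>.\<close>
      have desc: "\<ell> (d \<otimes> r) < \<ell> d" if r: "r \<in> ?I" for r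
      proof -
        have "\<ell> (w \<otimes> r) < \<ell> w" using r ru(3) rv(3) by auto
        moreover have "w \<otimes> r = z \<otimes> (d \<otimes> r)" using zd(3) c r I S_carrier by (auto simp: m_assoc)
        moreover have "d \<otimes> r \<in> generate W ?I" using generate_mult[OF I zd(2) generate_gen[OF r]] .
        ultimately show ?thesis using add[of "d \<otimes> r"] add[OF zd(2)] zd(3) by simp
      qed
      have fin: "?I \<in> finitary W S" and longest: "longest W S ?I = d"
        using descents_longest[OF I zd(2) desc] by blast+
      have fin': "{t, s} \<in> finitary W S" using fin by (simp add: insert_commute)
      let ?cs = "[{}, {s}, {s, t}]" and ?ds = "[{}, {t}, {s, t}]"
      have cs: "is_ordering W S ?I ?cs" using doubleton_orderings[OF fin False] .
      have ds: "is_ordering W S ?I ?ds"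
        using doubleton_orderings[OF fin' False[symmetric]] by (simp add: insert_commute)
      obtain x where x: "rex ?cs = x @ [s]" using adapted_suffix[OF rex[OF fin cs], of s] ru by auto
      obtain y where y: "rex ?ds = y @ [t]" using adapted_suffix[OF rex[OF fin ds], of t] rv by auto
      have red_z: "reduced_expr W S w (red z @ rex os)" if "is_ordering W S ?I os" for os
        using reduced_additive[OF reduced_red[OF c(1)] rex_reduced[OF that, unfolded longest] add[OF zd(2)]] zd(3)
        by simp
      \<comment> \<open>\<open>d\<close> may have length \<open>k\<close> itself, when
        \<open>z\<close> is trivial. This is harmless because \<open>tau_rex_independent\<close>
        asks only for levels strictly below the length of \<open>d\<close>.\<close>
      have "\<ell> d \<le> k" using add[OF zd(2)] zd(3) k by simp
      then have mid: "tau_word (rex ?cs) \<approx> tau_word (rex ?ds)"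
        using m longest by (intro tau_rex_independent[OF cs ds]) auto
      \<comment> \<open>\<open>rex ?cs\<close> ends in \<open>s\<close> like \<open>us\<close>, and
        \<open>rex ?ds\<close> ends in \<open>t\<close> like \<open>vs\<close>, so
        \<open>last\<close> applies at both ends and the braid relation bridges the middle.\<close>
      have "reduced_expr W S (w \<otimes> s) (red z @ x)"
        using reduced_snoc(1)[of w "red z @ x" s] red_z[OF cs] x by simp
      then have "tau_word us \<approx> tau_word (red z @ rex ?cs)"
        using last[of s u "red z @ x"] ru x uv by simp
      also have "\<dots> \<approx> tau_word (red z @ rex ?ds)"
        unfolding tau_word_append using red_letters[OF c(1)] by (intro cg_left[OF mid]) simp
      also have "\<dots> \<approx> tau_word vs"
      proof -
        have "reduced_expr W S (w \<otimes> t) (red z @ y)"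
          using reduced_snoc(1)[of w "red z @ y" t] red_z[OF ds] y by simp
        then show ?thesis using last[of t "red z @ y" v] rv y uv by simp
      qed
      finally show ?thesis .
    qed
  qed
qed

lemma matsumoto_all: "matsumoto k"
  by (induction k rule: less_induct) (rule matsumoto_step)

lemma Chi_span: "Chi \<subseteq> spn (tau_red ` carrier W)"
proof
  fix x assume "x \<in> Chi"
  then obtain ys where ys: "set ys \<subseteq> S" "x = chi_word W S ys" by (auto simp: Chi_def)
  have "tau_word zs \<in> spn (tau_red ` carrier W)" if "set zs \<subseteq> S" for zs
    by (rule spn_sub[OF tau_word_span[OF matsumoto_all that order_refl]])
      (use ball_carrier in \<open>auto intro!: spn.base\<close>)
  then have tau: "\<And>zs. set zs \<subseteq> S \<Longrightarrow> tau_word zs \<in> spn (tau_red ` carrier W)" .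
  have "short (length ys) \<subseteq> spn (tau_red ` carrier W)" using tau by (auto simp: short_def)
  from spn.add[OF spn_sub[OF chi_minus_tau[OF ys(1)] this] tau[OF ys(1)]]
  show "x \<in> spn (tau_red ` carrier W)" using ys(2) by simp
qed

section \<open>Generators of the kernel\<close>

lemma K_comb_torsion:
  assumes p: "p \<in> path_combs W S I J" and IJ: "I \<in> finitary W S" "J \<in> finitary W S" and K: "p \<in> K_ideal W S"
  shows "P_torsion W S rex a p"
proof -
  obtain cI cJ where o: "is_ordering W S I cI" "is_ordering W S J cJ"
    using ex_ordering IJ by blast
  obtain f where f: "f \<in> P_polys" "scal f (ups_chain cJ \<bullet> p \<bullet> del_chain cI) \<in> spn Chi"
    using comb_Chi[OF p o] by blast
  let ?x = "scal f (ups_chain cJ \<bullet> p \<bullet> del_chain cI)"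
  have "?x \<in> K_ideal W S"
    using K chain_closed[OF o(1)] chain_closed[OF o(2)] ideal_closed(3,4,5)[OF ideal_K] by blast
  then have "entry {} {} (T \<one>) ?x = 0" using one_x_ideal by (simp add: K_ideal_iff)
  from tau_red_independent[OF spn_sub[OF f(2) Chi_span] subset_refl this]
  have "?x \<in> Jid" by (simp add: cg_zero)
  then show ?thesis by (rule P_torsionI[OF p o f(1)])
qed

text \<open>The trivial paths sum to the identity, so a kernel element is the sum of its components
  \<open>e_path J \<bullet> (z \<bullet> e_path I)\<close>. Each component is again in the kernel
  and combines paths with fixed ends, hence it is torsion.\<close>

lemma K_ideal_generated:
  "K_ideal W S = Idl\<^bsub>R\<^esub> (J_rels W S rex a \<union>
     (\<Union>I \<in> finitary W S. \<Union>J \<in> finitary W S. {p \<in> path_combs W S I J. P_torsion W S rex a p}))"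
    (is "_ = Idl\<^bsub>R\<^esub> ?G")
proof (intro equalityI subsetI)
  have G: "?G \<subseteq> K_ideal W S" using J_rels_K by (auto simp: P_torsion_def)
  then have GC: "?G \<subseteq> carrier R" unfolding R_simps using K_C by (rule subset_trans)
  note ideal_G = ring.genideal_ideal[OF ring_R GC]
  show "x \<in> K_ideal W S" if "x \<in> Idl\<^bsub>R\<^esub> ?G" for x
    using ring.genideal_minimal[OF ring_R ideal_K G] that by blast
  fix z assume z: "z \<in> K_ideal W S"
  have zC: "z \<in> C" using z K_C by blast
  have comb: "e_path J \<bullet> (z \<bullet> e_path I) \<in> path_combs W S I J" for I J
    using zC by (auto simp: path_combs_def free_module_def e_path_conv conv_e_path elim: finite_subset[rotated])
  have "e_path J \<bullet> (z \<bullet> e_path I) \<in> Idl\<^bsub>R\<^esub> ?G" if "I \<in> finitary W S" "J \<in> finitary W S" for I J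
  proof -
    have "e_path J \<bullet> (z \<bullet> e_path I) \<in> K_ideal W S"
      using z that e_path_closed ideal_closed(3,4)[OF ideal_K] by blast
    then have "e_path J \<bullet> (z \<bullet> e_path I) \<in> ?G" using K_comb_torsion[OF comb that] comb that by blast
    then show ?thesis using ring.genideal_self[OF ring_R GC] by blast
  qed
  then have "(\<Sum>J \<in> finitary W S. \<Sum>I \<in> finitary W S. e_path J \<bullet> (z \<bullet> e_path I)) \<in> Idl\<^bsub>R\<^esub> ?G"
    by (intro ideal_sum[OF ideal_G])
  moreover have "(\<Sum>J \<in> finitary W S. \<Sum>I \<in> finitary W S. e_path J \<bullet> (z \<bullet> e_path I)) = z"
    using one_conv[OF zC] conv_one[OF zC]
    by (simp add: conv_sum_right[symmetric] conv_sum_left[symmetric])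
  ultimately show "z \<in> Idl\<^bsub>R\<^esub> ?G" by simp
qed

lemma sandwiched_torsion:
  assumes p: "p \<in> path_combs W S I J" and o: "is_ordering W S I cI" "is_ordering W S J cJ"
    and J: "ups_chain cJ \<otimes>\<^bsub>R\<^esub> p \<otimes>\<^bsub>R\<^esub> del_chain cI \<in> Idl\<^bsub>R\<^esub> (J_rels W S rex a)"
  shows "P_torsion W S rex a p"
  using J path_combsD(1)[OF p] chain_closed[OF o(1)] chain_closed[OF o(2)]
  by (intro P_torsionI[OF p o P_polys_one]) (simp add: mult_conv Jid_def)

end

theorem proposition7p1:
  fixes W :: "('w, 'm) monoid_scheme"
    and S :: "'w set"
    and rex :: "'w set list \<Rightarrow> 'w list"
    and a :: "'w list \<Rightarrow> 'w list \<Rightarrow> int poly"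
  assumes coxeter: "coxeter_system W S"
    and finite_S: "finite S"
    and rex: "\<And>I cs. I \<in> finitary W S \<Longrightarrow> is_ordering W S I cs \<Longrightarrow> adapted_expr W S cs (rex cs)"
    and a: "\<And>I cs. I \<in> finitary W S \<Longrightarrow> is_ordering W S I cs \<Longrightarrow>
              x_elt W I = subword_comb a (x_word W S) (rex cs)"
  shows "(\<forall>I \<in> finitary W S. \<forall>J \<in> finitary W S. \<forall>p \<in> path_combs W S I J. \<forall>cI cJ.
            is_ordering W S I cI \<longrightarrow> is_ordering W S J cJ \<longrightarrow>
            ups_chain cJ \<otimes>\<^bsub>path_alg W S\<^esub> p \<otimes>\<^bsub>path_alg W S\<^esub> del_chain cI
              \<in> Idl\<^bsub>path_alg W S\<^esub> (J_rels W S rex a) \<longrightarrow>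
            P_torsion W S rex a p) \<and>
         K_ideal W S =
           Idl\<^bsub>path_alg W S\<^esub> (J_rels W S rex a \<union>
             (\<Union>I \<in> finitary W S. \<Union>J \<in> finitary W S.
                {p \<in> path_combs W S I J. P_torsion W S rex a p}))"
proof -
  interpret hasse_relations W S rex a
    by unfold_locales (fact coxeter finite_S rex a)+
  show ?thesis using sandwiched_torsion K_ideal_generated by blast
qed

end
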